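(* Let $N,n,m$ be positive integers and let $w$ be an integer with $2\le w\le n$. Let $s\ge 2$ and let $w_1,\dots,w_s$ be positive integers with $w_1+\dots+w_s=w$. For $p\in\{1,\dots,w\}$ let $m_p=\#\{i\in[s]: w_i=p\}$ be the multiplicity of $p$ in the multiset $\{w_1,\dots,w_s\}$, and set $$M=\frac{1}{\prod_{p=1}^{w}m_p!}\cdot\frac{w!}{w_1!\cdots w_s!}.$$ For $1\le k\le \lfloor n/w\rfloor\wedge w$ define $$\tilde\Gamma_k(w,n)=\sum_{j=0}^{w-k}\binom{w-k}{j}\prod_{\ell=1}^{k(w-1)-j-1}\left(1-\frac{\ell}{n-w}\right)\left[\frac{w}{n-w}\right]^{j}\sum_{\substack{i_1+\dots+i_k=j\\ i_r\ge 0}}\frac{j!}{i_1!\cdots i_k!}\prod_{\ell=1}^{k}\left[\frac{1}{i_\ell+1}\prod_{r=1}^{i_\ell}\Big(1-\frac{r}{w}\Big)\right],$$ and $\varphi_{w,n}(x)=1+\sum_{k=1}^{\lfloor n/w\rfloor\wedge w}\binom{w}{k}\tilde\Gamma_k(w,n)\,x^k$. Let $\tau$ be the first positive solution of $\varphi_{w,n}(x)-x\varphi_{w,n}'(x)=0$. Let $\pi_{\mathcal G_s}(m)$ be the chromatic polynomial, evaluated at $m$, of the complete $s$-partite graph $\mathcal G_s$ whose parts have sizes $w_1,\dots,w_s$, and let $q=1-\pi_{\mathcal G_s}(m)/m^{w}$. Then a separating hash family $\mathrm{SHF}(N;n,m,\{w_1,\dots,w_s\})$ exists as soon as $$N\ge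 \frac{\ln[\varphi_{w,n}'(\tau)]+(w-1)\ln(n-w)-\ln((w-1)!)+\ln M}{\ln(1/q)}.$$ Moreover, the Moser–Tardos algorithm for SHF finds such a separating hash family in an expected time which is polynomial in $N$, $n$ and $m$ for any fixed $w$.
   Context: $[m]=\{1,\dots,m\}$, and $a\wedge b=\min(a,b)$. A disjoint family of type $(w_1,\dots,w_s)$ is a family $S=\{W_1,\dots,W_s\}$ of pairwise disjoint subsets of $[n]$ with $|W_i|=w_i$. For an $N\times n$ matrix $A$, $A|_S$ denotes the $N\times w$ submatrix formed by the columns with indices in $W_1\cup\dots\cup W_s$. A row of $A|_S$ separates $S$ if for every pair $\{r,r'\}\subseteq[s]$ with $r\ne r'$, the entries of that row in columns of $W_r$ are all different from its entries in columns of $W_{r'}$. A separating hash family $\mathrm{SHF}(N;n,m,\{w_1,\dots,w_s\})$ is an $N\times n$ matrix $A$ with entries in $[m]$ such that for every disjoint family $S$ of type $(w_1,\dots,w_s)$ some row of $A|_S$ separates $S$. Let $E_S$ be the bad event that no row of $A|_S$ separates $S$. The Moser–Tardos algorithm for SHF: Step 0: choose all $Nn$ entries of an $N\times n$ matrix independently and uniformly at random from $[m]$, obtaining $A_0$. Step $k\ge1$: given $A_{k-1}$, check all events $E_S$ over all disjoint families $S$ of type $(w_1,\dots,w_s)$; if some $E_S$ occurs, choose one such $S$ and resample independently and uniformly from $[m]$ all entries of $A_{k-1}|_S$, leaving the other entries unchanged, obtaining $A_k$; if no $E_S$ occurs, stop and output the current matrix. *)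

theory Defs
  imports "HOL-Probability.Probability"
begin

section \<open>Separating hash families\<close>

text \<open>
  An \<open>N \<times> n\<close> matrix with entries in \<open>[m]\<close> is a function on index pairs (row, column), both
  counted from 1. A type \<open>(w\<^sub>1, \<dots>, w\<^sub>s)\<close> is a function \<open>ws\<close> of which only the values on
  \<open>{1..s}\<close> are used.
\<close>

type_synonym matrix = "nat \<times> nat \<Rightarrow> nat"
type_synonym family = "nat set set"

definition matrices :: "nat \<Rightarrow> nat \<Rightarrow> nat \<Rightarrow> matrix set" where
  "matrices N n m = ({1..N} \<times> {1..n}) \<rightarrow>\<^sub>E {1..m}"

definition disjoint_families :: "nat \<Rightarrow> nat \<Rightarrow> (nat \<Rightarrow> nat) \<Rightarrow> family set" where
  "disjoint_families n s ws =
     {W ` {1..s} | W. (\<forall>i\<in>{1..s}. W i \<subseteq> {1..n} \<and> card (W i) = ws i) \<and>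
                      disjoint_family_on W {1..s}}"

definition row_separates :: "matrix \<Rightarrow> nat \<Rightarrow> family \<Rightarrow> bool" where
  "row_separates A i S \<longleftrightarrow>
     (\<forall>W\<in>S. \<forall>W'\<in>S. W \<noteq> W' \<longrightarrow> (\<forall>c\<in>W. \<forall>c'\<in>W'. A (i, c) \<noteq> A (i, c')))"

definition is_SHF :: "nat \<Rightarrow> nat \<Rightarrow> nat \<Rightarrow> nat \<Rightarrow> (nat \<Rightarrow> nat) \<Rightarrow> matrix \<Rightarrow> bool" where
  "is_SHF N n m s ws A \<longleftrightarrow>
     A \<in> matrices N n m \<and>
     (\<forall>S\<in>disjoint_families n s ws. \<exists>i\<in>{1..N}. row_separates A i S)"

definition bad_event :: "nat \<Rightarrow> family \<Rightarrow> matrix \<Rightarrow> bool" where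
  "bad_event N S A \<longleftrightarrow> \<not> (\<exists>i\<in>{1..N}. row_separates A i S)"


section \<open>The chromatic polynomial\<close>

definition proper_colourings :: "'a set \<Rightarrow> 'a set set \<Rightarrow> nat \<Rightarrow> ('a \<Rightarrow> nat) set" where
  "proper_colourings V E k = {f \<in> V \<rightarrow>\<^sub>E {1..k}. \<forall>u v. {u, v} \<in> E \<longrightarrow> f u \<noteq> f v}"

definition chromatic_polynomial :: "'a set \<Rightarrow> 'a set set \<Rightarrow> real poly" where
  "chromatic_polynomial V E =
     (THE p. \<forall>k::nat. poly p (real k) = real (card (proper_colourings V E k)))"

text \<open>
  The description is proper for finite graphs: the number of proper colourings with a prescribed
  set of used colours depends only on the size of that set, so the number of all proper colourings
  with \<open>k\<close> colours is a combination of binomial coefficients \<open>k choose j\<close> with \<open>j \<le> card V\<close>.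
\<close>

lemma card_proper_colourings_image:
  assumes "finite V" "\<Union>E \<subseteq> V" "B \<subseteq> {1..k}"
  shows "card {f \<in> proper_colourings V E k. f ` V = B} =
         card {f \<in> proper_colourings V E (card B). f ` V = {1..card B}}"
proof -
  have fB: "finite B" using assms(3) finite_subset by blast
  obtain h where h: "bij_betw h {1..card B} B"
    using fB ex_bij_betw_nat_finite_1 by blast
  define h' where "h' = inv_into {1..card B} h"
  have h': "bij_betw h' B {1..card B}"
    unfolding h'_def by (rule bij_betw_inv_into[OF h])
  have hh': "h (h' b) = b" if "b \<in> B" for b
    unfolding h'_def using that h by (metis bij_betw_inv_into_right)
  have h'h: "h' (h j) = j" if "j \<in> {1..card B}" for j
    unfolding h'_def using that h by (metis bij_betw_inv_into_left)
  have EV: "u \<in> V" "v \<in> V" if "{u, v} \<in> E" for u v using that assms(2) by auto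
  have hB: "h j \<in> B" if "j \<in> {1..card B}" for j using that h bij_betwE by blast
  have h'B: "h' b \<in> {1..card B}" if "b \<in> B" for b using that h' bij_betwE by blast
  show ?thesis
  proof (rule bij_betw_same_card[where f = "\<lambda>f. restrict (h' \<circ> f) V"],
         rule bij_betw_byWitness[where f' = "\<lambda>f. restrict (h \<circ> f) V"])
    show "\<forall>f\<in>{f \<in> proper_colourings V E k. f ` V = B}.
            restrict (h \<circ> restrict (h' \<circ> f) V) V = f"
      by (auto simp: proper_colourings_def fun_eq_iff restrict_def PiE_def extensional_def hh')
    show "\<forall>f\<in>{f \<in> proper_colourings V E (card B). f ` V = {1..card B}}.
            restrict (h' \<circ> restrict (h \<circ> f) V) V = f"
    proof
      fix f assume f: "f \<in> {f \<in> proper_colourings V E (card B). f ` V = {1..card B}}"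
      then have "f \<in> extensional V" "\<And>v. v \<in> V \<Longrightarrow> f v \<in> {1..card B}"
        by (auto simp: proper_colourings_def PiE_def)
      then show "restrict (h' \<circ> restrict (h \<circ> f) V) V = f"
        by (auto simp: fun_eq_iff restrict_def extensional_def h'h)
    qed
    show "(\<lambda>f. restrict (h' \<circ> f) V) ` {f \<in> proper_colourings V E k. f ` V = B}
            \<subseteq> {f \<in> proper_colourings V E (card B). f ` V = {1..card B}}"
    proof (rule image_subsetI)
      fix f assume f: "f \<in> {f \<in> proper_colourings V E k. f ` V = B}"
      have fb: "f v \<in> B" if "v \<in> V" for v using f that by auto
      have ne: "h' (f u) \<noteq> h' (f v)" if "{u, v} \<in> E" for u v
      proof -
        have "f u \<noteq> f v" using f that by (simp add: proper_colourings_def)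
        then show ?thesis using hh'[OF fb[OF EV(1)[OF that]]] hh'[OF fb[OF EV(2)[OF that]]] by metis
      qed
      have im: "restrict (h' \<circ> f) V ` V = {1..card B}"
      proof -
        have "restrict (h' \<circ> f) V ` V = h' ` (f ` V)" by (simp add: image_comp)
        also have "\<dots> = {1..card B}" using f h' by (simp add: bij_betw_def)
        finally show ?thesis .
      qed
      show "restrict (h' \<circ> f) V \<in> {f \<in> proper_colourings V E (card B). f ` V = {1..card B}}"
        unfolding proper_colourings_def using im
        by (intro CollectI conjI PiE_I allI impI) (simp_all add: ne EV h'B[OF fb] del: atLeastAtMost_iff One_nat_def)
    qed
    show "(\<lambda>f. restrict (h \<circ> f) V) ` {f \<in> proper_colourings V E (card B). f ` V = {1..card B}}
            \<subseteq> {f \<in> proper_colourings V E k. f ` V = B}"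
    proof (rule image_subsetI)
      fix f assume f: "f \<in> {f \<in> proper_colourings V E (card B). f ` V = {1..card B}}"
      have fb: "f v \<in> {1..card B}" if "v \<in> V" for v using f that by blast
      have ne: "h (f u) \<noteq> h (f v)" if "{u, v} \<in> E" for u v
      proof -
        have "f u \<noteq> f v" using f that by (simp add: proper_colourings_def)
        then show ?thesis using h'h[OF fb[OF EV(1)[OF that]]] h'h[OF fb[OF EV(2)[OF that]]] by metis
      qed
      have im: "restrict (h \<circ> f) V ` V = B"
      proof -
        have "restrict (h \<circ> f) V ` V = h ` (f ` V)" by (simp add: image_comp)
        also have "\<dots> = B" using f h by (simp add: bij_betw_def)
        finally show ?thesis .
      qed
      have "h (f v) \<in> {1..k}" if "v \<in> V" for v using hB[OF fb[OF that]] assms(3) by blast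
      then show "restrict (h \<circ> f) V \<in> {f \<in> proper_colourings V E k. f ` V = B}"
        unfolding proper_colourings_def using im
        by (intro CollectI conjI PiE_I allI impI) (simp_all add: ne EV del: atLeastAtMost_iff One_nat_def)
    qed
  qed
qed

lemma poly_chromatic_polynomial:
  assumes "finite V" "\<Union>E \<subseteq> V"
  shows "poly (chromatic_polynomial V E) (real k) = real (card (proper_colourings V E k))"
proof -
  define a where "a j = card {f \<in> proper_colourings V E j. f ` V = {1..j}}" for j
  define p :: "real poly" where
    "p = (\<Sum>j\<le>card V. smult (real (a j) / fact j) (\<Prod>i=0..<j. [:- real i, 1:]))"
  have fin: "finite (proper_colourings V E k)" for k
    unfolding proper_colourings_def using assms(1) by (simp add: finite_PiE)
  have a0: "a j = 0" if "j > card V" for j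
  proof -
    have "f ` V \<noteq> {1..j}" for f :: "'a \<Rightarrow> nat"
      using card_image_le[OF assms(1), of f] that by fastforce
    then show ?thesis by (simp add: a_def)
  qed
  have p: "poly p (real k) = real (card (proper_colourings V E k))" for k
  proof -
    have "proper_colourings V E k =
          (\<Union>B\<in>Pow {1..k}. {f \<in> proper_colourings V E k. f ` V = B})"
      by (auto simp: proper_colourings_def PiE_def Pi_def)
    then have "card (proper_colourings V E k) =
               card (\<Union>B\<in>Pow {1..k}. {f \<in> proper_colourings V E k. f ` V = B})"
      by simp
    also have "\<dots> = (\<Sum>B\<in>Pow {1..k}. card {f \<in> proper_colourings V E k. f ` V = B})"
      by (rule card_UN_disjoint) (auto simp: fin)
    also have "\<dots> = (\<Sum>B\<in>Pow {1..k}. a (card B))"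
      unfolding a_def
      by (intro sum.cong refl card_proper_colourings_image) (use assms in auto)
    also have "\<dots> = (\<Sum>j\<in>{..k}. \<Sum>B\<in>{B \<in> Pow {1..k}. card B = j}. a (card B))"
      by (rule sum.group[symmetric]) (auto dest: card_mono[OF finite_atLeastAtMost])
    also have "\<dots> = (\<Sum>j\<le>k. (k choose j) * a j)"
    proof (intro sum.cong refl)
      fix j
      have "(\<Sum>B\<in>{B \<in> Pow {1..k}. card B = j}. a (card B)) =
            card {B. B \<subseteq> {1..k} \<and> card B = j} * a j" by simp
      then show "(\<Sum>B\<in>{B \<in> Pow {1..k}. card B = j}. a (card B)) = (k choose j) * a j"
        by (simp add: n_subsets)
    qed
    also have "\<dots> = (\<Sum>j\<le>max k (card V). (k choose j) * a j)"
      by (rule sum.mono_neutral_left) auto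
    also have "\<dots> = (\<Sum>j\<le>card V. (k choose j) * a j)"
      by (rule sum.mono_neutral_right) (auto simp: a0)
    finally have *: "card (proper_colourings V E k) = (\<Sum>j\<le>card V. (k choose j) * a j)" .
    show ?thesis
      unfolding * p_def
      by (simp add: poly_sum poly_prod binomial_gbinomial gbinomial_prod_rev algebra_simps)
  qed
  have unique: "p' = p" if "\<forall>k::nat. poly p' (real k) = real (card (proper_colourings V E k))" for p'
  proof (rule ccontr)
    assume "p' \<noteq> p"
    then have "finite {x. poly (p' - p) x = 0}" by (intro poly_roots_finite) simp
    moreover have "range real \<subseteq> {x. poly (p' - p) x = 0}" using that p by auto
    moreover have "infinite (range real)" by (simp add: range_inj_infinite inj_on_def)
    ultimately show False using finite_subset by blast
  qed
  have "chromatic_polynomial V E = p"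
    unfolding chromatic_polynomial_def by (rule the_equality) (use p unique in auto)
  then show ?thesis using p by simp
qed

definition multipartite_vertices :: "nat \<Rightarrow> (nat \<Rightarrow> nat) \<Rightarrow> (nat \<times> nat) set" where
  "multipartite_vertices s ws = (SIGMA i:{1..s}. {1..ws i})"

definition multipartite_edges :: "nat \<Rightarrow> (nat \<Rightarrow> nat) \<Rightarrow> (nat \<times> nat) set set" where
  "multipartite_edges s ws =
     {{u, v} | u v. u \<in> multipartite_vertices s ws \<and> v \<in> multipartite_vertices s ws \<and>
                    fst u \<noteq> fst v}"


section \<open>The quantities in the bound\<close>

definition multiplicity_of_size :: "nat \<Rightarrow> (nat \<Rightarrow> nat) \<Rightarrow> nat \<Rightarrow> nat" where
  "multiplicity_of_size s ws p = card {i \<in> {1..s}. ws i = p}"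

definition shf_M :: "nat \<Rightarrow> nat \<Rightarrow> (nat \<Rightarrow> nat) \<Rightarrow> real" where
  "shf_M w s ws =
     1 / (\<Prod>p=1..w. fact (multiplicity_of_size s ws p)) * (fact w / (\<Prod>i=1..s. fact (ws i)))"

definition weak_compositions :: "nat \<Rightarrow> nat \<Rightarrow> (nat \<Rightarrow> nat) set" where
  "weak_compositions k j = {i \<in> {1..k} \<rightarrow>\<^sub>E {0..j}. (\<Sum>l=1..k. i l) = j}"

text \<open>
  In the range \<open>1 \<le> k\<close>, \<open>j \<le> w - k\<close> the upper limit \<open>k(w-1)-j-1\<close> of the first product is at
  least \<open>-1\<close>; where it is \<open>-1\<close> the truncated subtraction gives 0, and the product is empty
  as well.
\<close>

definition shf_Gamma :: "nat \<Rightarrow> nat \<Rightarrow> nat \<Rightarrow> real" where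
  "shf_Gamma w n k =
     (\<Sum>j=0..w-k.
        real ((w - k) choose j) *
        (\<Prod>l=1..k*(w-1)-j-1. 1 - real l / (real n - real w)) *
        (real w / (real n - real w)) ^ j *
        (\<Sum>i\<in>weak_compositions k j.
           fact j / (\<Prod>l=1..k. fact (i l)) *
           (\<Prod>l=1..k. 1 / (real (i l) + 1) * (\<Prod>r=1..i l. 1 - real r / real w))))"

definition shf_phi :: "nat \<Rightarrow> nat \<Rightarrow> real \<Rightarrow> real" where
  "shf_phi w n x = 1 + (\<Sum>k=1..min (n div w) w. real (w choose k) * shf_Gamma w n k * x ^ k)"

definition first_positive_solution :: "(real \<Rightarrow> real) \<Rightarrow> real \<Rightarrow> bool" where
  "first_positive_solution F \<tau> \<longleftrightarrow> 0 < \<tau> \<and> F \<tau> = 0 \<and> (\<forall>x. 0 < x \<and> x < \<tau> \<longrightarrow> F x \<noteq> 0)"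

definition shf_q :: "nat \<Rightarrow> nat \<Rightarrow> nat \<Rightarrow> (nat \<Rightarrow> nat) \<Rightarrow> real" where
  "shf_q w m s ws =
     1 - poly (chromatic_polynomial (multipartite_vertices s ws) (multipartite_edges s ws)) (real m)
         / real m ^ w"


section \<open>The Moser--Tardos algorithm\<close>

text \<open>
  The source of randomness is a sequence of independent \<open>N \<times> n\<close> matrices with independent
  uniform entries: \<open>\<omega> 0\<close> is the initial matrix, and Step \<open>k\<close> takes the new values of the resampled
  entries from \<open>\<omega> k\<close>.
\<close>

definition randomness :: "nat \<Rightarrow> nat \<Rightarrow> nat \<Rightarrow> (nat \<Rightarrow> matrix) measure" where
  "randomness N n m =
     (\<Pi>\<^sub>M k\<in>UNIV. \<Pi>\<^sub>M e\<in>{1..N} \<times> {1..n}. uniform_count_measure {1..m})"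

definition some_bad :: "nat \<Rightarrow> nat \<Rightarrow> nat \<Rightarrow> (nat \<Rightarrow> nat) \<Rightarrow> matrix \<Rightarrow> bool" where
  "some_bad N n s ws A \<longleftrightarrow> (\<exists>S\<in>disjoint_families n s ws. bad_event N S A)"

definition resample :: "nat \<Rightarrow> family \<Rightarrow> matrix \<Rightarrow> matrix \<Rightarrow> matrix" where
  "resample N S X A = (\<lambda>e. if e \<in> {1..N} \<times> \<Union>S then X e else A e)"

text \<open>
  The choice of an occurring bad event is left open. A selection rule may use the whole
  history \<open>[A\<^sub>0, \<dots>, A\<^sub>k\<^sub>-\<^sub>1]\<close> of the run.
\<close>

type_synonym selection = "matrix list \<Rightarrow> family"

definition valid_selection ::
  "nat \<Rightarrow> nat \<Rightarrow> nat \<Rightarrow> nat \<Rightarrow> (nat \<Rightarrow> nat) \<Rightarrow> selection \<Rightarrow> bool" where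
  "valid_selection N n m s ws sel \<longleftrightarrow>
     (\<forall>h. h \<noteq> [] \<and> set h \<subseteq> matrices N n m \<and> some_bad N n s ws (last h) \<longrightarrow>
          sel h \<in> disjoint_families n s ws \<and> bad_event N (sel h) (last h))"

text \<open>After the algorithm has stopped, the current matrix is repeated forever.\<close>

fun mt_history ::
  "nat \<Rightarrow> nat \<Rightarrow> nat \<Rightarrow> (nat \<Rightarrow> nat) \<Rightarrow> selection \<Rightarrow> (nat \<Rightarrow> matrix) \<Rightarrow> nat \<Rightarrow> matrix list" where
  "mt_history N n s ws sel \<omega> 0 = [\<omega> 0]"
| "mt_history N n s ws sel \<omega> (Suc k) =
     (let h = mt_history N n s ws sel \<omega> k; A = last h
      in h @ [if some_bad N n s ws A then resample N (sel h) (\<omega> (Suc k)) A else A])"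

definition mt_matrix ::
  "nat \<Rightarrow> nat \<Rightarrow> nat \<Rightarrow> (nat \<Rightarrow> nat) \<Rightarrow> selection \<Rightarrow> (nat \<Rightarrow> matrix) \<Rightarrow> nat \<Rightarrow> matrix" where
  "mt_matrix N n s ws sel \<omega> k = last (mt_history N n s ws sel \<omega> k)"

definition mt_stops ::
  "nat \<Rightarrow> nat \<Rightarrow> nat \<Rightarrow> (nat \<Rightarrow> nat) \<Rightarrow> selection \<Rightarrow> (nat \<Rightarrow> matrix) \<Rightarrow> bool" where
  "mt_stops N n s ws sel \<omega> \<longleftrightarrow> (\<exists>k. \<not> some_bad N n s ws (mt_matrix N n s ws sel \<omega> k))"

definition mt_output ::
  "nat \<Rightarrow> nat \<Rightarrow> nat \<Rightarrow> (nat \<Rightarrow> nat) \<Rightarrow> selection \<Rightarrow> (nat \<Rightarrow> matrix) \<Rightarrow> matrix" where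
  "mt_output N n s ws sel \<omega> =
     mt_matrix N n s ws sel \<omega> (LEAST k. \<not> some_bad N n s ws (mt_matrix N n s ws sel \<omega> k))"

text \<open>
  Running time is the number of elementary operations: drawing an entry uniformly from \<open>[m]\<close>,
  comparing two entries of the matrix, and listing a column index of a family. Checking all events
  means that, for every disjoint family, its columns are listed and all pairs of entries from
  different blocks are compared in every row.
\<close>

definition check_time :: "nat \<Rightarrow> nat \<Rightarrow> nat \<Rightarrow> (nat \<Rightarrow> nat) \<Rightarrow> nat" where
  "check_time N n s ws =
     card (disjoint_families n s ws) *
       ((\<Sum>r=1..s. ws r) + N * (\<Sum>r=1..s. \<Sum>r'=Suc r..s. ws r * ws r'))"

definition resample_time :: "nat \<Rightarrow> nat \<Rightarrow> (nat \<Rightarrow> nat) \<Rightarrow> nat" where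
  "resample_time N s ws = N * (\<Sum>r=1..s. ws r)"

text \<open>
  The time of Step \<open>k + 1\<close>. The step is carried out iff the algorithm has not stopped in an
  earlier step, that is, iff a bad event occurs in each of \<open>A\<^sub>0, \<dots>, A\<^sub>k\<^sub>-\<^sub>1\<close>.
\<close>

definition step_time ::
  "nat \<Rightarrow> nat \<Rightarrow> nat \<Rightarrow> (nat \<Rightarrow> nat) \<Rightarrow> selection \<Rightarrow> (nat \<Rightarrow> matrix) \<Rightarrow> nat \<Rightarrow> nat" where
  "step_time N n s ws sel \<omega> k =
     (if \<forall>i<k. some_bad N n s ws (mt_matrix N n s ws sel \<omega> i)
      then check_time N n s ws +
           (if some_bad N n s ws (mt_matrix N n s ws sel \<omega> k) then resample_time N s ws else 0)
      else 0)"

definition mt_time ::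
  "nat \<Rightarrow> nat \<Rightarrow> nat \<Rightarrow> (nat \<Rightarrow> nat) \<Rightarrow> selection \<Rightarrow> (nat \<Rightarrow> matrix) \<Rightarrow> ennreal" where
  "mt_time N n s ws sel \<omega> =
     of_nat (N * n) + (\<Sum>k. of_nat (step_time N n s ws sel \<omega> k))"

definition expected_mt_time ::
  "nat \<Rightarrow> nat \<Rightarrow> nat \<Rightarrow> nat \<Rightarrow> (nat \<Rightarrow> nat) \<Rightarrow> selection \<Rightarrow> ennreal" where
  "expected_mt_time N n m s ws sel = (\<integral>\<^sup>+\<omega>. mt_time N n s ws sel \<omega> \<partial>randomness N n m)"

definition poly3 :: "nat \<Rightarrow> (nat \<Rightarrow> nat \<Rightarrow> nat \<Rightarrow> real) \<Rightarrow> real \<Rightarrow> real \<Rightarrow> real \<Rightarrow> real" where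
  "poly3 d c x y z = (\<Sum>i\<le>d. \<Sum>j\<le>d. \<Sum>k\<le>d. c i j k * x ^ i * y ^ j * z ^ k)"

end

theory Submission
  imports Defs "HOL-Combinatorics.Multiset_Permutations"
begin

text \<open>
  The cluster-expansion criterion: the dependency graph joins two disjoint families that share a
  column, and the sum of \<open>\<mu>\<^sup>|\<^sup>I\<^sup>|\<close> over the independent sets \<open>I\<close> of families meeting a given family is
  exactly \<open>\<phi>(x)\<close> for \<open>x = \<mu> M (n - w)\<^sup>w\<^sup>-\<^sup>1 / (w - 1)!\<close>. A bad event has probability \<open>q\<^sup>N\<close>, so the
  criterion reads \<open>q\<^sup>N M (n - w)\<^sup>w\<^sup>-\<^sup>1 / (w - 1)! \<le> x / \<phi>(x)\<close>; the right-hand side at \<open>x = \<tau>\<close> is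
  \<open>1 / \<phi>'(\<tau>)\<close>, which is the bound on \<open>N\<close>.

  For the algorithm, the potential of a matrix is the sum, over all layered histories of dependent
  resamplings, of the probability that such a history is consistent with that matrix. Recording one
  more resampling is injective on histories, so the potential drops by at least 1 in expectation at
  each resampling; its initial expectation is at most the sum of \<open>\<mu>\<close> over all families, hence at
  most \<open>n choose w\<close>, because \<open>\<tau> \<le> (n - w)\<^sup>w\<^sup>-\<^sup>1 / (w - 1)!\<close>.
\<close>

section \<open>Resampling in the variable setting\<close>

text \<open>The selection rule may use the whole past, so the law of the current matrix is out of
  reach. The potential avoids it: it is a function of the current state alone, and the estimate for
  one step is the same whichever occurring event is chosen. Histories are read forwards from the
  current state. Resamplings of disjoint sets of cells commute, so a history is a heap of pieces
  with a single last piece, and its layers are a normal form in which every piece stands as late as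
  possible; histories that differ by commutations are thereby counted once. From a uniform state,
  redrawing the cells that a layer has just tested leaves a uniform state again. Hence weights
  average to products of probabilities, and their sum over all layered lists telescopes, one layer
  at a time, under the criterion. The equation for \<tau> comes from making the criterion as weak as
  possible: the coefficients of \<open>shf_phi\<close> are nonnegative, so x / \<phi>(x) is largest
  where \<phi>(x) = x \<phi>'(x).\<close>

definition upd :: "'c set \<Rightarrow> ('c \<Rightarrow> 'v) \<Rightarrow> ('c \<Rightarrow> 'v) \<Rightarrow> 'c \<Rightarrow> 'v" where
  "upd C X A = (\<lambda>c. if c \<in> C then X c else A c)"

locale resampling =
  fixes D :: "'c set" and B :: "'v set" and Ev :: "'e set"
    and vbl :: "'e \<Rightarrow> 'c set" and bad :: "'e \<Rightarrow> ('c \<Rightarrow> 'v) \<Rightarrow> bool"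
  assumes finite_D: "finite D" and finite_B: "finite B" and B_nonempty: "B \<noteq> {}"
    and finite_Ev: "finite Ev"
    and vbl_subset: "e \<in> Ev \<Longrightarrow> vbl e \<subseteq> D"
    and vbl_nonempty: "e \<in> Ev \<Longrightarrow> vbl e \<noteq> {}"
    and bad_cong: "e \<in> Ev \<Longrightarrow> (\<And>c. c \<in> vbl e \<Longrightarrow> A c = A' c) \<Longrightarrow> bad e A = bad e A'"
begin

section \<open>Averages over uniformly distributed states\<close>

definition states :: "('c \<Rightarrow> 'v) set" where
  "states = D \<rightarrow>\<^sub>E B"

definition avg :: "(('c \<Rightarrow> 'v) \<Rightarrow> real) \<Rightarrow> real" where
  "avg f = (\<Sum>A\<in>states. f A) / real (card states)"

lemma finite_states: "finite states"
  unfolding states_def using finite_D finite_B by (simp add: finite_PiE)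

lemma card_states_pos: "card states > 0"
  unfolding states_def using finite_D finite_B B_nonempty
  by (simp add: card_PiE prod_pos card_gt_0_iff)

lemma upd_in_states: "X \<in> states \<Longrightarrow> A \<in> states \<Longrightarrow> upd C X A \<in> states"
  unfolding states_def upd_def by (auto simp: PiE_iff extensional_def)

lemma avg_const: "avg (\<lambda>_. c) = c"
  unfolding avg_def using card_states_pos by simp

lemma avg_cong: "(\<And>A. A \<in> states \<Longrightarrow> f A = g A) \<Longrightarrow> avg f = avg g"
  unfolding avg_def by (metis (mono_tags, lifting) sum.cong)

lemma avg_cmult: "avg (\<lambda>A. c * f A) = c * avg f"
  unfolding avg_def by (simp add: sum_distrib_left)

lemma avg_mult_const: "avg (\<lambda>A. f A * c) = avg f * c"
  using avg_cmult[of c f] by (simp add: mult.commute)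

lemma avg_nonneg: "(\<And>A. A \<in> states \<Longrightarrow> f A \<ge> 0) \<Longrightarrow> avg f \<ge> 0"
  unfolding avg_def by (simp add: sum_nonneg)

lemma avg_sum: "avg (\<lambda>A. \<Sum>i\<in>J. f i A) = (\<Sum>i\<in>J. avg (f i))"
  unfolding avg_def by (subst sum.swap) (simp add: sum_divide_distrib)

text \<open>
  Exchanging the cells in \<open>C\<close> between two states is an involution; this replaces Fubini arguments.
\<close>

lemma avg_avg_upd: "avg (\<lambda>A. avg (\<lambda>X. f (upd C X A) (upd C A X))) = avg (\<lambda>A. avg (\<lambda>X. f A X))"
proof -
  have "(\<Sum>(A, X)\<in>states \<times> states. f (upd C X A) (upd C A X)) = (\<Sum>(A, X)\<in>states \<times> states. f A X)"
    by (rule sum.reindex_bij_witness[where i = "\<lambda>(A, X). (upd C X A, upd C A X)"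
          and j = "\<lambda>(A, X). (upd C X A, upd C A X)"])
       (auto simp: upd_in_states, auto simp: upd_def fun_eq_iff)
  then show ?thesis
    unfolding avg_def by (simp add: sum.cartesian_product[symmetric] sum_divide_distrib[symmetric])
qed

text \<open>All cells that \<open>g\<close> reads are redrawn before \<open>f\<close> looks at the
  state, so the test and the later average decouple.\<close>

lemma avg_mult_avg_upd:
  assumes "\<And>A A'. (\<And>c. c \<in> C \<Longrightarrow> A c = A' c) \<Longrightarrow> g A = g A'"
  shows "avg (\<lambda>A. g A * avg (\<lambda>X. f (upd C X A))) = avg g * avg f"
proof -
  have g: "g (upd C A X) = g A" for A X
    by (rule assms) (simp add: upd_def)
  have "avg (\<lambda>A. avg (\<lambda>X. f (upd C X A) * g (upd C A X))) = avg (\<lambda>A. avg (\<lambda>X. f A * g X))"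
    by (rule avg_avg_upd)
  then show ?thesis by (simp add: g avg_cmult avg_mult_const mult.commute)
qed

lemma avg_mult_indep:
  assumes "\<And>A A'. (\<And>c. c \<in> C \<Longrightarrow> A c = A' c) \<Longrightarrow> g A = g A'"
    and "\<And>A A'. (\<And>c. c \<notin> C \<Longrightarrow> A c = A' c) \<Longrightarrow> f A = f A'"
  shows "avg (\<lambda>A. g A * f A) = avg g * avg f"
proof -
  have "f (upd C X A) = f A" for A X
    by (rule assms(2)) (simp add: upd_def)
  then show ?thesis
    using avg_mult_avg_upd[of C g f, OF assms(1)] by (simp add: avg_const)
qed

section \<open>Resampling operators and the weight of a history\<close>

definition prob :: "'e \<Rightarrow> real" where
  "prob e = avg (\<lambda>A. of_bool (bad e A))"

definition touch :: "'e \<Rightarrow> 'e set \<Rightarrow> bool" where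
  "touch e I \<longleftrightarrow> (\<exists>e'\<in>I. vbl e \<inter> vbl e' \<noteq> {})"

definition indep :: "'e set \<Rightarrow> bool" where
  "indep I \<longleftrightarrow> I \<subseteq> Ev \<and> pairwise (\<lambda>e e'. vbl e \<inter> vbl e' = {}) I"

definition cells :: "'e set \<Rightarrow> 'c set" where
  "cells I = (\<Union>e\<in>I. vbl e)"

text \<open>An operator on functions of the state rather than a probability on paths: commutation of
  resamplings then becomes an identity of operators, \<open>resample_op_Un\<close>.\<close>

definition resample_op :: "'e set \<Rightarrow> (('c \<Rightarrow> 'v) \<Rightarrow> real) \<Rightarrow> ('c \<Rightarrow> 'v) \<Rightarrow> real" where
  "resample_op I f A = of_bool (\<forall>e\<in>I. bad e A) * avg (\<lambda>X. f (upd (cells I) X A))"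

text \<open>The head layer is performed first: its events must all hold in \<open>A\<close>, then
  its cells are redrawn and the rest of the list is tried on the new state. The value is the chance
  that the history can be carried out from \<open>A\<close>.\<close>

fun weight :: "'e set list \<Rightarrow> ('c \<Rightarrow> 'v) \<Rightarrow> real" where
  "weight [] A = 1"
| "weight (I # ls) A = resample_op I (weight ls) A"

lemma weight_Cons: "weight (I # ls) = resample_op I (weight ls)"
  by (rule ext) (rule weight.simps)

lemma prob_nonneg: "prob e \<ge> 0"
  unfolding prob_def by (rule avg_nonneg) simp

text \<open>Neighbourhoods are inclusive: an event is its own neighbour, so a repeated resampling of
  the same event goes into a different layer.\<close>

lemma touch_self: "e \<in> Ev \<Longrightarrow> e \<in> I \<Longrightarrow> touch e I"
  unfolding touch_def by (rule bexI[of _ e]) (auto simp: vbl_nonempty)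

lemma bad_all_cong:
  assumes "I \<subseteq> Ev" "\<And>c. c \<in> cells I \<Longrightarrow> A c = A' c"
  shows "(\<forall>e\<in>I. bad e A) \<longleftrightarrow> (\<forall>e\<in>I. bad e A')"
proof -
  have "bad e A = bad e A'" if "e \<in> I" for e
    by (rule bad_cong) (use assms that in \<open>auto simp: cells_def\<close>)
  then show ?thesis by simp
qed

text \<open>Redrawing the cells of \<open>I\<close> cannot affect the events of \<open>J\<close>,
  and two redraws of disjoint sets of cells amount to one redraw of the union. Used in both
  directions, this exchanges the two operators.\<close>

lemma resample_op_Un:
  assumes "I \<subseteq> Ev" "J \<subseteq> Ev" "cells I \<inter> cells J = {}"
  shows "resample_op I (resample_op J f) A = resample_op (I \<union> J) f A"
proof -
  have b: "(\<forall>e\<in>J. bad e (upd (cells I) X A)) \<longleftrightarrow> (\<forall>e\<in>J. bad e A)" for X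
    by (rule bad_all_cong) (use assms in \<open>auto simp: upd_def\<close>)
  have u: "upd (cells J) Y (upd (cells I) X A) = upd (cells (I \<union> J)) (upd (cells I) X Y) A" for X Y
    using assms(3) by (auto simp: upd_def cells_def fun_eq_iff)
  have "resample_op I (resample_op J f) A =
    of_bool (\<forall>e\<in>I \<union> J. bad e A) *
      avg (\<lambda>X. avg (\<lambda>Y. f (upd (cells (I \<union> J)) (upd (cells I) X Y) A)))"
    unfolding resample_op_def b u avg_cmult by (simp add: ball_Un)
  \<comment> \<open>Exchanging the cells of \<open>I\<close> between \<open>X\<close> and
    \<open>Y\<close> shows that the composite \<open>upd (cells I) X Y\<close> is again
    uniform.\<close>
  also have "avg (\<lambda>X. avg (\<lambda>Y. f (upd (cells (I \<union> J)) (upd (cells I) X Y) A))) =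
      avg (\<lambda>X. f (upd (cells (I \<union> J)) X A))"
    using avg_avg_upd[of "\<lambda>_ Z. f (upd (cells (I \<union> J)) Z A)" "cells I"] by (simp add: avg_const)
  finally show ?thesis by (simp add: resample_op_def)
qed

lemma weight_nonneg: "A \<in> states \<Longrightarrow> weight ls A \<ge> 0"
  by (induction ls arbitrary: A) (auto simp: resample_op_def upd_in_states intro!: avg_nonneg)

lemma weight_cong:
  assumes "\<And>I. I \<in> set ls \<Longrightarrow> I \<subseteq> Ev" "\<And>I c. I \<in> set ls \<Longrightarrow> c \<in> cells I \<Longrightarrow> A c = A' c"
  shows "weight ls A = weight ls A'"
  using assms
proof (induction ls arbitrary: A A')
  case (Cons I ls)
  have b: "(\<forall>e\<in>I. bad e A) \<longleftrightarrow> (\<forall>e\<in>I. bad e A')"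
    by (rule bad_all_cong) (use Cons.prems in auto)
  have "weight ls (upd (cells I) X A) = weight ls (upd (cells I) X A')" for X
    by (rule Cons.IH) (use Cons.prems in \<open>auto simp: upd_def\<close>)
  then show ?case by (simp add: resample_op_def b)
qed simp

lemma avg_bad_all:
  assumes "indep I"
  shows "avg (\<lambda>A. of_bool (\<forall>e\<in>I. bad e A)) = (\<Prod>e\<in>I. prob e)"
proof -
  have "finite I" using assms finite_Ev by (auto simp: indep_def finite_subset)
  then show ?thesis using assms
  proof (induction I)
    case empty
    then show ?case by (simp add: avg_const)
  next
    case (insert e I)
    have e: "e \<in> Ev" and I: "I \<subseteq> Ev" and disj: "\<And>e'. e' \<in> I \<Longrightarrow> vbl e \<inter> vbl e' = {}"
      and indI: "indep I"
      using insert.prems insert.hyps unfolding indep_def pairwise_insert by auto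
    have "avg (\<lambda>A. of_bool (\<forall>e\<in>insert e I. bad e A)) =
        avg (\<lambda>A. of_bool (bad e A) * of_bool (\<forall>e\<in>I. bad e A))"
      by (rule avg_cong) simp
    also have "\<dots> = avg (\<lambda>A. of_bool (bad e A)) * avg (\<lambda>A. of_bool (\<forall>e\<in>I. bad e A))"
    proof (rule avg_mult_indep[where C = "vbl e"])
      fix A A' :: "'c \<Rightarrow> 'v" assume "\<And>c. c \<in> vbl e \<Longrightarrow> A c = A' c"
      then have "bad e A = bad e A'" by (rule bad_cong[OF e])
      then show "of_bool (bad e A) = (of_bool (bad e A') :: real)" by simp
    next
      fix A A' :: "'c \<Rightarrow> 'v" assume "\<And>c. c \<notin> vbl e \<Longrightarrow> A c = A' c"
      then have "(\<forall>e\<in>I. bad e A) \<longleftrightarrow> (\<forall>e\<in>I. bad e A')"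
        by (intro bad_all_cong I) (use disj in \<open>auto simp: cells_def\<close>)
      then show "of_bool (\<forall>e\<in>I. bad e A) = (of_bool (\<forall>e\<in>I. bad e A') :: real)"
        by simp
    qed
    finally show ?case using insert.IH[OF indI] insert.hyps by (simp add: prob_def)
  qed
qed

text \<open>The test of the first layer reads only cells that are redrawn at once, so the state
  handed to the rest of the list is uniform and independent of that test.\<close>

lemma avg_weight:
  assumes "\<And>I. I \<in> set ls \<Longrightarrow> indep I"
  shows "avg (weight ls) = (\<Prod>I\<leftarrow>ls. \<Prod>e\<in>I. prob e)"
  using assms
proof (induction ls)
  case Nil
  then show ?case by (simp add: avg_const)
next
  case (Cons I ls)
  have I: "indep I" using Cons.prems by simp
  have "avg (weight (I # ls)) = avg (\<lambda>A. of_bool (\<forall>e\<in>I. bad e A)) * avg (weight ls)"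
    unfolding weight.simps resample_op_def
  proof (rule avg_mult_avg_upd)
    fix A A' :: "'c \<Rightarrow> 'v" assume "\<And>c. c \<in> cells I \<Longrightarrow> A c = A' c"
    then have "(\<forall>e\<in>I. bad e A) \<longleftrightarrow> (\<forall>e\<in>I. bad e A')"
      by (intro bad_all_cong) (use I in \<open>auto simp: indep_def\<close>)
    then show "of_bool (\<forall>e\<in>I. bad e A) = (of_bool (\<forall>e\<in>I. bad e A') :: real)"
      by simp
  qed
  also have "\<dots> = (\<Prod>J\<leftarrow>I # ls. \<Prod>e\<in>J. prob e)"
    using Cons by (simp add: avg_bad_all[OF I])
  finally show ?case .
qed

text \<open>
  A layered list records, most recent layer last, a resampling (the last layer) together with the
  earlier resamplings it depends on; every layer consists of resamplings of disjoint sets of cells.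
\<close>

fun layered :: "'e set list \<Rightarrow> bool" where
  "layered [] \<longleftrightarrow> False"
| "layered [I] \<longleftrightarrow> (\<exists>e\<in>Ev. I = {e})"
| "layered (I # J # ls) \<longleftrightarrow> indep I \<and> I \<noteq> {} \<and> (\<forall>e\<in>I. touch e J) \<and> layered (J # ls)"

definition touches :: "'e \<Rightarrow> 'e set list \<Rightarrow> bool" where
  "touches e ls \<longleftrightarrow> (\<exists>I\<in>set ls. touch e I)"

text \<open>A resampling that happens before everything recorded slides towards the end until the
  next layer is the first one that it touches, and joins or opens the layer in front of that one. If
  no layer is touched the list is returned as it is, a default value.\<close>

fun ins :: "'e \<Rightarrow> 'e set list \<Rightarrow> 'e set list" where
  "ins e [] = []"
| "ins e [I] = (if touch e I then [{e}, I] else [I])"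
| "ins e (I # J # ls) =
     (if touch e I then {e} # I # J # ls
      else if touch e J then insert e I # J # ls
      else I # ins e (J # ls))"

text \<open>Removes the first occurrence of \<open>e\<close>, and the layer as well if it becomes
  empty; a left inverse of \<open>ins e\<close> on the lists that \<open>e\<close> touches.\<close>

fun del :: "'e \<Rightarrow> 'e set list \<Rightarrow> 'e set list" where
  "del e [] = []"
| "del e (I # ls) = (if e \<in> I then (if I = {e} then ls else (I - {e}) # ls) else I # del e ls)"

lemma indep_single: "e \<in> Ev \<Longrightarrow> indep {e}"
  by (simp add: indep_def)

lemma indep_insert: "e \<in> Ev \<Longrightarrow> indep I \<Longrightarrow> \<not> touch e I \<Longrightarrow> indep (insert e I)"
  by (auto simp: indep_def touch_def pairwise_insert)

lemma layered_indep: "layered ls \<Longrightarrow> I \<in> set ls \<Longrightarrow> indep I"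
  by (induction ls rule: layered.induct) (auto simp: indep_single)

text \<open>Insertion behind a layer can only enlarge the layer next to it, so the events in front
  keep a neighbour there.\<close>

lemma ins_hd: "\<not> touch e I \<Longrightarrow> \<exists>I' ls'. ins e (I # ls) = I' # ls' \<and> I \<subseteq> I'"
  by (cases ls) auto

lemma touch_mono: "touch e I \<Longrightarrow> I \<subseteq> J \<Longrightarrow> touch e J"
  by (auto simp: touch_def)

lemma layered_ins: "e \<in> Ev \<Longrightarrow> layered ls \<Longrightarrow> layered (ins e ls)"
proof (induction ls rule: layered.induct)
  case (3 I J ls)
  show ?case
  proof (cases "touch e I \<or> touch e J")
    case True
    then show ?thesis using 3 by (auto simp: indep_single indep_insert)
  next
    case False
    obtain I' ls' where I': "ins e (J # ls) = I' # ls'" "J \<subseteq> I'"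
      using ins_hd False by blast
    have "layered (ins e (J # ls))" using 3 by simp
    then show ?thesis using False 3 I' by (auto intro: touch_mono)
  qed
qed (auto simp: indep_single)

text \<open>The inserted \<open>e\<close> touches itself. In \<open>potential_step\<close> this
  keeps the lists that receive \<open>e\<close> apart from those that are left alone.\<close>

lemma touches_ins: "e \<in> Ev \<Longrightarrow> touches e ls \<Longrightarrow> touches e (ins e ls)"
  by (induction ls rule: layered.induct) (auto simp: touches_def touch_self)

lemma length_ins: "length (ins e ls) \<le> Suc (length ls)"
  by (induction ls rule: layered.induct) auto

lemma ins_ne_single: "layered ls \<Longrightarrow> touches e ls \<Longrightarrow> ins e ls \<noteq> [{e}]"
  by (induction ls rule: layered.induct) (auto simp: touches_def)

text \<open>No layer before the place of insertion contains \<open>e\<close>, since \<open>e\<close>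
  would touch it; so the first occurrence is the inserted one.\<close>

lemma del_ins: "e \<in> Ev \<Longrightarrow> layered ls \<Longrightarrow> touches e ls \<Longrightarrow> del e (ins e ls) = ls"
proof (induction ls rule: layered.induct)
  case (3 I J ls)
  have *: "e \<in> I \<Longrightarrow> touch e I" using 3 touch_self by blast
  show ?case using 3 * by (auto simp: touches_def)
qed (auto simp: touches_def)

lemma cells_disjoint: "\<not> touch e I \<Longrightarrow> cells {e} \<inter> cells I = {}"
  by (auto simp: cells_def touch_def)

text \<open>The layers that \<open>e\<close> slides past have cells disjoint from those of
  \<open>e\<close>, and resamplings of disjoint cells commute without changing the weight.\<close>

lemma weight_ins:
  "e \<in> Ev \<Longrightarrow> layered ls \<Longrightarrow> touches e ls \<Longrightarrow> weight (ins e ls) A = resample_op {e} (weight ls) A"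
proof (induction ls arbitrary: A rule: layered.induct)
  case (3 I J ls)
  have sub: "I \<subseteq> Ev" "{e} \<subseteq> Ev" using 3 by (auto simp: indep_def)
  note prems = "3.prems" and IH0 = "3.IH"
  consider "touch e I" | "\<not> touch e I" "touch e J" | "\<not> touch e I" "\<not> touch e J" by blast
  then show ?case
  proof cases
    case 1
    then show ?thesis by (simp only: ins.simps if_True weight_Cons)
  next
    case 2
    have "weight (ins e (I # J # ls)) A = resample_op ({e} \<union> I) (weight (J # ls)) A"
      using 2 by simp
    also have "\<dots> = resample_op {e} (resample_op I (weight (J # ls))) A"
      by (rule resample_op_Un[symmetric]) (use sub cells_disjoint[OF 2(1)] in auto)
    finally show ?thesis by (simp only: weight_Cons)
  next
    case 3
    have IH: "weight (ins e (J # ls)) = resample_op {e} (weight (J # ls))"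
      by (rule ext, rule IH0) (use prems 3 in \<open>auto simp: touches_def\<close>)
    have "weight (ins e (I # J # ls)) A = resample_op I (resample_op {e} (weight (J # ls))) A"
      using 3 by (simp add: IH)
    also have "\<dots> = resample_op ({e} \<union> I) (weight (J # ls)) A"
      using resample_op_Un[of I "{e}" "weight (J # ls)" A] sub cells_disjoint[OF 3(1)]
      by (simp add: Un_commute Int_commute)
    also have "\<dots> = resample_op {e} (resample_op I (weight (J # ls))) A"
      by (rule resample_op_Un[symmetric]) (use sub cells_disjoint[OF 3(1)] in auto)
    finally show ?thesis by (simp only: weight_Cons)
  qed
qed (auto simp: touches_def)

text \<open>The bound on the length makes the potential a finite sum; \<open>T\<close> is the number
  of steps of the run that are still to be accounted for.\<close>

definition layered_lists :: "nat \<Rightarrow> 'e set list set" where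
  "layered_lists T = {ls. layered ls \<and> length ls \<le> T}"

lemma finite_layered_lists: "finite (layered_lists T)"
proof (rule finite_subset)
  show "layered_lists T \<subseteq> {ls. set ls \<subseteq> Pow Ev \<and> length ls \<le> T}"
    using layered_indep by (fastforce simp: layered_lists_def indep_def)
  show "finite {ls. set ls \<subseteq> Pow Ev \<and> length ls \<le> T}"
    by (rule finite_lists_length_le) (simp add: finite_Ev)
qed

definition potential :: "nat \<Rightarrow> ('c \<Rightarrow> 'v) \<Rightarrow> real" where
  "potential T A = (\<Sum>ls\<in>layered_lists T. weight ls A)"

lemma potential_nonneg: "A \<in> states \<Longrightarrow> potential T A \<ge> 0"
  unfolding potential_def by (simp add: sum_nonneg weight_nonneg)

text \<open>
  Prepending the resampling of \<open>e\<close> is injective on layered lists and misses the list \<open>[{e}]\<close>.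
\<close>

lemma potential_step:
  assumes A: "A \<in> states" and e: "e \<in> Ev" and bad: "bad e A"
  shows "1 + avg (\<lambda>X. potential T (upd (vbl e) X A)) \<le> potential (Suc T) A"
proof -
  \<comment> \<open>A list that \<open>e\<close> does not touch reads no redrawn cell, so its weight
    is the same before and after the resampling and it must stay fixed.\<close>
  define \<Phi> where "\<Phi> ls = (if touches e ls then ins e ls else ls)" for ls
  have lay: "layered ls" if "ls \<in> layered_lists T" for ls
    using that by (simp add: layered_lists_def)
  have touch\<Phi>: "touches e (\<Phi> ls) \<longleftrightarrow> touches e ls" for ls
    unfolding \<Phi>_def using touches_ins[OF e] by simp
  have inj: "inj_on \<Phi> (layered_lists T)"
  proof (rule inj_onI)
    fix ls ls' assume *: "ls \<in> layered_lists T" "ls' \<in> layered_lists T" "\<Phi> ls = \<Phi> ls'"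
    then have "touches e ls \<longleftrightarrow> touches e ls'" using touch\<Phi> by metis
    then show "ls = ls'"
      using * del_ins[OF e lay] unfolding \<Phi>_def by metis
  qed
  have sub: "\<Phi> ` layered_lists T \<subseteq> layered_lists (Suc T) - {[{e}]}"
  proof (rule image_subsetI)
    fix ls assume ls: "ls \<in> layered_lists T"
    have "\<Phi> ls \<noteq> [{e}]"
      using ins_ne_single[OF lay[OF ls]] touch_self[OF e] by (auto simp: \<Phi>_def touches_def)
    then show "\<Phi> ls \<in> layered_lists (Suc T) - {[{e}]}"
      using ls layered_ins[OF e] length_ins[of e ls]
      by (auto simp: \<Phi>_def layered_lists_def intro: le_trans)
  qed
  have step: "avg (\<lambda>X. weight ls (upd (vbl e) X A)) = weight (\<Phi> ls) A" if ls: "ls \<in> layered_lists T" for ls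
  proof (cases "touches e ls")
    case True
    then show ?thesis
      using weight_ins[OF e lay[OF ls]] bad by (simp add: \<Phi>_def resample_op_def cells_def)
  next
    case False
    have "weight ls (upd (vbl e) X A) = weight ls A" for X
    proof (rule weight_cong)
      show "I \<subseteq> Ev" if "I \<in> set ls" for I
        using layered_indep[OF lay[OF ls] that] by (simp add: indep_def)
      show "upd (vbl e) X A c = A c" if "I \<in> set ls" "c \<in> cells I" for I c
        using False that by (auto simp: touches_def touch_def cells_def upd_def)
    qed
    then show ?thesis using False by (simp add: \<Phi>_def avg_const)
  qed
  have mem: "[{e}] \<in> layered_lists (Suc T)" using e by (simp add: layered_lists_def)
  \<comment> \<open>Since \<open>e\<close> is bad in \<open>A\<close>, the missed list contributes
    exactly the unit by which the potential decreases.\<close>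
  have we: "weight [{e}] A = 1" using bad by (simp add: resample_op_def avg_const)
  have "avg (\<lambda>X. potential T (upd (vbl e) X A)) = (\<Sum>ls\<in>layered_lists T. weight (\<Phi> ls) A)"
    unfolding potential_def avg_sum using step by simp
  also have "\<dots> = (\<Sum>ls\<in>\<Phi> ` layered_lists T. weight ls A)"
    by (simp add: sum.reindex[OF inj])
  also have "\<dots> \<le> (\<Sum>ls\<in>layered_lists (Suc T) - {[{e}]}. weight ls A)"
    by (rule sum_mono2) (use sub finite_layered_lists weight_nonneg[OF A] in auto)
  also have "\<dots> = potential (Suc T) A - 1"
    unfolding potential_def by (subst sum_diff1) (use finite_layered_lists mem we in auto)
  finally show ?thesis by simp
qed

section \<open>The cluster expansion bound on the average potential\<close>

definition indep_touching :: "'e set \<Rightarrow> 'e set set" where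
  "indep_touching J = {I. indep I \<and> (\<forall>e\<in>I. touch e J)}"

lemma finite_indep_touching: "finite (indep_touching J)"
  by (rule finite_subset[of _ "Pow Ev"]) (auto simp: indep_touching_def indep_def finite_Ev)

context
  fixes \<mu> :: "'e \<Rightarrow> real"
  assumes \<mu>_nonneg: "e \<in> Ev \<Longrightarrow> \<mu> e \<ge> 0"
    and \<mu>: "e \<in> Ev \<Longrightarrow> prob e * (\<Sum>I\<in>indep_touching {e}. \<Prod>e'\<in>I. \<mu> e') \<le> \<mu> e"
begin

lemma prod_\<mu>_nonneg: "indep I \<Longrightarrow> (\<Prod>e\<in>I. \<mu> e) \<ge> 0"
  using \<mu>_nonneg by (intro prod_nonneg) (auto simp: indep_def)

text \<open>Split an independent set into the members that touch \<open>e\<close> and the others,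
  which must then touch \<open>J\<close>. The two parts determine the set; dropping the independence
  between them gives the inequality.\<close>

lemma sum_indep_touching_insert:
  "(\<Sum>I\<in>indep_touching (insert e J). \<Prod>e\<in>I. \<mu> e) \<le>
   (\<Sum>I\<in>indep_touching {e}. \<Prod>e\<in>I. \<mu> e) * (\<Sum>I\<in>indep_touching J. \<Prod>e\<in>I. \<mu> e)"
proof -
  define split where "split I = ({e'\<in>I. touch e' {e}}, {e'\<in>I. \<not> touch e' {e}})" for I
  have split_mult: "(\<Prod>e\<in>I. \<mu> e) = (\<lambda>(P, Q). (\<Prod>e\<in>P. \<mu> e) * (\<Prod>e\<in>Q. \<mu> e)) (split I)"
    if "I \<in> indep_touching (insert e J)" for I
  proof -
    have "finite I" using that finite_Ev by (auto simp: indep_touching_def indep_def finite_subset)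
    then show ?thesis unfolding split_def
      by (simp, subst prod.union_disjoint[symmetric]) (auto intro!: prod.cong)
  qed
  have inj: "inj_on split (indep_touching (insert e J))"
    by (rule inj_onI) (auto simp: split_def set_eq_iff)
  have im: "split ` indep_touching (insert e J) \<subseteq> indep_touching {e} \<times> indep_touching J"
    by (auto simp: split_def indep_touching_def indep_def pairwise_def touch_def)
  have "(\<Sum>I\<in>indep_touching (insert e J). \<Prod>e\<in>I. \<mu> e) =
      (\<Sum>x\<in>split ` indep_touching (insert e J). (\<lambda>(P, Q). (\<Prod>e\<in>P. \<mu> e) * (\<Prod>e\<in>Q. \<mu> e)) x)"
    unfolding sum.reindex[OF inj] by (rule sum.cong) (auto simp: split_mult)
  also have "\<dots> \<le> (\<Sum>x\<in>indep_touching {e} \<times> indep_touching J.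
      (\<lambda>(P, Q). (\<Prod>e\<in>P. \<mu> e) * (\<Prod>e\<in>Q. \<mu> e)) x)"
    by (rule sum_mono2[OF _ im])
       (auto simp: finite_indep_touching, auto simp: indep_touching_def intro!: mult_nonneg_nonneg prod_\<mu>_nonneg)
  also have "\<dots> = (\<Sum>I\<in>indep_touching {e}. \<Prod>e\<in>I. \<mu> e) * (\<Sum>I\<in>indep_touching J. \<Prod>e\<in>I. \<mu> e)"
    by (simp add: sum_product sum.cartesian_product)
  finally show ?thesis .
qed

text \<open>The criterion is multiplied over the members of \<open>J\<close>; submultiplicativity of
  the sum over independent sets passes it from single events to whole layers.\<close>

lemma prob_layer_le:
  assumes "indep J"
  shows "(\<Prod>e\<in>J. prob e) * (\<Sum>I\<in>indep_touching J. \<Prod>e\<in>I. \<mu> e) \<le> (\<Prod>e\<in>J. \<mu> e)"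
proof -
  have "finite J" using assms finite_Ev by (auto simp: indep_def finite_subset)
  then show ?thesis using assms
  proof (induction J)
    case empty
    have "indep_touching {} = {{}}" by (auto simp: indep_touching_def touch_def indep_def)
    then show ?case by simp
  next
    case (insert e J)
    have e: "e \<in> Ev" "indep J"
      using insert.prems insert.hyps unfolding indep_def pairwise_insert by auto
    let ?Z = "\<lambda>J. \<Sum>I\<in>indep_touching J. \<Prod>e\<in>I. \<mu> e"
    have Z: "?Z J \<ge> 0" for J
      by (intro sum_nonneg prod_\<mu>_nonneg) (simp add: indep_touching_def)
    have "(\<Prod>e\<in>insert e J. prob e) * ?Z (insert e J) \<le> (prob e * (\<Prod>e\<in>J. prob e)) * (?Z {e} * ?Z J)"
      using insert.hyps sum_indep_touching_insert[of e J]
      by (simp add: mult_left_mono prob_nonneg prod_nonneg)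
    also have "\<dots> = (prob e * ?Z {e}) * ((\<Prod>e\<in>J. prob e) * ?Z J)" by (simp add: mult_ac)
    also have "\<dots> \<le> \<mu> e * (\<Prod>e\<in>J. \<mu> e)"
      by (intro mult_mono \<mu> e insert.IH mult_nonneg_nonneg Z prod_nonneg \<mu>_nonneg)
         (auto simp: prob_nonneg)
    finally show ?case using insert.hyps by simp
  qed
qed

definition layered_of_length :: "nat \<Rightarrow> 'e set list set" where
  "layered_of_length r = {ls. layered ls \<and> length ls = r}"

definition prob_list :: "'e set list \<Rightarrow> real" where
  "prob_list ls = (\<Prod>I\<leftarrow>ls. \<Prod>e\<in>I. prob e)"

lemma prob_list_nonneg: "prob_list ls \<ge> 0"
  by (induction ls) (auto simp: prob_list_def prob_nonneg intro!: mult_nonneg_nonneg prod_nonneg)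

lemma finite_layered_of_length: "finite (layered_of_length r)"
  by (rule finite_subset[OF _ finite_layered_lists[of r]])
     (auto simp: layered_of_length_def layered_lists_def)

lemma sum_layered_of_length_Suc:
  "(\<Sum>ls\<in>layered_of_length (Suc (Suc r)). g ls) =
   (\<Sum>ls\<in>layered_of_length (Suc r). \<Sum>I\<in>indep_touching (hd ls) - {{}}. g (I # ls))"
proof -
  have "(\<Sum>ls\<in>layered_of_length (Suc (Suc r)). g ls) =
      (\<Sum>(ls, I)\<in>Sigma (layered_of_length (Suc r)) (\<lambda>ls. indep_touching (hd ls) - {{}}). g (I # ls))"
    by (rule sum.reindex_bij_witness[where j = "\<lambda>ls. (tl ls, hd ls)" and i = "\<lambda>(ls, I). I # ls"])
       (auto simp: layered_of_length_def indep_touching_def length_Suc_conv)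
  also have "\<dots> = (\<Sum>ls\<in>layered_of_length (Suc r). \<Sum>I\<in>indep_touching (hd ls) - {{}}. g (I # ls))"
    by (rule sum.Sigma[symmetric]) (auto simp: finite_layered_of_length finite_indep_touching)
  finally show ?thesis .
qed

text \<open>A telescoping estimate in which the front layer is charged \<open>\<mu>\<close> instead
  of \<open>prob\<close>. By \<open>prob_layer_le\<close> the charge of a front layer
  \<open>J\<close> pays for every independent set placed before it: the empty set stands for the
  list that begins with \<open>J\<close>, the nonempty ones become new front layers, charged
  \<open>\<mu>\<close> in turn.\<close>

lemma sum_layered_le:
  "(\<Sum>ls\<in>layered_of_length (Suc r). (\<Prod>e\<in>hd ls. \<mu> e) * prob_list (tl ls))
   + (\<Sum>k\<le>r. \<Sum>ls\<in>layered_of_length k. prob_list ls) \<le> (\<Sum>e\<in>Ev. \<mu> e)"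
proof (induction r)
  case 0
  have 1: "layered_of_length 0 = {}" by (auto simp: layered_of_length_def)
  have 2: "layered_of_length (Suc 0) = (\<lambda>e. [{e}]) ` Ev"
    by (auto simp: layered_of_length_def length_Suc_conv)
  have "(\<Sum>ls\<in>layered_of_length (Suc 0). (\<Prod>e\<in>hd ls. \<mu> e) * prob_list (tl ls)) = (\<Sum>e\<in>Ev. \<mu> e)"
    unfolding 2 by (subst sum.reindex) (auto simp: inj_on_def prob_list_def)
  then show ?case by (simp add: 1)
next
  case (Suc r)
  have ineq: "(\<Sum>I\<in>indep_touching (hd ls) - {{}}. (\<Prod>e\<in>I. \<mu> e) * prob_list ls) + prob_list ls
      \<le> (\<Prod>e\<in>hd ls. \<mu> e) * prob_list (tl ls)" if ls: "ls \<in> layered_of_length (Suc r)" for ls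
  proof -
    obtain J ls' where ls': "ls = J # ls'" using ls by (auto simp: layered_of_length_def length_Suc_conv)
    have J: "indep J" using ls ls' layered_indep by (auto simp: layered_of_length_def)
    have mem: "{} \<in> indep_touching J" by (auto simp: indep_touching_def indep_def)
    have "(\<Sum>I\<in>indep_touching J. \<Prod>e\<in>I. \<mu> e) = 1 + (\<Sum>I\<in>indep_touching J - {{}}. \<Prod>e\<in>I. \<mu> e)"
      using sum.remove[OF finite_indep_touching mem, of "\<lambda>I. \<Prod>e\<in>I. \<mu> e"] by simp
    then have "(\<Sum>I\<in>indep_touching J - {{}}. (\<Prod>e\<in>I. \<mu> e) * prob_list ls) + prob_list ls =
        ((\<Prod>e\<in>J. prob e) * (\<Sum>I\<in>indep_touching J. \<Prod>e\<in>I. \<mu> e)) * prob_list ls'"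
      unfolding ls' by (simp add: prob_list_def sum_distrib_right[symmetric] algebra_simps)
    also have "\<dots> \<le> (\<Prod>e\<in>J. \<mu> e) * prob_list ls'"
      by (intro mult_right_mono prob_layer_le J prob_list_nonneg)
    finally show ?thesis by (simp add: ls')
  qed
  have "(\<Sum>ls\<in>layered_of_length (Suc (Suc r)). (\<Prod>e\<in>hd ls. \<mu> e) * prob_list (tl ls))
      + (\<Sum>ls\<in>layered_of_length (Suc r). prob_list ls)
    \<le> (\<Sum>ls\<in>layered_of_length (Suc r). (\<Prod>e\<in>hd ls. \<mu> e) * prob_list (tl ls))"
    unfolding sum_layered_of_length_Suc using sum_mono[OF ineq] by (simp add: sum.distrib)
  then show ?case using Suc.IH by simp
qed

theorem avg_potential_le: "avg (potential T) \<le> (\<Sum>e\<in>Ev. \<mu> e)"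
proof -
  have "avg (potential T) = (\<Sum>ls\<in>layered_lists T. prob_list ls)"
    unfolding potential_def[abs_def] avg_sum prob_list_def
    by (intro sum.cong refl avg_weight layered_indep[rotated]) (auto simp: layered_lists_def)
  also have "layered_lists T = (\<Union>k\<le>T. layered_of_length k)"
    by (auto simp: layered_lists_def layered_of_length_def)
  also have "(\<Sum>ls\<in>(\<Union>k\<le>T. layered_of_length k). prob_list ls) =
      (\<Sum>k\<le>T. \<Sum>ls\<in>layered_of_length k. prob_list ls)"
    by (rule sum.UNION_disjoint) (auto simp: finite_layered_of_length, auto simp: layered_of_length_def)
  also have "\<dots> \<le> (\<Sum>e\<in>Ev. \<mu> e)"
  proof -
    have "(\<Sum>ls\<in>layered_of_length (Suc T). (\<Prod>e\<in>hd ls. \<mu> e) * prob_list (tl ls)) \<ge> 0"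
    proof (intro sum_nonneg mult_nonneg_nonneg prob_list_nonneg prod_\<mu>_nonneg)
      fix ls assume "ls \<in> layered_of_length (Suc T)"
      then show "indep (hd ls)"
        using layered_indep by (cases ls) (auto simp: layered_of_length_def)
    qed
    then show ?thesis using sum_layered_le[of T] by simp
  qed
  finally show ?thesis .
qed

end

end

section \<open>The run of the algorithm\<close>

lemma PiM_uniform_count_measure:
  assumes "finite D" "finite B" "B \<noteq> {}"
  shows "(\<Pi>\<^sub>M e\<in>D. uniform_count_measure B) = uniform_count_measure (D \<rightarrow>\<^sub>E B)"
proof (rule measure_eqI_finite[where A = "D \<rightarrow>\<^sub>E B"])
  interpret product_prob_space "\<lambda>_. uniform_count_measure B" D
    using assms by (intro product_prob_spaceI prob_space_uniform_count_measure)
  have "sets (\<Pi>\<^sub>M e\<in>D. uniform_count_measure B) = sets (\<Pi>\<^sub>M e\<in>D. count_space B)"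
    by (rule sets_PiM_cong) (auto simp: sets_uniform_count_measure)
  also have "(\<Pi>\<^sub>M e\<in>D. count_space B) = count_space (D \<rightarrow>\<^sub>E B)"
    using assms by (intro count_space_PiM_finite) (auto simp: countable_finite)
  finally show "sets (\<Pi>\<^sub>M e\<in>D. uniform_count_measure B) = Pow (D \<rightarrow>\<^sub>E B)" by simp
  show "sets (uniform_count_measure (D \<rightarrow>\<^sub>E B)) = Pow (D \<rightarrow>\<^sub>E B)"
    by (simp add: sets_uniform_count_measure)
  show fin: "finite (D \<rightarrow>\<^sub>E B)" using assms by (simp add: finite_PiE)
  fix a assume a: "a \<in> D \<rightarrow>\<^sub>E B"
  have "{a} = (\<Pi>\<^sub>E e\<in>D. {a e})" using a by (intro PiE_singleton[symmetric]) (simp add: PiE_def)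
  then have "emeasure (\<Pi>\<^sub>M e\<in>D. uniform_count_measure B) {a} =
      emeasure (\<Pi>\<^sub>M e\<in>D. uniform_count_measure B) (\<Pi>\<^sub>E e\<in>D. {a e})" by simp
  also have "\<dots> = (\<Prod>e\<in>D. emeasure (uniform_count_measure B) {a e})"
    using assms a by (intro emeasure_PiM) (auto simp: sets_uniform_count_measure)
  also have "\<dots> = (\<Prod>e\<in>D. ennreal (1 / card B))"
    using assms a by (intro prod.cong refl) (auto simp: emeasure_uniform_count_measure PiE_iff)
  also have "\<dots> = ennreal ((1 / card B) ^ card D)" by (simp add: ennreal_power)
  also have "\<dots> = emeasure (uniform_count_measure (D \<rightarrow>\<^sub>E B)) {a}"
    using assms a fin by (simp add: emeasure_uniform_count_measure card_PiE power_one_over)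
  finally show "emeasure (\<Pi>\<^sub>M e\<in>D. uniform_count_measure B) {a} =
      emeasure (uniform_count_measure (D \<rightarrow>\<^sub>E B)) {a}" .
qed

lemma finite_disjoint_families: "finite (disjoint_families n s ws)"
  by (rule finite_subset[of _ "Pow (Pow {1..n})"]) (auto simp: disjoint_families_def)

lemma disjoint_familiesE:
  assumes "S \<in> disjoint_families n s ws"
  obtains W where "S = W ` {1..s}" "\<forall>i\<in>{1..s}. W i \<subseteq> {1..n}"
    "\<forall>i\<in>{1..s}. card (W i) = ws i" "disjoint_family_on W {1..s}"
proof -
  from assms have "\<exists>W. S = W ` {1..s} \<and> (\<forall>i\<in>{1..s}. W i \<subseteq> {1..n} \<and> card (W i) = ws i) \<and>
      disjoint_family_on W {1..s}"
    unfolding disjoint_families_def by (simp only: mem_Collect_eq)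
  then show ?thesis using that by (elim exE conjE) simp
qed

lemma Union_disjoint_families: "S \<in> disjoint_families n s ws \<Longrightarrow> \<Union>S \<subseteq> {1..n}"
  by (auto simp: disjoint_families_def)

definition grid :: "nat \<Rightarrow> nat \<Rightarrow> (nat \<times> nat) set" where
  "grid N n = {1..N} \<times> {1..n}"

definition colours :: "nat \<Rightarrow> nat set" where
  "colours m = {1..m}"

definition family_cells :: "nat \<Rightarrow> family \<Rightarrow> (nat \<times> nat) set" where
  "family_cells N S = {1..N} \<times> \<Union>S"

lemma row_separates_cong:
  assumes "\<And>c. c \<in> \<Union>S \<Longrightarrow> A (i, c) = A' (i, c)"
  shows "row_separates A i S = row_separates A' i S"
proof -
  have "A (i, c) = A' (i, c)" if "W \<in> S" "c \<in> W" for c W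
    using that assms by blast
  then show ?thesis
    unfolding row_separates_def by (intro ball_cong refl imp_cong) metis
qed

locale shf =
  fixes N n m s w :: nat and ws :: "nat \<Rightarrow> nat"
  assumes N_pos: "0 < N" and m_pos: "0 < m" and s_ge: "2 \<le> s"
    and ws_pos: "\<And>i. i \<in> {1..s} \<Longrightarrow> 0 < ws i" and ws_sum: "(\<Sum>i=1..s. ws i) = w"
begin

sublocale resampling "grid N n" "colours m" "disjoint_families n s ws"
  "family_cells N" "bad_event N"
proof
  show "family_cells N S \<noteq> {}" if "S \<in> disjoint_families n s ws" for S
  proof -
    from that obtain W where W: "S = W ` {1..s}" "\<forall>i\<in>{1..s}. W i \<subseteq> {1..n}"
      "\<forall>i\<in>{1..s}. card (W i) = ws i" "disjoint_family_on W {1..s}"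
      by (rule disjoint_familiesE)
    have 1: "1 \<in> {1..s}" using s_ge by simp
    then have "card (W 1) > 0" using W(3) ws_pos by simp
    then have "W 1 \<noteq> {}" by auto
    moreover have "W 1 \<in> S" using W(1) 1 by blast
    ultimately show ?thesis using N_pos by (auto simp: family_cells_def)
  qed
  show "family_cells N S \<subseteq> grid N n" if "S \<in> disjoint_families n s ws" for S
    using Union_disjoint_families[OF that] by (auto simp: family_cells_def grid_def)
  show "bad_event N S A = bad_event N S A'"
    if eq: "\<And>c. c \<in> family_cells N S \<Longrightarrow> A c = A' c" for S A A'
  proof -
    have "A (i, c) = A' (i, c)" if "i \<in> {1..N}" "c \<in> \<Union>S" for i c
      using that by (intro eq) (simp add: family_cells_def)
    then have "row_separates A i S = row_separates A' i S" if "i \<in> {1..N}" for i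
      using that by (intro row_separates_cong) blast
    then show ?thesis by (simp add: bad_event_def)
  qed
qed (use m_pos in \<open>auto simp: finite_disjoint_families grid_def colours_def\<close>)

lemma states_eq: "states = matrices N n m"
  by (subst states_def) (simp add: matrices_def grid_def colours_def)

lemma resample_eq: "resample N S X A = upd (family_cells N S) X A"
  by (simp add: resample_def upd_def family_cells_def)

abbreviation entries :: "matrix measure" where
  "entries \<equiv> uniform_count_measure (matrices N n m)"

lemma randomness_eq: "randomness N n m = (\<Pi>\<^sub>M k\<in>UNIV. entries)"
  unfolding randomness_def matrices_def using m_pos by (subst PiM_uniform_count_measure) auto

sublocale seq: sequence_space entries
proof -
  have "prob_space entries"
    using finite_states card_states_pos
    by (intro prob_space_uniform_count_measure) (auto simp: states_eq)
  then interpret E: prob_space entries .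
  show "sequence_space entries" by unfold_locales
qed

text \<open>The passage from integrals over one random matrix to the finite averages above;
  \<open>entries\<close> is discrete, so \<open>g\<close> need not come with a measurability
  assumption.\<close>

lemma nn_integral_entries_le:
  assumes "\<And>X. X \<in> states \<Longrightarrow> g X \<le> ennreal (f X)" "\<And>X. X \<in> states \<Longrightarrow> 0 \<le> f X"
  shows "(\<integral>\<^sup>+X. g X \<partial>entries) \<le> ennreal (avg f)"
proof -
  have "(\<integral>\<^sup>+X. g X \<partial>entries) = (\<Sum>X\<in>states. ennreal (1 / card states) * g X)"
    unfolding uniform_count_measure_def using finite_states
    by (subst nn_integral_point_measure_finite) (simp_all add: states_eq)
  also have "\<dots> \<le> (\<Sum>X\<in>states. ennreal (1 / card states) * ennreal (f X))"
    by (intro sum_mono mult_left_mono assms) auto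
  also have "\<dots> = (\<Sum>X\<in>states. ennreal (1 / card states * f X))"
    by (intro sum.cong refl ennreal_mult[symmetric] assms) auto
  also have "\<dots> = ennreal (\<Sum>X\<in>states. 1 / card states * f X)"
    by (intro sum_ennreal mult_nonneg_nonneg assms) auto
  also have "(\<Sum>X\<in>states. 1 / card states * f X) = avg f"
    by (simp add: avg_def sum_divide_distrib)
  finally show ?thesis .
qed

text \<open>Conditioning on the first matrix: the sequence is one matrix followed by an independent
  copy of the whole sequence.\<close>

lemma nn_integral_seq_split:
  assumes [measurable]: "f \<in> borel_measurable seq.S"
  shows "(\<integral>\<^sup>+\<omega>. f \<omega> \<partial>seq.S) = (\<integral>\<^sup>+X. (\<integral>\<^sup>+\<omega>. f (case_nat X \<omega>) \<partial>seq.S) \<partial>entries)"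
proof -
  have "(\<integral>\<^sup>+\<omega>. f \<omega> \<partial>seq.S) = (\<integral>\<^sup>+\<omega>. f \<omega> \<partial>distr (entries \<Otimes>\<^sub>M seq.S) seq.S (\<lambda>(s, \<omega>). case_nat s \<omega>))"
    by (simp add: seq.PiM_iter)
  also have "\<dots> = (\<integral>\<^sup>+p. f (case_nat (fst p) (snd p)) \<partial>(entries \<Otimes>\<^sub>M seq.S))"
    by (subst nn_integral_distr) (auto simp: case_prod_beta)
  also have "\<dots> = (\<integral>\<^sup>+X. (\<integral>\<^sup>+\<omega>. f (case_nat X \<omega>) \<partial>seq.S) \<partial>entries)"
    by (subst seq.P.nn_integral_fst[symmetric]) auto
  finally show ?thesis .
qed

abbreviation is_bad :: "matrix \<Rightarrow> bool" where
  "is_bad \<equiv> some_bad N n s ws"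

section \<open>Runs from an arbitrary history and the number of resamplings\<close>

context
  fixes sel :: selection
  assumes valid: "valid_selection N n m s ws sel"
begin

definition mt_step :: "matrix list \<Rightarrow> matrix \<Rightarrow> matrix list" where
  "mt_step h X = h @ [if is_bad (last h) then resample N (sel h) X (last h) else last h]"

text \<open>The start is an arbitrary history and the randomness is read from index 0. This makes
  the run after one step a run of the same kind, as the induction in
  \<open>nn_integral_bad_steps_le\<close> requires.\<close>

fun run :: "matrix list \<Rightarrow> (nat \<Rightarrow> matrix) \<Rightarrow> nat \<Rightarrow> matrix list" where
  "run h \<omega> 0 = h"
| "run h \<omega> (Suc k) = mt_step (run h \<omega> k) (\<omega> k)"

lemma mt_history_eq_run: "mt_history N n s ws sel (case_nat X \<omega>) k = run [X] \<omega> k"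
  by (induction k) (simp_all add: mt_step_def Let_def)

lemma run_case_nat: "run h (case_nat X \<omega>) (Suc k) = run (mt_step h X) \<omega> k"
  by (induction k) simp_all

definition histories :: "matrix list set" where
  "histories = {h. h \<noteq> [] \<and> set h \<subseteq> states}"

lemma countable_histories: "countable histories"
  by (rule countable_subset[of _ "lists states"])
     (auto simp: histories_def finite_states countable_finite)

lemma sel_bad:
  assumes "h \<in> histories" "is_bad (last h)"
  shows "sel h \<in> disjoint_families n s ws" "bad_event N (sel h) (last h)"
  using valid assms unfolding valid_selection_def histories_def states_eq by auto

lemma last_history: "h \<in> histories \<Longrightarrow> last h \<in> states"
  by (auto simp: histories_def)

lemma mt_step_history: "h \<in> histories \<Longrightarrow> X \<in> states \<Longrightarrow> mt_step h X \<in> histories"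
  using last_history[of h] by (auto simp: mt_step_def histories_def resample_eq upd_in_states)

lemma measurable_mt_step:
  assumes "h \<in> histories"
  shows "(\<lambda>\<omega>. mt_step h (\<omega> k)) \<in> measurable seq.S (count_space histories)"
proof (rule measurable_compose[where f = "\<lambda>\<omega>. \<omega> k" and g = "mt_step h"])
  show "(\<lambda>\<omega>. \<omega> k) \<in> measurable seq.S entries"
    by (rule measurable_component_singleton) simp
  show "mt_step h \<in> measurable entries (count_space histories)"
    by (rule measurableI)
       (use mt_step_history[OF assms] in
         \<open>auto simp: sets_uniform_count_measure space_uniform_count_measure states_eq\<close>)
qed

text \<open>The rule \<open>sel\<close> is an arbitrary function; measurability holds because only
  countably many histories can arise.\<close>

lemma measurable_run:
  assumes "h \<in> histories"
  shows "(\<lambda>\<omega>. run h \<omega> k) \<in> measurable seq.S (count_space histories)"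
proof (induction k)
  case 0
  then show ?case using assms by simp
next
  case (Suc k)
  from measurable_compose_countable'[OF measurable_mt_step Suc.IH countable_histories]
  show ?case by simp
qed

definition bad_steps :: "nat \<Rightarrow> matrix list \<Rightarrow> (nat \<Rightarrow> matrix) \<Rightarrow> ennreal" where
  "bad_steps T h \<omega> = (\<Sum>k<T. of_bool (is_bad (last (run h \<omega> k))))"

lemma measurable_bad_steps: "h \<in> histories \<Longrightarrow> bad_steps T h \<in> borel_measurable seq.S"
  unfolding bad_steps_def[abs_def]
  by (intro borel_measurable_sum measurable_compose[OF measurable_run]) auto

lemma bad_steps_Suc:
  "bad_steps (Suc T) h (case_nat X \<omega>) = of_bool (is_bad (last h)) + bad_steps T (mt_step h X) \<omega>"
  unfolding bad_steps_def sum.lessThan_Suc_shift run_case_nat by simp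

lemma bad_steps_stopped: "\<not> is_bad (last h) \<Longrightarrow> bad_steps T h \<omega> = 0"
proof -
  assume "\<not> is_bad (last h)"
  then have "last (run h \<omega> k) = last h" for k
    by (induction k) (auto simp: mt_step_def)
  then show ?thesis using \<open>\<not> is_bad (last h)\<close> by (simp add: bad_steps_def)
qed

text \<open>The first draw is split off. \<open>potential_step\<close> pays for this one step and,
  on average over the draw, for the potential of the extended history.\<close>

lemma nn_integral_bad_steps_le:
  "h \<in> histories \<Longrightarrow> (\<integral>\<^sup>+\<omega>. bad_steps T h \<omega> \<partial>seq.S) \<le> ennreal (potential T (last h))"
proof (induction T arbitrary: h)
  case 0
  then show ?case by (simp add: bad_steps_def)
next
  case (Suc T)
  note h = Suc.prems
  show ?case
  proof (cases "is_bad (last h)")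
    case False
    then show ?thesis by (simp add: bad_steps_stopped)
  next
    case True
    define S where "S = sel h"
    have S: "S \<in> disjoint_families n s ws" "bad_event N S (last h)"
      using sel_bad[OF h True] by (auto simp: S_def)
    let ?A = "\<lambda>X. upd (family_cells N S) X (last h)"
    have step: "last (mt_step h X) = ?A X" for X
      using True by (simp add: mt_step_def resample_eq S_def)
    have A: "?A X \<in> states" if "X \<in> states" for X
      using that last_history[OF h] by (rule upd_in_states)
    have "(\<integral>\<^sup>+\<omega>. bad_steps (Suc T) h \<omega> \<partial>seq.S) =
        (\<integral>\<^sup>+X. (\<integral>\<^sup>+\<omega>. bad_steps (Suc T) h (case_nat X \<omega>) \<partial>seq.S) \<partial>entries)"
      by (rule nn_integral_seq_split[OF measurable_bad_steps[OF h]])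
    also have "\<dots> \<le> ennreal (avg (\<lambda>X. 1 + potential T (?A X)))"
    proof (rule nn_integral_entries_le)
      fix X assume X: "X \<in> states"
      have "(\<integral>\<^sup>+\<omega>. bad_steps (Suc T) h (case_nat X \<omega>) \<partial>seq.S) =
          (\<integral>\<^sup>+\<omega>. 1 + bad_steps T (mt_step h X) \<omega> \<partial>seq.S)"
        using True by (simp add: bad_steps_Suc)
      also have "\<dots> = 1 + (\<integral>\<^sup>+\<omega>. bad_steps T (mt_step h X) \<omega> \<partial>seq.S)"
        by (subst nn_integral_add)
           (auto intro: measurable_bad_steps[OF mt_step_history[OF h X]] simp: seq.P.emeasure_space_1)
      also have "\<dots> \<le> 1 + ennreal (potential T (?A X))"
        using Suc.IH[OF mt_step_history[OF h X]] by (simp add: step add_left_mono)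
      also have "\<dots> = ennreal (1 + potential T (?A X))"
        using potential_nonneg[OF A[OF X]] by simp
      finally show "(\<integral>\<^sup>+\<omega>. bad_steps (Suc T) h (case_nat X \<omega>) \<partial>seq.S) \<le> ennreal (1 + potential T (?A X))" .
      show "0 \<le> 1 + potential T (?A X)" using potential_nonneg[OF A[OF X]] by simp
    qed
    \<comment> \<open>Additivity of \<open>avg\<close>, as \<open>avg_sum\<close> over a set of two
      indices.\<close>
    also have "avg (\<lambda>X. 1 + potential T (?A X)) = 1 + avg (\<lambda>X. potential T (?A X))"
      using avg_sum[of "\<lambda>i X. if i = 0 then 1 else potential T (?A X)" "{0, 1::nat}"]
      by (simp add: avg_const)
    also have "\<dots> \<le> potential (Suc T) (last h)"
      by (rule potential_step[OF last_history[OF h] S])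
    finally show ?thesis by (simp add: ennreal_leI)
  qed
qed

lemma measurable_mt_matrix:
  "(\<lambda>\<omega>. mt_matrix N n s ws sel \<omega> k) \<in> measurable seq.S (count_space states)"
proof -
  have "(\<lambda>\<omega>. mt_history N n s ws sel \<omega> k) \<in> measurable seq.S (count_space histories)"
  proof (induction k)
    case 0
    have "(\<lambda>\<omega>. [\<omega> 0]) \<in> measurable seq.S (count_space histories)"
    proof (rule measurable_compose[where f = "\<lambda>\<omega>. \<omega> 0" and g = "\<lambda>X. [X]"])
      show "(\<lambda>\<omega>. \<omega> 0) \<in> measurable seq.S entries"
        by (rule measurable_component_singleton) simp
      show "(\<lambda>X. [X]) \<in> measurable entries (count_space histories)"
        by (rule measurableI)
           (auto simp: sets_uniform_count_measure space_uniform_count_measure states_eq histories_def)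
    qed
    then show ?case by simp
  next
    case (Suc k)
    from measurable_compose_countable'[OF measurable_mt_step[of _ "Suc k"] Suc.IH countable_histories]
    show ?case by (simp add: mt_step_def Let_def)
  qed
  then show ?thesis
    unfolding mt_matrix_def
    by (rule measurable_compose) (auto simp: last_history)
qed

lemma measurable_bad_mt [measurable]:
  "(\<lambda>\<omega>. of_bool (is_bad (mt_matrix N n s ws sel \<omega> k)) :: ennreal) \<in> borel_measurable seq.S"
  by (rule measurable_compose[OF measurable_mt_matrix]) simp

definition num_resamplings :: "(nat \<Rightarrow> matrix) \<Rightarrow> ennreal" where
  "num_resamplings \<omega> = (\<Sum>k. of_bool (is_bad (mt_matrix N n s ws sel \<omega> k)))"

lemma measurable_num_resamplings [measurable]: "num_resamplings \<in> borel_measurable seq.S"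
  unfolding num_resamplings_def[abs_def] by measurable

context
  fixes \<mu> :: "family \<Rightarrow> real"
  assumes \<mu>_nonneg: "S \<in> disjoint_families n s ws \<Longrightarrow> \<mu> S \<ge> 0"
    and \<mu>: "S \<in> disjoint_families n s ws \<Longrightarrow>
      prob S * (\<Sum>I\<in>indep_touching {S}. \<Prod>S'\<in>I. \<mu> S') \<le> \<mu> S"
begin

text \<open>The bound for the first \<open>T\<close> steps does not depend on \<open>T\<close>, so
  it survives the limit.\<close>

lemma nn_integral_num_resamplings_le:
  "(\<integral>\<^sup>+\<omega>. num_resamplings \<omega> \<partial>seq.S) \<le> ennreal (\<Sum>S\<in>disjoint_families n s ws. \<mu> S)"
proof -
  let ?b = "\<lambda>k \<omega>. of_bool (is_bad (mt_matrix N n s ws sel \<omega> k)) :: ennreal"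
  have "(\<integral>\<^sup>+\<omega>. num_resamplings \<omega> \<partial>seq.S) = (\<Sum>k. \<integral>\<^sup>+\<omega>. ?b k \<omega> \<partial>seq.S)"
    unfolding num_resamplings_def by (rule nn_integral_suminf) measurable
  also have "\<dots> \<le> ennreal (\<Sum>S\<in>disjoint_families n s ws. \<mu> S)"
  proof (rule suminf_le_const)
    fix T
    have "(\<Sum>k<T. \<integral>\<^sup>+\<omega>. ?b k \<omega> \<partial>seq.S) = (\<integral>\<^sup>+\<omega>. (\<Sum>k<T. ?b k \<omega>) \<partial>seq.S)"
      by (subst nn_integral_sum) auto
    also have "\<dots> = (\<integral>\<^sup>+X. (\<integral>\<^sup>+\<omega>. (\<Sum>k<T. ?b k (case_nat X \<omega>)) \<partial>seq.S) \<partial>entries)"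
      by (rule nn_integral_seq_split) measurable
    also have "\<dots> = (\<integral>\<^sup>+X. (\<integral>\<^sup>+\<omega>. bad_steps T [X] \<omega> \<partial>seq.S) \<partial>entries)"
      unfolding mt_matrix_def mt_history_eq_run bad_steps_def ..
    also have "\<dots> \<le> ennreal (avg (potential T))"
    proof (rule nn_integral_entries_le)
      fix X assume X: "X \<in> states"
      then have "[X] \<in> histories" by (simp add: histories_def)
      from nn_integral_bad_steps_le[OF this]
      show "(\<integral>\<^sup>+\<omega>. bad_steps T [X] \<omega> \<partial>seq.S) \<le> ennreal (potential T X)" by simp
    qed (rule potential_nonneg)
    also have "\<dots> \<le> ennreal (\<Sum>S\<in>disjoint_families n s ws. \<mu> S)"
      by (intro ennreal_leI avg_potential_le \<mu>_nonneg \<mu>)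
    finally show "(\<Sum>k<T. \<integral>\<^sup>+\<omega>. ?b k \<omega> \<partial>seq.S) \<le> ennreal (\<Sum>S\<in>disjoint_families n s ws. \<mu> S)" .
  qed auto
  finally show ?thesis .
qed

text \<open>A run that never stops has infinitely many resamplings, which a finite expectation
  allows only on a null set.\<close>

theorem AE_mt_stops:
  "AE \<omega> in randomness N n m.
     mt_stops N n s ws sel \<omega> \<and> is_SHF N n m s ws (mt_output N n s ws sel \<omega>)"
proof -
  have "AE \<omega> in seq.S. num_resamplings \<omega> \<noteq> \<infinity>"
    using nn_integral_num_resamplings_le
    by (intro nn_integral_noteq_infinite measurable_num_resamplings)
       (metis ennreal_less_top infinity_ennreal_def not_le)
  moreover have "AE \<omega> in seq.S. \<omega> \<in> space seq.S" by (rule AE_space)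
  ultimately show ?thesis
    unfolding randomness_eq
  proof eventually_elim
    case (elim \<omega>)
    have stops: "mt_stops N n s ws sel \<omega>"
    proof (rule ccontr)
      assume "\<not> mt_stops N n s ws sel \<omega>"
      then have bad: "is_bad (mt_matrix N n s ws sel \<omega> k)" for k
        by (simp add: mt_stops_def)
      have "of_nat T \<le> num_resamplings \<omega>" for T
        using sum_le_suminf[of "\<lambda>_. 1::ennreal" "{..<T}"] by (simp add: num_resamplings_def bad)
      then show False
        using elim(1) ennreal_Ex_less_of_nat[of "num_resamplings \<omega>"] by (auto simp: less_top not_less[symmetric])
    qed
    define k where "k = (LEAST k. \<not> is_bad (mt_matrix N n s ws sel \<omega> k))"
    have "\<not> is_bad (mt_matrix N n s ws sel \<omega> k)"
      unfolding k_def by (rule LeastI_ex) (use stops in \<open>simp add: mt_stops_def\<close>)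
    moreover have "mt_matrix N n s ws sel \<omega> k \<in> matrices N n m"
      using measurable_space[OF measurable_mt_matrix elim(2)] by (simp add: states_eq)
    ultimately have "is_SHF N n m s ws (mt_output N n s ws sel \<omega>)"
      unfolding mt_output_def k_def[symmetric] by (simp add: is_SHF_def some_bad_def bad_event_def)
    then show ?case using stops by simp
  qed
qed

text \<open>Every check except the first is preceded by a resampling, so the number of checks
  exceeds the number of resamplings by at most one.\<close>

lemma step_time_sum_le:
  "(\<Sum>k<T. step_time N n s ws sel \<omega> k) \<le> check_time N n s ws +
     (check_time N n s ws + resample_time N s ws) *
       (\<Sum>k<T. of_bool (is_bad (mt_matrix N n s ws sel \<omega> k)))"
proof -
  let ?b = "\<lambda>k. of_bool (is_bad (mt_matrix N n s ws sel \<omega> k)) :: nat"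
  let ?c = "check_time N n s ws" and ?r = "resample_time N s ws"
  \<comment> \<open>A check is charged to the resampling one step earlier; hence the first sum over
    the bad steps ends one index before the second.\<close>
  have "(\<Sum>k<Suc T. step_time N n s ws sel \<omega> k) \<le> ?c + ?c * (\<Sum>k<T. ?b k) + ?r * (\<Sum>k<Suc T. ?b k)" for T
  proof (induction T)
    case (Suc T)
    have "step_time N n s ws sel \<omega> (Suc T) \<le> ?c * ?b T + ?r * ?b (Suc T)"
      by (auto simp: step_time_def)
    then show ?case using Suc.IH by (simp add: algebra_simps)
  qed (simp add: step_time_def)
  note * = this
  show ?thesis
  proof (cases T)
    case (Suc T')
    then show ?thesis using *[of T'] by (simp add: algebra_simps)
  qed simp
qed

theorem expected_mt_time_le:
  "expected_mt_time N n m s ws sel \<le>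
     ennreal (real (N * n + check_time N n s ws) +
       real (check_time N n s ws + resample_time N s ws) * (\<Sum>S\<in>disjoint_families n s ws. \<mu> S))"
proof -
  let ?c = "check_time N n s ws" and ?r = "resample_time N s ws"
  have "mt_time N n s ws sel \<omega> \<le> of_nat (N * n + ?c) + of_nat (?c + ?r) * num_resamplings \<omega>" for \<omega>
  proof -
    let ?b = "\<lambda>k. is_bad (mt_matrix N n s ws sel \<omega> k)"
    have "(\<Sum>k. of_nat (step_time N n s ws sel \<omega> k)) \<le> of_nat ?c + of_nat (?c + ?r) * num_resamplings \<omega>"
    proof (rule suminf_le_const)
      fix T
      have "(\<Sum>k<T. of_nat (step_time N n s ws sel \<omega> k)) =
          (of_nat (\<Sum>k<T. step_time N n s ws sel \<omega> k) :: ennreal)" by simp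
      also have "\<dots> \<le> of_nat (?c + (?c + ?r) * (\<Sum>k<T. of_bool (?b k)))"
        using step_time_sum_le by (simp only: of_nat_le_iff)
      also have "\<dots> = of_nat ?c + of_nat (?c + ?r) * (\<Sum>k<T. of_bool (?b k))" by simp
      also have "\<dots> \<le> of_nat ?c + of_nat (?c + ?r) * num_resamplings \<omega>"
        unfolding num_resamplings_def
        by (intro add_left_mono mult_left_mono sum_le_suminf) auto
      finally show "(\<Sum>k<T. of_nat (step_time N n s ws sel \<omega> k)) \<le>
          of_nat ?c + of_nat (?c + ?r) * num_resamplings \<omega>" .
    qed auto
    then show ?thesis by (simp add: mt_time_def add.assoc add_left_mono)
  qed
  then have "expected_mt_time N n m s ws sel \<le>
      (\<integral>\<^sup>+\<omega>. of_nat (N * n + ?c) + of_nat (?c + ?r) * num_resamplings \<omega> \<partial>seq.S)"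
    unfolding expected_mt_time_def randomness_eq by (intro nn_integral_mono)
  also have "\<dots> = of_nat (N * n + ?c) + of_nat (?c + ?r) * (\<integral>\<^sup>+\<omega>. num_resamplings \<omega> \<partial>seq.S)"
    by (subst nn_integral_add) (auto simp: nn_integral_cmult seq.P.emeasure_space_1)
  also have "\<dots> \<le> of_nat (N * n + ?c) + of_nat (?c + ?r) * ennreal (\<Sum>S\<in>disjoint_families n s ws. \<mu> S)"
    by (intro add_left_mono mult_left_mono nn_integral_num_resamplings_le) simp
  also have "\<dots> = ennreal (real (N * n + ?c) + real (?c + ?r) * (\<Sum>S\<in>disjoint_families n s ws. \<mu> S))"
    using \<mu>_nonneg
    by (simp add: ennreal_of_nat_eq_real_of_nat ennreal_mult ennreal_plus sum_nonneg del: of_nat_add of_nat_mult)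
  finally show ?thesis .
qed

end

end

end

section \<open>Counting disjoint families\<close>

definition ordered_families :: "nat \<Rightarrow> (nat \<Rightarrow> nat) \<Rightarrow> 'a set \<Rightarrow> (nat \<Rightarrow> 'a set) set" where
  "ordered_families s ws X =
     {W \<in> {1..s} \<rightarrow>\<^sub>E Pow X. (\<forall>i\<in>{1..s}. card (W i) = ws i) \<and> disjoint_family_on W {1..s}}"

lemma finite_ordered_families: "finite X \<Longrightarrow> finite (ordered_families s ws X)"
  unfolding ordered_families_def by (simp add: finite_PiE)

text \<open>The multinomial coefficient, freed of division: choose the last block, recurse on the
  remaining points, and drop the factorial of what is left over.\<close>

lemma card_ordered_families_le:
  assumes "finite X"
  shows "card (ordered_families s ws X) * (\<Prod>i=1..s. fact (ws i)) \<le> fact (card X)"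
  using assms
proof (induction s arbitrary: X)
  case 0
  have "ordered_families 0 ws X \<subseteq> {\<lambda>_. undefined}" by (auto simp: ordered_families_def)
  then have "card (ordered_families 0 ws X) \<le> card {\<lambda>_::nat. undefined :: 'a set}"
    by (rule card_mono[rotated]) simp
  then show ?case by (simp add: le_trans[OF _ fact_ge_1])
next
  case (Suc s)
  let ?u = "ws (Suc s)"
  let ?Us = "{U. U \<subseteq> X \<and> card U = ?u}"
  let ?f = "\<lambda>W. (W (Suc s), restrict W {1..s})"
  have finU: "finite ?Us" using Suc.prems by simp
  have "inj_on ?f (ordered_families (Suc s) ws X)"
  proof (rule inj_onI)
    fix W W' assume *: "W \<in> ordered_families (Suc s) ws X" "W' \<in> ordered_families (Suc s) ws X"
      "?f W = ?f W'"
    then have "W i = W' i" if "i \<in> {1..Suc s}" for i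
      using that by (cases "i = Suc s") (auto simp: fun_eq_iff restrict_def split: if_splits)
    then show "W = W'"
      using * by (intro PiE_ext[of W "{1..Suc s}" "\<lambda>_. Pow X" W']) (auto simp: ordered_families_def)
  qed
  moreover have "?f ` ordered_families (Suc s) ws X \<subseteq> Sigma ?Us (\<lambda>U. ordered_families s ws (X - U))"
  proof (rule image_subsetI)
    fix W assume "W \<in> ordered_families (Suc s) ws X"
    then have W: "\<And>i. i \<in> {1..Suc s} \<Longrightarrow> W i \<subseteq> X \<and> card (W i) = ws i"
      and disj: "\<And>i j. i \<in> {1..Suc s} \<Longrightarrow> j \<in> {1..Suc s} \<Longrightarrow> i \<noteq> j \<Longrightarrow> W i \<inter> W j = {}"
      by (auto simp: ordered_families_def disjoint_family_on_def PiE_iff)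
    have "W i \<subseteq> X - W (Suc s)" if "i \<in> {1..s}" for i
      using W[of i] disj[of i "Suc s"] that by auto
    then show "?f W \<in> Sigma ?Us (\<lambda>U. ordered_families s ws (X - U))"
      using W disj by (auto simp: ordered_families_def disjoint_family_on_def)
  qed
  ultimately have "card (ordered_families (Suc s) ws X) \<le>
      card (Sigma ?Us (\<lambda>U. ordered_families s ws (X - U)))"
    using finU Suc.prems by (intro card_inj_on_le) (auto intro!: finite_SigmaI finite_ordered_families)
  also have "\<dots> = (\<Sum>U\<in>?Us. card (ordered_families s ws (X - U)))"
    using finU Suc.prems by (subst card_SigmaI) (auto simp: finite_ordered_families)
  finally have "card (ordered_families (Suc s) ws X) * (\<Prod>i=1..Suc s. fact (ws i)) \<le>
      (\<Sum>U\<in>?Us. card (ordered_families s ws (X - U))) * (\<Prod>i=1..Suc s. fact (ws i))"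
    by (rule mult_le_mono1)
  also have "\<dots> = (\<Sum>U\<in>?Us. card (ordered_families s ws (X - U)) * (\<Prod>i=1..s. fact (ws i)) * fact ?u)"
    by (simp add: sum_distrib_left mult_ac)
  also have "\<dots> \<le> (\<Sum>U\<in>?Us. fact (card X - ?u) * fact ?u)"
  proof (intro sum_mono mult_le_mono1)
    fix U assume "U \<in> ?Us"
    then have "card (X - U) = card X - ?u"
      using Suc.prems by (auto simp: card_Diff_subset finite_subset)
    then show "card (ordered_families s ws (X - U)) * (\<Prod>i=1..s. fact (ws i)) \<le> fact (card X - ?u)"
      using Suc.IH[of "X - U"] Suc.prems by simp
  qed
  also have "\<dots> = (card X choose ?u) * (fact (card X - ?u) * fact ?u)"
    using n_subsets[OF Suc.prems, of ?u] by simp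
  also have "\<dots> \<le> fact (card X)"
    by (cases "?u \<le> card X") (simp_all add: binomial_fact_lemma[symmetric] mult_ac binomial_eq_0)
  finally show ?case .
qed

text \<open>Blocks of equal size may be renumbered among themselves, and each renumbering turns an
  unordered family into a different ordered one.\<close>

lemma card_families_Union_mult_le:
  assumes ws_pos: "\<And>i. i \<in> {1..s} \<Longrightarrow> 0 < ws i" and ws_le: "\<And>i. i \<in> {1..s} \<Longrightarrow> ws i \<le> w"
    and X: "finite X"
  shows "card {S \<in> disjoint_families n s ws. \<Union>S = X} *
           (\<Prod>p=1..w. fact (multiplicity_of_size s ws p)) \<le> card (ordered_families s ws X)"
proof -
  let ?F = "{S \<in> disjoint_families n s ws. \<Union>S = X}"
  let ?C = "\<lambda>p. {i \<in> {1..s}. ws i = p}"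
  define G where "G = (\<Pi>\<^sub>E p\<in>{1..w}. {\<sigma>. \<sigma> permutes ?C p})"
  let ?P = "\<lambda>(S :: family) W. S = W ` {1..s} \<and> (\<forall>i\<in>{1..s}. card (W i) = ws i) \<and> disjoint_family_on W {1..s}"
  have ex: "\<exists>W. ?P S W"
    if "S \<in> ?F" for S
  proof -
    from that have "S \<in> disjoint_families n s ws" by simp
    then show ?thesis by (rule disjoint_familiesE) (intro exI conjI)
  qed
  define W where "W S = (SOME W. ?P S W)" for S
  have "?P S (W S)" if "S \<in> ?F" for S
    using someI_ex[OF ex[OF that]] unfolding W_def .
  then have W: "S = W S ` {1..s}" "i \<in> {1..s} \<Longrightarrow> card (W S i) = ws i"
      "disjoint_family_on (W S) {1..s}" if "S \<in> ?F" for S i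
    using that by (blast+)
  \<comment> \<open>\<open>h\<close> renumbers the chosen enumeration of \<open>S\<close> within
    each size class. Its range is still \<open>S\<close>, and since \<open>W S\<close> is injective
    the renumbering can be read off as well.\<close>
  define h where "h = (\<lambda>(S, \<sigma>). restrict (\<lambda>i. W S ((\<sigma> (ws i) :: nat \<Rightarrow> nat) i)) {1..s})"
  \<comment> \<open>Two equal disjoint blocks would be empty, which the positive sizes
    exclude.\<close>
  have injW: "inj_on (W S) {1..s}" if S: "S \<in> ?F" for S
  proof (rule inj_onI)
    fix i j assume *: "i \<in> {1..s}" "j \<in> {1..s}" "W S i = W S j"
    show "i = j"
    proof (rule ccontr)
      assume "i \<noteq> j"
      then have "W S i \<inter> W S j = {}" by (rule disjoint_family_onD[OF W(3)[OF S] *(1,2)])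
      then have "card (W S i) = 0" using * by simp
      then show False using W(2)[OF S *(1)] ws_pos[OF *(1)] by simp
    qed
  qed
  have perm: "\<sigma> (ws i) permutes ?C (ws i)" if "\<sigma> \<in> G" "i \<in> {1..s}" for \<sigma> i
    using that ws_pos[OF that(2)] ws_le[OF that(2)] by (auto simp: G_def PiE_iff Suc_le_eq)
  have mem: "\<sigma> (ws i) i \<in> {1..s}" "ws (\<sigma> (ws i) i) = ws i" if "\<sigma> \<in> G" "i \<in> {1..s}" for \<sigma> i
  proof -
    have "\<sigma> (ws i) i \<in> ?C (ws i)" using permutes_in_image[OF perm[OF that]] that by simp
    then show "\<sigma> (ws i) i \<in> {1..s}" "ws (\<sigma> (ws i) i) = ws i" by auto
  qed
  have inj\<sigma>: "inj_on (\<lambda>i. \<sigma> (ws i) i) {1..s}" if "\<sigma> \<in> G" for \<sigma>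
  proof (rule inj_onI)
    fix i j assume *: "i \<in> {1..s}" "j \<in> {1..s}" "\<sigma> (ws i) i = \<sigma> (ws j) j"
    then have "ws i = ws j" using mem(2)[OF that *(1)] mem(2)[OF that *(2)] by simp
    then show "i = j" using * permutes_inj[OF perm[OF that *(1)]] by (auto dest: injD)
  qed
  have im\<sigma>: "(\<lambda>i. \<sigma> (ws i) i) ` {1..s} = {1..s}" if "\<sigma> \<in> G" for \<sigma>
    by (rule endo_inj_surj) (use inj\<sigma>[OF that] mem(1)[OF that] in auto)
  have h_image: "h (S, \<sigma>) ` {1..s} = S" if "S \<in> ?F" "\<sigma> \<in> G" for S \<sigma>
  proof -
    have "h (S, \<sigma>) ` {1..s} = W S ` (\<lambda>i. \<sigma> (ws i) i) ` {1..s}"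
      by (simp add: h_def image_image)
    then show ?thesis using W(1)[OF that(1)] im\<sigma>[OF that(2)] by simp
  qed
  have "inj_on h (?F \<times> G)"
  proof (rule inj_onI, clarify)
    fix S \<sigma> S' \<sigma>'
    assume S: "S \<in> disjoint_families n s ws" "X = \<Union>S" "S' \<in> disjoint_families n s ws" "\<Union>S' = \<Union>S"
      and \<sigma>: "\<sigma> \<in> G" "\<sigma>' \<in> G" and eq: "h (S, \<sigma>) = h (S', \<sigma>')"
    have SF: "S \<in> ?F" "S' \<in> ?F" using S by auto
    have "S = S'" using h_image[OF SF(1) \<sigma>(1)] h_image[OF SF(2) \<sigma>(2)] eq by simp
    moreover have "\<sigma> = \<sigma>'"
    proof (rule PiE_ext)
      show "\<sigma> \<in> (\<Pi>\<^sub>E p\<in>{1..w}. {\<sigma>. \<sigma> permutes ?C p})" "\<sigma>' \<in> (\<Pi>\<^sub>E p\<in>{1..w}. {\<sigma>. \<sigma> permutes ?C p})"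
        using \<sigma> by (auto simp: G_def)
      fix p assume p: "p \<in> {1..w}"
      show "\<sigma> p = \<sigma>' p"
      proof
        fix i
        show "\<sigma> p i = \<sigma>' p i"
        proof (cases "i \<in> ?C p")
          case True
          then have i: "i \<in> {1..s}" "ws i = p" by auto
          have "W S (\<sigma> (ws i) i) = W S (\<sigma>' (ws i) i)"
            using fun_cong[OF eq, of i] i \<open>S = S'\<close> by (simp add: h_def)
          then have "\<sigma> (ws i) i = \<sigma>' (ws i) i"
            by (rule inj_onD[OF injW[OF SF(1)]]) (use mem(1)[OF \<sigma>(1) i(1)] mem(1)[OF \<sigma>(2) i(1)] in auto)
          then show ?thesis using i by simp
        next
          case False
          have "\<sigma> p permutes ?C p" "\<sigma>' p permutes ?C p"
            using \<sigma> p by (auto simp: G_def PiE_iff)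
          from permutes_not_in[OF this(1) False] permutes_not_in[OF this(2) False]
          show ?thesis by simp
        qed
      qed
    qed
    ultimately show "S = S' \<and> \<sigma> = \<sigma>'" by simp
  qed
  moreover have "h ` (?F \<times> G) \<subseteq> ordered_families s ws X"
  proof (rule image_subsetI)
    fix x assume "x \<in> ?F \<times> G"
    then obtain S \<sigma> where x: "x = (S, \<sigma>)" and S: "S \<in> ?F" and \<sigma>: "\<sigma> \<in> G" by blast
    have "W S (\<sigma> (ws i) i) \<subseteq> X" "card (W S (\<sigma> (ws i) i)) = ws i" if "i \<in> {1..s}" for i
    proof -
      have "W S (\<sigma> (ws i) i) \<in> W S ` {1..s}" by (rule imageI[OF mem(1)[OF \<sigma> that]])
      then have "W S (\<sigma> (ws i) i) \<in> S" by (simp only: W(1)[OF S, symmetric])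
      then show "W S (\<sigma> (ws i) i) \<subseteq> X" using S by auto
      show "card (W S (\<sigma> (ws i) i)) = ws i" using W(2)[OF S] mem[OF \<sigma> that] by simp
    qed
    moreover have "disjoint_family_on (h x) {1..s}"
      unfolding disjoint_family_on_def
    proof (intro ballI impI)
      fix i j assume *: "i \<in> {1..s}" "j \<in> {1..s}" "i \<noteq> j"
      then have "\<sigma> (ws i) i \<noteq> \<sigma> (ws j) j" using inj_onD[OF inj\<sigma>[OF \<sigma>] _ *(1,2)] by auto
      then have "W S (\<sigma> (ws i) i) \<inter> W S (\<sigma> (ws j) j) = {}"
        by (rule disjoint_family_onD[OF W(3)[OF S] mem(1)[OF \<sigma> *(1)] mem(1)[OF \<sigma> *(2)]])
      then show "h x i \<inter> h x j = {}" using * by (simp add: h_def x)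
    qed
    ultimately show "h x \<in> ordered_families s ws X"
      by (simp add: ordered_families_def h_def x)
  qed
  ultimately have "card (?F \<times> G) \<le> card (ordered_families s ws X)"
    by (intro card_inj_on_le[OF _ _ finite_ordered_families[OF X]])
  moreover have "card G = (\<Prod>p=1..w. fact (multiplicity_of_size s ws p))"
    unfolding G_def multiplicity_of_size_def
    by (subst card_PiE) (auto intro!: prod.cong card_permutations)
  ultimately show ?thesis by (simp add: card_cartesian_product)
qed

lemma shf_M_pos: "shf_M w s ws > 0"
  unfolding shf_M_def by (intro mult_pos_pos divide_pos_pos prod_pos) auto

lemma shf_M_le: "shf_M w s ws \<le> fact w"
proof -
  have "(1::real) \<le> (\<Prod>p=1..w. fact (multiplicity_of_size s ws p)) * (\<Prod>i=1..s. fact (ws i))"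
    using mult_mono[of 1 "\<Prod>p=1..w. fact (multiplicity_of_size s ws p) :: real" 1 "\<Prod>i=1..s. fact (ws i)"]
    by (simp add: prod_ge_1 prod_nonneg)
  then show ?thesis unfolding shf_M_def
    by (simp add: divide_le_eq_1 divide_le_eq mult_ac zero_less_mult_iff prod_pos)
qed

lemma card_Union_family:
  assumes "S \<in> disjoint_families n s ws"
  shows "card (\<Union>S) = (\<Sum>i=1..s. ws i)"
proof -
  from assms obtain W where W: "S = W ` {1..s}" "\<forall>i\<in>{1..s}. W i \<subseteq> {1..n}"
    "\<forall>i\<in>{1..s}. card (W i) = ws i" "disjoint_family_on W {1..s}"
    by (rule disjoint_familiesE)
  have "card (\<Union>i\<in>{1..s}. W i) = (\<Sum>i\<in>{1..s}. card (W i))"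
  proof (rule card_UN_disjoint')
    show "finite (W i)" if "i \<in> {1..s}" for i
      using W(2) that by (meson finite_atLeastAtMost finite_subset)
  qed (use W in auto)
  then show ?thesis using W by simp
qed

lemma card_families_Union_le:
  assumes ws_pos: "\<And>i. i \<in> {1..s} \<Longrightarrow> 0 < ws i" and w: "(\<Sum>i=1..s. ws i) = w"
  shows "real (card {S \<in> disjoint_families n s ws. \<Union>S = X}) \<le> shf_M w s ws"
proof (cases "{S \<in> disjoint_families n s ws. \<Union>S = X} = {}")
  case True
  then have "card {S \<in> disjoint_families n s ws. \<Union>S = X} = 0" by (simp only: card.empty)
  then show ?thesis using shf_M_pos[of w s ws] by linarith
next
  case False
  then obtain S where S: "S \<in> disjoint_families n s ws" "\<Union>S = X" by blast
  have X: "finite X" "card X = w"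
    using Union_disjoint_families[OF S(1)] card_Union_family[OF S(1)] S(2) w
    by (auto intro: finite_subset)
  have le: "ws i \<le> w" if "i \<in> {1..s}" for i
    unfolding w[symmetric] using that by (intro member_le_sum) auto
  define F where "F = card {S \<in> disjoint_families n s ws. \<Union>S = X}"
  have "F * (\<Prod>p=1..w. fact (multiplicity_of_size s ws p)) * (\<Prod>i=1..s. fact (ws i)) \<le>
      card (ordered_families s ws X) * (\<Prod>i=1..s. fact (ws i))"
    unfolding F_def by (rule mult_le_mono1[OF card_families_Union_mult_le[OF ws_pos le X(1)]])
  also have "\<dots> \<le> fact w"
    using card_ordered_families_le[OF X(1), of s ws] X(2) by simp
  finally have "real (F * (\<Prod>p=1..w. fact (multiplicity_of_size s ws p)) * (\<Prod>i=1..s. fact (ws i)))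
      \<le> real (fact w)"
    by (rule of_nat_mono)
  then have "real F * (\<Prod>p=1..w. fact (multiplicity_of_size s ws p)) * (\<Prod>i=1..s. fact (ws i)) \<le> fact w"
    by simp
  then show ?thesis
    unfolding shf_M_def F_def[symmetric] by (simp add: field_simps prod_pos)
qed

section \<open>Falling factorials and the terms of Gamma\<close>

definition ffact :: "real \<Rightarrow> nat \<Rightarrow> real" where
  "ffact x a = (\<Prod>i<a. x - real i)"

text \<open>Removing one block at a time lowers the argument. Real arguments make this exact even
  when it becomes negative, where natural subtraction would truncate.\<close>

lemma ffact_add: "ffact x (a + b) = ffact x a * ffact (x - real a) b"
proof (induction b)
  case (Suc b)
  then show ?case by (simp add: ffact_def algebra_simps)
qed (simp add: ffact_def)

lemma ffact_eq_binomial: "ffact (real x) a = fact a * real (x choose a)"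
  by (simp add: ffact_def binomial_gbinomial gbinomial_prod_rev atLeast0LessThan)

lemma ffact_nonneg: "ffact (real x) a \<ge> 0"
  by (simp add: ffact_eq_binomial)

lemma binomial_eq_ffact: "real (x choose a) = ffact (real x) a / fact a"
  by (simp add: ffact_eq_binomial)

text \<open>With \<open>y = n - w\<close> this is the source of the first product in
  \<open>shf_Gamma\<close>.\<close>

lemma ffact_eq_power: "y > 0 \<Longrightarrow> ffact y a = y ^ a * (\<Prod>l=1..a-1. 1 - real l / y)"
proof (induction a)
  case (Suc a)
  show ?case
  proof (cases a)
    case (Suc b)
    have "ffact y (Suc a) = ffact y a * (y - real a)" by (simp add: ffact_def)
    also have "\<dots> = y ^ a * (\<Prod>l=1..a-1. 1 - real l / y) * (y * (1 - real a / y))"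
      using Suc.IH Suc.prems by (simp add: field_simps)
    finally show ?thesis using Suc by simp
  qed (simp add: ffact_def)
qed (simp add: ffact_def)

text \<open>The source of the products over \<open>r\<close> in \<open>shf_Gamma\<close>: a family
  that shares \<open>i + 1\<close> columns with the given one contributes
  \<open>1 / fact (w - (i + 1))\<close>, measured against \<open>1 / fact (w - 1)\<close>.\<close>

lemma inverse_fact_diff:
  assumes "i < w"
  shows "1 / fact (w - 1 - i) = real w ^ i * (\<Prod>r=1..i. 1 - real r / real w) / fact (w - 1)"
  using assms
proof (induction i)
  case (Suc i)
  have "w - 1 - i = Suc (w - 1 - Suc i)" using Suc.prems by simp
  then have "fact (w - 1 - i) = real (w - 1 - i) * fact (w - 1 - Suc i)"
    by (metis fact_Suc)
  moreover have "real (w - 1 - i) = real w - real (Suc i)" using Suc.prems by simp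
  moreover have "real w - real (Suc i) > 0" using Suc.prems by simp
  ultimately have "1 / fact (w - 1 - Suc i) = (real w - real (Suc i)) * (1 / fact (w - 1 - i))"
    by simp
  also have "\<dots> = (real w - real (Suc i)) * (real w ^ i * (\<Prod>r=1..i. 1 - real r / real w) / fact (w - 1))"
    using Suc.IH Suc.prems by simp
  also have "real w - real (Suc i) = real w * (1 - real (Suc i) / real w)"
    using Suc.prems by (simp add: field_simps)
  finally show ?case by (simp add: mult_ac)
qed simp

text \<open>Entry \<open>l\<close> is the number of columns that the \<open>l\<close>-th family
  shares with the given one. The shift by one encodes that at least one column is shared.\<close>

definition composition_blocks :: "nat \<Rightarrow> (nat \<Rightarrow> nat) \<Rightarrow> nat list" where
  "composition_blocks k i = map (\<lambda>l. i l + 1) [1..<Suc k]"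

text \<open>For natural \<open>x\<close> and \<open>y\<close>, a product of two multinomial
  coefficients: the number of ordered tuples of disjoint \<open>w\<close>-sets, one per entry
  \<open>b\<close>, with \<open>b\<close> points in an \<open>x\<close>-set and \<open>w - b\<close>
  points in a \<open>y\<close>-set disjoint from it.\<close>

definition count_term :: "nat \<Rightarrow> real \<Rightarrow> real \<Rightarrow> nat list \<Rightarrow> real" where
  "count_term w x y bs = ffact x (sum_list bs) * ffact y (\<Sum>b\<leftarrow>bs. w - b) /
     ((\<Prod>b\<leftarrow>bs. fact b) * (\<Prod>b\<leftarrow>bs. fact (w - b)))"

lemma composition_blocks_conv:
  "(\<Sum>b\<leftarrow>composition_blocks k i. f b :: nat) = (\<Sum>l=1..k. f (i l + 1))"
  "(\<Prod>b\<leftarrow>composition_blocks k i. g b :: real) = (\<Prod>l=1..k. g (i l + 1))"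
proof -
  have set_upt': "set [1..<Suc k] = {1..k}" by auto
  show "(\<Sum>b\<leftarrow>composition_blocks k i. f b) = (\<Sum>l=1..k. f (i l + 1))"
    unfolding set_upt'[symmetric] sum.distinct_set_conv_list[OF distinct_upt]
    by (simp only: composition_blocks_def map_map comp_def)
  show "(\<Prod>b\<leftarrow>composition_blocks k i. g b) = (\<Prod>l=1..k. g (i l + 1))"
    unfolding set_upt'[symmetric] prod.distinct_set_conv_list[OF distinct_upt]
    by (simp only: composition_blocks_def map_map comp_def)
qed

definition gamma_summand :: "nat \<Rightarrow> nat \<Rightarrow> nat \<Rightarrow> nat \<Rightarrow> (nat \<Rightarrow> nat) \<Rightarrow> real" where
  "gamma_summand w n k j i =
     real ((w - k) choose j) * (\<Prod>l=1..k*(w-1)-j-1. 1 - real l / (real n - real w)) *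
       (real w / (real n - real w)) ^ j *
       (fact j / (\<Prod>l=1..k. fact (i l)) *
         (\<Prod>l=1..k. 1 / (real (i l) + 1) * (\<Prod>r=1..i l. 1 - real r / real w)))"

lemma shf_Gamma_eq:
  "shf_Gamma w n k = (\<Sum>j=0..w-k. \<Sum>i\<in>weak_compositions k j. gamma_summand w n k j i)"
  unfolding shf_Gamma_def gamma_summand_def by (simp only: sum_distrib_left)

text \<open>The estimate, by a power in place of a falling factorial, for the number of ways to
  complete one column of the given family by \<open>w - 1\<close> columns outside it.\<close>

definition block_scale :: "nat \<Rightarrow> nat \<Rightarrow> real" where
  "block_scale w n = (real n - real w) ^ (w - 1) / fact (w - 1)"

text \<open>Each factor of Gamma has its origin here. \<open>ffact w (k + j)\<close> yields both
  binomial coefficients and the factorials of \<open>k\<close> and \<open>j\<close>; the falling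
  factorial of \<open>n - w\<close> yields the first product. The powers of \<open>n - w\<close>
  missing from \<open>block_scale w n ^ k\<close> and the powers of \<open>w\<close> from
  \<open>inverse_fact_diff\<close> form the \<open>j\<close>-th power. The factor
  \<open>fact k\<close> counts the orders of the families.\<close>

lemma count_term_composition:
  assumes k: "1 \<le> k" "k \<le> w" and n: "w < n" and j: "j \<le> w - k" and i: "i \<in> weak_compositions k j"
  shows "count_term w (real w) (real n - real w) (composition_blocks k i) =
    fact k * (real (w choose k) * block_scale w n ^ k * gamma_summand w n k j i)"
proof -
  define y where "y = real n - real w"
  have y: "y > 0" using n by (simp add: y_def)
  have isum: "(\<Sum>l=1..k. i l) = j" using i by (simp add: weak_compositions_def)
  have il: "i l < w" if "l \<in> {1..k}" for l
  proof -
    have "i l \<le> (\<Sum>l=1..k. i l)" by (rule member_le_sum) (use that in auto)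
    then show ?thesis using isum j k by simp
  qed
  \<comment> \<open>Makes the subtraction in the exponent exact.\<close>
  have jk: "j \<le> k * (w - 1)"
  proof -
    have "w - k \<le> k * (w - 1)" using k by (cases k) (auto simp: algebra_simps)
    then show ?thesis using j by simp
  qed
  have s1: "sum_list (composition_blocks k i) = k + j"
  proof -
    have "(\<Sum>l=1..k. i l + 1) = k + j" unfolding sum.distrib isum by simp
    then show ?thesis using composition_blocks_conv(1)[of "\<lambda>b. b" k i] by simp
  qed
  have s2: "(\<Sum>b\<leftarrow>composition_blocks k i. w - b) = k * (w - 1) - j"
  proof -
    have "(\<Sum>l=1..k. w - (i l + 1)) + (\<Sum>l=1..k. i l) = (\<Sum>l=1..k. w - 1)"
      unfolding sum.distrib[symmetric] by (rule sum.cong) (use il in fastforce)+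
    then show ?thesis using isum by (simp add: composition_blocks_conv(1))
  qed
  have f1: "ffact (real w) (k + j) = fact k * real (w choose k) * (fact j * real ((w - k) choose j))"
    using k by (simp add: ffact_add ffact_eq_binomial flip: of_nat_diff)
  have f2: "ffact y (k * (w - 1) - j) = (y ^ (w - 1)) ^ k / y ^ j * (\<Prod>l=1..k*(w-1)-j-1. 1 - real l / y)"
  proof -
    have "y ^ (k * (w - 1) - j) = y ^ (k * (w - 1)) / y ^ j"
      using y jk by (simp add: power_diff)
    then show ?thesis using ffact_eq_power[OF y, of "k * (w - 1) - j"]
      by (simp add: power_mult[symmetric] mult.commute)
  qed
  have p1: "(\<Prod>b\<leftarrow>composition_blocks k i. fact b :: real) = (\<Prod>l=1..k. real (i l) + 1) * (\<Prod>l=1..k. fact (i l))"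
    by (simp add: composition_blocks_conv(2) prod.distrib[symmetric] add.commute)
  have p2: "1 / (\<Prod>b\<leftarrow>composition_blocks k i. fact (w - b) :: real) =
      real w ^ j * (\<Prod>l=1..k. \<Prod>r=1..i l. 1 - real r / real w) / fact (w - 1) ^ k"
  proof -
    have "1 / (\<Prod>b\<leftarrow>composition_blocks k i. fact (w - b) :: real) = (\<Prod>l=1..k. 1 / fact (w - 1 - i l))"
      by (simp add: composition_blocks_conv(2) prod_dividef)
    also have "\<dots> = (\<Prod>l=1..k. real w ^ i l * (\<Prod>r=1..i l. 1 - real r / real w) / fact (w - 1))"
      by (intro prod.cong refl inverse_fact_diff il)
    also have "\<dots> = (\<Prod>l=1..k. real w ^ i l) * (\<Prod>l=1..k. \<Prod>r=1..i l. 1 - real r / real w) / fact (w - 1) ^ k"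
      by (simp add: prod_dividef prod.distrib)
    also have "(\<Prod>l=1..k. real w ^ i l) = real w ^ j"
      unfolding isum[symmetric] by (rule power_sum[symmetric])
    finally show ?thesis .
  qed
  have "count_term w (real w) y (composition_blocks k i) =
      ffact (real w) (k + j) * ffact y (k * (w - 1) - j) /
        (\<Prod>b\<leftarrow>composition_blocks k i. fact b) * (1 / (\<Prod>b\<leftarrow>composition_blocks k i. fact (w - b)))"
    by (simp add: count_term_def s1 s2)
  also have "\<dots> = fact k * (real (w choose k) * block_scale w n ^ k * gamma_summand w n k j i)"
    unfolding f1 f2 p1 p2 gamma_summand_def block_scale_def y_def[symmetric] prod.distrib prod_dividef
    using y by (simp add: power_divide mult_ac)
  finally show ?thesis by (simp add: y_def)
qed

lemma count_term_nonneg: "count_term w (real x) (real y) bs \<ge> 0"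
  unfolding count_term_def
  by (intro divide_nonneg_nonneg mult_nonneg_nonneg ffact_nonneg prod_list_nonneg) auto

text \<open>Single factors \<open>1 - l / (n - w)\<close> may be negative. The full product comes
  from a falling factorial of the natural number \<open>n - w\<close>, which passes through zero
  before any sign could change; so the sign is read off \<open>count_term\<close>.\<close>

lemma gamma_summand_nonneg:
  assumes "1 \<le> k" "k \<le> w" "w < n" "j \<le> w - k" "i \<in> weak_compositions k j"
  shows "gamma_summand w n k j i \<ge> 0"
proof -
  have "0 \<le> count_term w (real w) (real (n - w)) (composition_blocks k i)" by (rule count_term_nonneg)
  also have "real (n - w) = real n - real w" using assms by simp
  finally have "0 \<le> fact k * (real (w choose k) * block_scale w n ^ k) * gamma_summand w n k j i"
    unfolding count_term_composition[OF assms] by (simp add: mult.assoc)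
  moreover have "0 < fact k * (real (w choose k) * block_scale w n ^ k)"
    using assms by (simp add: block_scale_def)
  ultimately show ?thesis by (simp only: zero_le_mult_iff) linarith
qed

lemma shf_Gamma_nonneg: "1 \<le> k \<Longrightarrow> k \<le> w \<Longrightarrow> w < n \<Longrightarrow> shf_Gamma w n k \<ge> 0"
  unfolding shf_Gamma_eq by (intro sum_nonneg gamma_summand_nonneg) auto

lemma finite_weak_compositions: "finite (weak_compositions k j)"
  unfolding weak_compositions_def by (simp add: finite_PiE)

text \<open>The summand with \<open>j = w - 2\<close> and \<open>(i\<^sub>1, i\<^sub>2) = (w - 2, 0)\<close> counts \<open>w\<^sup>2 ((n - w) choose w)\<close> pairs.\<close>

lemma shf_Gamma_2_ge:
  assumes "2 \<le> w" "2 * w \<le> n"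
  shows "real (w choose 2) * block_scale w n ^ 2 * shf_Gamma w n 2 \<ge> 1"
proof -
  define i where "i = (\<lambda>l::nat. if l = 1 then w - 2 else if l = 2 then 0 else undefined :: nat)"
  have set2: "{1..2::nat} = {1, 2}" by auto
  have i: "i \<in> weak_compositions 2 (w - 2)"
    unfolding weak_compositions_def set2 by (auto simp: i_def PiE_iff extensional_def)
  have blocks: "composition_blocks 2 i = [w - 1, 1]"
    using assms by (simp add: composition_blocks_def i_def upt_rec numeral_2_eq_2)
  have wn: "w < n" "1 \<le> (2::nat)" using assms by auto
  have "(\<Sum>j=0..w-2. \<Sum>i\<in>weak_compositions 2 j. gamma_summand w n 2 j i) \<ge>
      (\<Sum>i\<in>weak_compositions 2 (w-2). gamma_summand w n 2 (w-2) i)"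
    using assms wn
    by (intro member_le_sum[where f = "\<lambda>j. \<Sum>i\<in>weak_compositions 2 j. gamma_summand w n 2 j i"]
        sum_nonneg gamma_summand_nonneg) auto
  also have "(\<Sum>i\<in>weak_compositions 2 (w-2). gamma_summand w n 2 (w-2) i) \<ge> gamma_summand w n 2 (w-2) i"
    using assms wn
    by (intro member_le_sum i finite_weak_compositions gamma_summand_nonneg) auto
  finally have ge: "shf_Gamma w n 2 \<ge> gamma_summand w n 2 (w-2) i" by (simp add: shf_Gamma_eq)
  have scale: "block_scale w n > 0" using wn by (simp add: block_scale_def)
  have fact_w: "fact w = real w * fact (w - 1)" using assms by (simp add: fact_reduce)
  have "count_term w (real w) (real (n - w)) [w - 1, 1] =
      (fact w * (fact w * real ((n - w) choose w))) / (fact (w - 1) * fact (w - 1))"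
  proof -
    have "sum_list [w - 1, 1] = w" "(\<Sum>b\<leftarrow>[w - 1, 1]. w - b) = w" using assms by auto
    moreover have "w - (w - 1) = 1" using assms by simp
    ultimately show ?thesis
      unfolding count_term_def by (simp add: ffact_eq_binomial)
  qed
  also have "\<dots> = real w * real w * real ((n - w) choose w)" by (simp add: fact_w)
  finally have ct: "count_term w (real w) (real (n - w)) [w - 1, 1] = real w * real w * real ((n - w) choose w)" .
  \<comment> \<open>The two families use \<open>1\<close> and \<open>w - 1\<close> columns outside
    the given one, together \<open>w\<close>, and \<open>2 * w \<le> n\<close> leaves room for them.
    The factor \<open>w * w\<close> then absorbs the \<open>fact 2\<close> orders of the
    pair.\<close>
  have "(n - w) choose w \<ge> 1" using assms by (simp add: Suc_le_eq zero_less_binomial)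
  then have "1 \<le> real ((n - w) choose w)" by linarith
  moreover have "2 * 1 \<le> real w * real w" using assms by (intro mult_mono) auto
  ultimately have "2 * 1 \<le> real w * real w * real ((n - w) choose w)"
    by (intro mult_mono) auto
  then have "2 \<le> count_term w (real w) (real n - real w) (composition_blocks 2 i)"
    using ct wn by (simp add: blocks)
  then have "2 \<le> fact 2 * (real (w choose 2) * block_scale w n ^ 2 * gamma_summand w n 2 (w-2) i)"
    using count_term_composition[of 2 w n "w-2" i] assms wn i by simp
  then have "1 \<le> real (w choose 2) * block_scale w n ^ 2 * gamma_summand w n 2 (w-2) i"
    by (simp add: fact_2)
  also have "\<dots> \<le> real (w choose 2) * block_scale w n ^ 2 * shf_Gamma w n 2"
    using ge scale by (intro mult_left_mono) auto
  finally show ?thesis .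
qed

text \<open>Choose the columns inside \<open>X\<close>, then those in the rest, then one of at most
  \<open>shf_M w s ws\<close> ways to cut the resulting set into blocks.\<close>

lemma (in shf) card_families_blocks_le:
  assumes fin: "finite X" "finite Y" and b: "b \<le> w"
  shows "real (card {S \<in> disjoint_families n s ws. \<Union>S \<subseteq> X \<union> Y \<and> card (\<Union>S \<inter> X) = b}) \<le>
    real (card X choose b) * real (card Y choose (w - b)) * shf_M w s ws"
proof -
  let ?P = "{P. P \<subseteq> X \<and> card P = b}" and ?Q = "{Q. Q \<subseteq> Y \<and> card Q = w - b}"
  let ?F = "\<lambda>U. {S \<in> disjoint_families n s ws. \<Union>S = U}"
  have sub: "{S \<in> disjoint_families n s ws. \<Union>S \<subseteq> X \<union> Y \<and> card (\<Union>S \<inter> X) = b} \<subseteq>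
      (\<Union>(P, Q)\<in>?P \<times> ?Q. ?F (P \<union> Q))"
  proof
    fix S assume "S \<in> {S \<in> disjoint_families n s ws. \<Union>S \<subseteq> X \<union> Y \<and> card (\<Union>S \<inter> X) = b}"
    then have S: "S \<in> disjoint_families n s ws" "\<Union>S \<subseteq> X \<union> Y" "card (\<Union>S \<inter> X) = b" by auto
    have "card (\<Union>S) = w" using card_Union_family[OF S(1)] ws_sum by simp
    moreover have "finite (\<Union>S)" using S(2) fin by (meson finite_Un finite_subset)
    ultimately have "card (\<Union>S - X) = w - b"
      using card_Diff_subset_Int[of "\<Union>S" X] S(3) fin by simp
    then have "(\<Union>S \<inter> X, \<Union>S - X) \<in> ?P \<times> ?Q" using S by auto
    moreover have "S \<in> ?F ((\<Union>S \<inter> X) \<union> (\<Union>S - X))" using S(1) by (simp add: Int_Diff_Un)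
    ultimately show "S \<in> (\<Union>(P, Q)\<in>?P \<times> ?Q. ?F (P \<union> Q))" by (intro UN_I[of "(\<Union>S \<inter> X, \<Union>S - X)"]) auto
  qed
  have finPQ: "finite (?P \<times> ?Q)" using fin by simp
  have "card {S \<in> disjoint_families n s ws. \<Union>S \<subseteq> X \<union> Y \<and> card (\<Union>S \<inter> X) = b} \<le>
      card (\<Union>(P, Q)\<in>?P \<times> ?Q. ?F (P \<union> Q))"
    by (rule card_mono[OF _ sub]) (use finPQ finite_disjoint_families in auto)
  also have "\<dots> \<le> (\<Sum>(P, Q)\<in>?P \<times> ?Q. card (?F (P \<union> Q)))"
    using card_UN_le[OF finPQ, of "\<lambda>(P, Q). ?F (P \<union> Q)"] by (simp add: case_prod_beta)
  finally have "real (card {S \<in> disjoint_families n s ws. \<Union>S \<subseteq> X \<union> Y \<and> card (\<Union>S \<inter> X) = b}) \<le>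
      (\<Sum>(P, Q)\<in>?P \<times> ?Q. real (card (?F (P \<union> Q))))"
    by (simp add: case_prod_beta flip: of_nat_sum)
  also have "\<dots> \<le> (\<Sum>(P, Q)\<in>?P \<times> ?Q. shf_M w s ws)"
    by (intro sum_mono) (auto intro!: card_families_Union_le ws_pos ws_sum)
  also have "\<dots> = real (card X choose b) * real (card Y choose (w - b)) * shf_M w s ws"
    by (simp add: card_cartesian_product n_subsets[OF fin(1)] n_subsets[OF fin(2)])
  finally show ?thesis .
qed

section \<open>Independent sets of families meeting a given family\<close>

context shf
begin

text \<open>Lists in place of sets, so that members can be chosen and counted one after another;
  deleting the columns already taken enforces disjointness.\<close>

fun family_lists :: "nat set \<Rightarrow> nat set \<Rightarrow> nat list \<Rightarrow> family list set" where
  "family_lists X Y [] = {[]}"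
| "family_lists X Y (b # bs) =
     (\<lambda>(S, Ss). S # Ss) `
       Sigma {S \<in> disjoint_families n s ws. \<Union>S \<subseteq> X \<union> Y \<and> card (\<Union>S \<inter> X) = b}
         (\<lambda>S. family_lists (X - \<Union>S) (Y - \<Union>S) bs)"

lemma finite_family_lists: "finite (family_lists X Y bs)"
  by (induction bs arbitrary: X Y) (auto intro!: finite_imageI finite_SigmaI simp: finite_disjoint_families)

lemma card_family_lists_le:
  assumes "finite X" "finite Y" "X \<inter> Y = {}" "\<forall>b\<in>set bs. b \<le> w"
  shows "real (card (family_lists X Y bs)) \<le>
    shf_M w s ws ^ length bs * count_term w (real (card X)) (real (card Y)) bs"
  using assms
proof (induction bs arbitrary: X Y)
  case Nil
  then show ?case by (simp add: count_term_def ffact_def)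
next
  case (Cons b bs)
  let ?F = "{S \<in> disjoint_families n s ws. \<Union>S \<subseteq> X \<union> Y \<and> card (\<Union>S \<inter> X) = b}"
  let ?M = "shf_M w s ws"
  let ?x = "real (card X) - real b" and ?y = "real (card Y) - real (w - b)"
  have finF: "finite ?F" using finite_disjoint_families by simp
  have b: "b \<le> w" using Cons.prems by simp
  have each: "real (card (family_lists (X - \<Union>S) (Y - \<Union>S) bs)) \<le> ?M ^ length bs * count_term w ?x ?y bs"
    and ct: "0 \<le> count_term w ?x ?y bs" if S: "S \<in> ?F" for S
  proof -
    have U: "card (\<Union>S) = w" "finite (\<Union>S)"
      using S card_Union_family[of S n s ws] ws_sum Cons.prems by (auto intro: finite_subset)
    have "card (\<Union>S \<inter> Y) = w - b"
    proof -
      have "\<Union>S = (\<Union>S \<inter> X) \<union> (\<Union>S \<inter> Y)" using S by auto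
      then have "card (\<Union>S) = card (\<Union>S \<inter> X) + card (\<Union>S \<inter> Y)"
        using card_Un_disjoint[of "\<Union>S \<inter> X" "\<Union>S \<inter> Y"] U(2) Cons.prems(3) by auto
      then show ?thesis using U S by simp
    qed
    moreover have "card (\<Union>S \<inter> X) = b" using S by simp
    moreover have "card (\<Union>S \<inter> X) \<le> card X" "card (\<Union>S \<inter> Y) \<le> card Y"
      using Cons.prems by (auto intro: card_mono)
    moreover have "card (X - \<Union>S) = card X - card (\<Union>S \<inter> X)" "card (Y - \<Union>S) = card Y - card (\<Union>S \<inter> Y)"
      using Cons.prems by (simp_all add: card_Diff_subset_Int Int_commute)
    ultimately have xy: "real (card (X - \<Union>S)) = ?x" "real (card (Y - \<Union>S)) = ?y" by auto
    show "real (card (family_lists (X - \<Union>S) (Y - \<Union>S) bs)) \<le> ?M ^ length bs * count_term w ?x ?y bs"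
      using Cons.IH[of "X - \<Union>S" "Y - \<Union>S"] Cons.prems unfolding xy by auto
    show "0 \<le> count_term w ?x ?y bs"
      using count_term_nonneg[of w "card (X - \<Union>S)" "card (Y - \<Union>S)" bs] unfolding xy .
  qed
  have "inj_on (\<lambda>(S, Ss). S # Ss) A" for A :: "(family \<times> family list) set"
    by (auto simp: inj_on_def)
  then have "card (family_lists X Y (b # bs)) =
      card (Sigma ?F (\<lambda>S. family_lists (X - \<Union>S) (Y - \<Union>S) bs))"
    unfolding family_lists.simps by (rule card_image)
  also have "\<dots> = (\<Sum>S\<in>?F. card (family_lists (X - \<Union>S) (Y - \<Union>S) bs))"
    by (rule card_SigmaI[OF finF]) (simp add: finite_family_lists)
  finally have "real (card (family_lists X Y (b # bs))) =
      (\<Sum>S\<in>?F. real (card (family_lists (X - \<Union>S) (Y - \<Union>S) bs)))" by simp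
  also have "\<dots> \<le> (\<Sum>S\<in>?F. ?M ^ length bs * count_term w ?x ?y bs)"
    by (rule sum_mono) (rule each)
  also have "\<dots> = real (card ?F) * (?M ^ length bs * count_term w ?x ?y bs)" by simp
  also have "\<dots> \<le> (real (card X choose b) * real (card Y choose (w - b)) * ?M) *
      (?M ^ length bs * count_term w ?x ?y bs)"
  proof (cases "?F = {}")
    case False
    then show ?thesis
      using card_families_blocks_le[OF Cons.prems(1,2) b] ct shf_M_pos[of w s ws]
      by (intro mult_right_mono mult_nonneg_nonneg) auto
  next
    case True
    \<comment> \<open>With no family to choose, the bound must still be nonnegative although
      \<open>?x\<close> or \<open>?y\<close> may be negative. In that case a binomial coefficient
      vanishes; otherwise \<open>count_term\<close> has natural arguments.\<close>
    have "card X < b \<or> card Y < w - b \<or> 0 \<le> count_term w ?x ?y bs"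
    proof (cases "b \<le> card X \<and> w - b \<le> card Y")
      case True
      then show ?thesis
        using count_term_nonneg[of w "card X - b" "card Y - (w - b)" bs] by (simp add: of_nat_diff)
    qed auto
    then have "0 \<le> (real (card X choose b) * real (card Y choose (w - b)) * ?M) *
      (?M ^ length bs * count_term w ?x ?y bs)"
      using shf_M_pos[of w s ws] by (auto simp: binomial_eq_0)
    then show ?thesis unfolding True by simp
  qed
  also have "\<dots> = ?M ^ length (b # bs) * count_term w (real (card X)) (real (card Y)) (b # bs)"
    by (simp add: count_term_def ffact_add binomial_eq_ffact mult_ac)
  finally show ?case .
qed

lemma in_family_lists:
  assumes "\<forall>S\<in>set Ss. S \<in> disjoint_families n s ws \<and> \<Union>S \<subseteq> X \<union> Y"
    "sorted_wrt (\<lambda>S S'. \<Union>S \<inter> \<Union>S' = {}) Ss"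
  shows "Ss \<in> family_lists X Y (map (\<lambda>S. card (\<Union>S \<inter> X)) Ss)"
  using assms
proof (induction Ss arbitrary: X Y)
  case (Cons S Ss)
  have disj: "\<Union>S \<inter> \<Union>S' = {}" if "S' \<in> set Ss" for S' using Cons.prems(2) that by simp
  have "Ss \<in> family_lists (X - \<Union>S) (Y - \<Union>S) (map (\<lambda>S'. card (\<Union>S' \<inter> (X - \<Union>S))) Ss)"
  proof (rule Cons.IH)
    show "\<forall>S'\<in>set Ss. S' \<in> disjoint_families n s ws \<and> \<Union>S' \<subseteq> (X - \<Union>S) \<union> (Y - \<Union>S)"
    proof
      fix S' assume S': "S' \<in> set Ss"
      then have "S' \<in> disjoint_families n s ws" "\<Union>S' \<subseteq> X \<union> Y" using Cons.prems(1) by auto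
      then show "S' \<in> disjoint_families n s ws \<and> \<Union>S' \<subseteq> (X - \<Union>S) \<union> (Y - \<Union>S)"
        using disj[OF S'] by (intro conjI) (assumption, blast)
    qed
    show "sorted_wrt (\<lambda>S S'. \<Union>S \<inter> \<Union>S' = {}) Ss" using Cons.prems(2) by simp
  qed
  moreover have "map (\<lambda>S'. card (\<Union>S' \<inter> (X - \<Union>S))) Ss = map (\<lambda>S'. card (\<Union>S' \<inter> X)) Ss"
  proof (rule map_cong[OF refl])
    fix S' assume "S' \<in> set Ss"
    then have "\<Union>S' \<inter> (X - \<Union>S) = \<Union>S' \<inter> X" using disj by blast
    then show "card (\<Union>S' \<inter> (X - \<Union>S)) = card (\<Union>S' \<inter> X)" by simp
  qed
  ultimately show ?case using Cons.prems(1) by (auto intro!: image_eqI[where x = "(S, Ss)"])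
qed simp

lemma cells_disjoint_iff: "family_cells N S \<inter> family_cells N S' = {} \<longleftrightarrow> \<Union>S \<inter> \<Union>S' = {}"
proof -
  have "family_cells N S \<inter> family_cells N S' = {1..N} \<times> (\<Union>S \<inter> \<Union>S')"
    unfolding family_cells_def by blast
  then show ?thesis using N_pos by (simp add: Sigma_empty_iff Suc_le_eq del: Int_Union2)
qed

lemma touch_iff: "touch S {S'} \<longleftrightarrow> \<Union>S \<inter> \<Union>S' \<noteq> {}"
  by (simp add: touch_def cells_disjoint_iff)

lemma indep_touching_disjoint:
  assumes "I \<in> indep_touching {S0}"
  shows "S \<in> I \<Longrightarrow> S \<in> disjoint_families n s ws" "S \<in> I \<Longrightarrow> \<Union>S \<inter> \<Union>S0 \<noteq> {}"
    "S \<in> I \<Longrightarrow> S' \<in> I \<Longrightarrow> S \<noteq> S' \<Longrightarrow> \<Union>S \<inter> \<Union>S' = {}"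
  using assms unfolding indep_touching_def indep_def pairwise_def touch_iff cells_disjoint_iff by auto

lemma finite_family_Union: "S \<in> disjoint_families n s ws \<Longrightarrow> finite (\<Union>S)"
  by (rule finite_subset[OF Union_disjoint_families finite_atLeastAtMost])

text \<open>The members are disjoint, each takes at least one of the \<open>w\<close> columns of
  \<open>S0\<close> and exactly \<open>w\<close> of all \<open>n\<close> columns. This is the reason
  for the range of \<open>k\<close> in \<open>shf_phi\<close>.\<close>

lemma indep_touching_card_le:
  assumes S0: "S0 \<in> disjoint_families n s ws" and I: "I \<in> indep_touching {S0}"
  shows "finite I" "(\<Sum>S\<in>I. card (\<Union>S \<inter> \<Union>S0)) \<le> w" "card I \<le> w" "w * card I \<le> n"
proof -
  note D = indep_touching_disjoint[OF I]
  show fin: "finite I" by (rule finite_subset[OF _ finite_disjoint_families]) (rule subsetI, rule D(1))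
  have "(\<Sum>S\<in>I. card (\<Union>S \<inter> \<Union>S0)) = card (\<Union>S\<in>I. \<Union>S \<inter> \<Union>S0)"
    using D fin finite_family_Union
    by (intro card_UN_disjoint[symmetric]) (auto simp: disjoint_iff)
  also have "\<dots> \<le> card (\<Union>S0)" using finite_family_Union[OF S0] by (intro card_mono) auto
  also have "\<dots> = w" using card_Union_family[OF S0] ws_sum by simp
  finally show le: "(\<Sum>S\<in>I. card (\<Union>S \<inter> \<Union>S0)) \<le> w" .
  have "card I = (\<Sum>S\<in>I. 1)" by simp
  also have "\<dots> \<le> (\<Sum>S\<in>I. card (\<Union>S \<inter> \<Union>S0))"
  proof (rule sum_mono)
    fix S assume "S \<in> I"
    then have "card (\<Union>S \<inter> \<Union>S0) > 0"
      using D(1,2) finite_family_Union by (simp add: card_gt_0_iff)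
    then show "1 \<le> card (\<Union>S \<inter> \<Union>S0)" by simp
  qed
  finally show "card I \<le> w" using le by simp
  have "card (\<Union>S) = w" if "S \<in> I" for S
    using card_Union_family[OF D(1)[OF that]] ws_sum by simp
  then have "w * card I = (\<Sum>S\<in>I. card (\<Union>S))" by simp
  also have "\<dots> = card (\<Union>S\<in>I. \<Union>S)"
    using D fin finite_family_Union by (intro card_UN_disjoint[symmetric]) auto
  also have "\<dots> \<le> card {1..n}"
    by (intro card_mono finite_atLeastAtMost UN_least Union_disjoint_families[OF D(1)])
  finally show "w * card I \<le> n" by simp
qed

text \<open>Each independent set is listed in all \<open>fact k\<close> orders, and the lists are
  sorted by how many columns of \<open>S0\<close> each member takes. The \<open>w\<close> columns of
  \<open>S0\<close> bound the sum of these numbers, hence \<open>j \<le> w - k\<close>.\<close>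

lemma card_indep_touching_le:
  assumes S0: "S0 \<in> disjoint_families n s ws" and k: "1 \<le> k" "k \<le> w" and n: "w < n"
  shows "real (card {I \<in> indep_touching {S0}. card I = k}) \<le>
    real (w choose k) * shf_Gamma w n k * (shf_M w s ws * block_scale w n) ^ k"
proof -
  define X where "X = \<Union>S0"
  define Y where "Y = {1..n} - X"
  have X: "X \<subseteq> {1..n}" "card X = w"
    using Union_disjoint_families[OF S0] card_Union_family[OF S0] ws_sum by (auto simp: X_def)
  have fin: "finite X" "finite Y" "X \<inter> Y = {}" "X \<union> Y = {1..n}" and Y: "card Y = n - w"
    using X by (auto simp: Y_def finite_subset card_Diff_subset)
  let ?Is = "{I \<in> indep_touching {S0}. card I = k}"
  let ?L = "\<Union>(j, i)\<in>Sigma {0..w-k} (weak_compositions k). family_lists X Y (composition_blocks k i)"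
  have finS: "finite (Sigma {0..w-k} (weak_compositions k))"
    by (simp add: finite_weak_compositions)
  have sub: "(\<Union>I\<in>?Is. permutations_of_set I) \<subseteq> ?L"
  proof
    fix Ss assume "Ss \<in> (\<Union>I\<in>?Is. permutations_of_set I)"
    then obtain I where I: "I \<in> indep_touching {S0}" "card I = k" and Ss: "set Ss = I" "distinct Ss"
      by (auto simp: permutations_of_set_def)
    note D = indep_touching_disjoint[OF I(1)]
    have len: "length Ss = k" using Ss I(2) distinct_card by metis
    define bs where "bs = map (\<lambda>S. card (\<Union>S \<inter> X)) Ss"
    have "Ss \<in> family_lists X Y bs"
      unfolding bs_def
    proof (rule in_family_lists)
      show "\<forall>S\<in>set Ss. S \<in> disjoint_families n s ws \<and> \<Union>S \<subseteq> X \<union> Y"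
        unfolding Ss(1) fin(4) by (intro ballI conjI D(1) Union_disjoint_families[OF D(1)])
      show "sorted_wrt (\<lambda>S S'. \<Union>S \<inter> \<Union>S' = {}) Ss"
        unfolding sorted_wrt_iff_nth_less
      proof (intro allI impI)
        fix a b assume ab: "a < b" "b < length Ss"
        then have "Ss ! a \<noteq> Ss ! b" using Ss(2) by (simp add: nth_eq_iff_index_eq)
        moreover have "Ss ! a \<in> I" "Ss ! b \<in> I" using ab Ss(1) by auto
        ultimately show "\<Union>(Ss ! a) \<inter> \<Union>(Ss ! b) = {}" by (intro D(3))
      qed
    qed
    have pos: "bs ! l \<ge> 1" if "l < k" for l
    proof -
      have "Ss ! l \<in> I" using that len Ss(1) by auto
      then have "\<Union>(Ss ! l) \<inter> X \<noteq> {}" using D(2) by (simp add: X_def)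
      then have "card (\<Union>(Ss ! l) \<inter> X) > 0" using fin(1) by (simp add: card_gt_0_iff)
      then show ?thesis using that len by (simp add: bs_def)
    qed
    \<comment> \<open>Two shifts by one: list positions start at 0 and composition indices at 1, and
      block sizes exceed the parts of the composition by 1.\<close>
    define i where "i = restrict (\<lambda>l. bs ! (l - 1) - 1) {1..k}"
    define j where "j = (\<Sum>l=1..k. i l)"
    have blocks: "composition_blocks k i = bs"
    proof (rule nth_equalityI)
      show "length (composition_blocks k i) = length bs"
        by (simp add: composition_blocks_def bs_def len del: upt_Suc)
      fix l assume "l < length (composition_blocks k i)"
      then have l: "l < k" by (simp add: composition_blocks_def del: upt_Suc)
      then have "composition_blocks k i ! l = i (1 + l) + 1"
        unfolding composition_blocks_def by (subst nth_map) (simp_all add: nth_upt del: upt_Suc)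
      also have "\<dots> = bs ! l" using l pos[OF l] by (simp add: i_def)
      finally show "composition_blocks k i ! l = bs ! l" .
    qed
    have "sum_list bs = (\<Sum>S\<in>I. card (\<Union>S \<inter> X))"
      unfolding bs_def Ss(1)[symmetric] using Ss(2) by (simp add: sum.distinct_set_conv_list)
    then have "sum_list bs \<le> w" using indep_touching_card_le(2)[OF S0 I(1)] by (simp add: X_def)
    moreover have "sum_list bs = j + k"
    proof -
      have "(\<Sum>l=1..k. i l + 1) = j + k" unfolding sum.distrib j_def by simp
      then show ?thesis using composition_blocks_conv(1)[of "\<lambda>b. b" k i] by (simp add: blocks)
    qed
    ultimately have "j \<in> {0..w-k}" by simp
    moreover have "i \<in> weak_compositions k j"
    proof -
      have "i l \<le> j" if "l \<in> {1..k}" for l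
        unfolding j_def by (rule member_le_sum) (use that in auto)
      moreover have "i \<in> extensional {1..k}" by (simp add: i_def)
      ultimately show ?thesis unfolding weak_compositions_def by (auto simp: PiE_iff j_def)
    qed
    ultimately show "Ss \<in> ?L"
      using \<open>Ss \<in> family_lists X Y bs\<close> blocks by (intro UN_I[of "(j, i)"]) auto
  qed
  have finI: "finite ?Is" by (simp add: finite_indep_touching)
  have "fact k * card ?Is = (\<Sum>I\<in>?Is. card (permutations_of_set I))"
  proof -
    have "card (permutations_of_set I) = fact k" if "I \<in> ?Is" for I
      using that indep_touching_card_le(1)[OF S0] by auto
    then show ?thesis by simp
  qed
  also have "\<dots> = card (\<Union>I\<in>?Is. permutations_of_set I)"
  proof (rule card_UN_disjoint[symmetric, OF finI])
    show "\<forall>I\<in>?Is. finite (permutations_of_set I)" by simp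
    show "\<forall>I\<in>?Is. \<forall>I'\<in>?Is. I \<noteq> I' \<longrightarrow> permutations_of_set I \<inter> permutations_of_set I' = {}"
      by (auto simp: permutations_of_set_def)
  qed
  also have "\<dots> \<le> card ?L"
    by (rule card_mono[OF _ sub]) (use finS finite_family_lists in auto)
  also have "\<dots> \<le> (\<Sum>(j, i)\<in>Sigma {0..w-k} (weak_compositions k).
      card (family_lists X Y (composition_blocks k i)))"
    using card_UN_le[OF finS, of "\<lambda>(j, i). family_lists X Y (composition_blocks k i)"]
    by (simp add: case_prod_beta)
  also have "\<dots> = (\<Sum>j=0..w-k. \<Sum>i\<in>weak_compositions k j. card (family_lists X Y (composition_blocks k i)))"
    by (rule sum.Sigma[symmetric]) (auto simp: finite_weak_compositions)
  finally have "real (fact k * card ?Is) \<le>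
      real (\<Sum>j=0..w-k. \<Sum>i\<in>weak_compositions k j. card (family_lists X Y (composition_blocks k i)))"
    by (rule of_nat_mono)
  then have "fact k * real (card ?Is) \<le>
      (\<Sum>j=0..w-k. \<Sum>i\<in>weak_compositions k j. real (card (family_lists X Y (composition_blocks k i))))"
    by simp
  also have "\<dots> \<le> (\<Sum>j=0..w-k. \<Sum>i\<in>weak_compositions k j.
      fact k * (real (w choose k) * (shf_M w s ws * block_scale w n) ^ k) * gamma_summand w n k j i)"
  proof (intro sum_mono)
    fix j i assume j: "j \<in> {0..w-k}" and i: "i \<in> weak_compositions k j"
    have le: "\<forall>b\<in>set (composition_blocks k i). b \<le> w"
    proof
      fix b assume "b \<in> set (composition_blocks k i)"
      then have "b \<in> (\<lambda>l. i l + 1) ` {1..k}"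
        by (simp add: composition_blocks_def atLeastLessThanSuc_atLeastAtMost del: upt_Suc)
      then obtain l where l: "l \<in> {1..k}" "b = i l + 1" by blast
      have "i l \<le> j" using i l(1) by (auto simp: weak_compositions_def PiE_iff)
      then show "b \<le> w" using l j k by auto
    qed
    have "real (card (family_lists X Y (composition_blocks k i))) \<le>
        shf_M w s ws ^ length (composition_blocks k i) *
          count_term w (real (card X)) (real (card Y)) (composition_blocks k i)"
      by (rule card_family_lists_le[OF fin(1-3) le])
    also have "length (composition_blocks k i) = k" by (simp add: composition_blocks_def del: upt_Suc)
    also have "count_term w (real (card X)) (real (card Y)) (composition_blocks k i) =
        fact k * (real (w choose k) * block_scale w n ^ k * gamma_summand w n k j i)"
      using count_term_composition[OF k n _ i] j X(2) Y n by (simp add: of_nat_diff)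
    finally show "real (card (family_lists X Y (composition_blocks k i))) \<le>
        fact k * (real (w choose k) * (shf_M w s ws * block_scale w n) ^ k) * gamma_summand w n k j i"
      by (simp add: power_mult_distrib mult_ac)
  qed
  also have "\<dots> = fact k * (real (w choose k) * shf_Gamma w n k * (shf_M w s ws * block_scale w n) ^ k)"
    unfolding shf_Gamma_eq sum_distrib_left[symmetric] by (simp add: mult_ac)
  finally show ?thesis by simp
qed

text \<open>Grouped by cardinality, the scale in the weight of a family cancels the factor
  \<open>(shf_M w s ws * block_scale w n) ^ k\<close> of the count.\<close>

lemma sum_indep_touching_le:
  assumes S0: "S0 \<in> disjoint_families n s ws" and n: "w < n" and x: "x \<ge> 0"
  shows "(\<Sum>I\<in>indep_touching {S0}. \<Prod>S\<in>I. x / (shf_M w s ws * block_scale w n)) \<le> shf_phi w n x"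
proof -
  define c where "c = shf_M w s ws * block_scale w n"
  have c: "c > 0" using shf_M_pos n by (simp add: c_def block_scale_def)
  define K where "K = min (n div w) w"
  have w: "0 < w" using ws_sum ws_pos[of 1] s_ge member_le_sum[of 1 "{1..s}" ws] by auto
  have card_le: "card I \<le> K" if "I \<in> indep_touching {S0}" for I
    using indep_touching_card_le(3,4)[OF S0 that] w by (auto simp: K_def less_eq_div_iff_mult_less_eq mult.commute)
  have "(\<Sum>I\<in>indep_touching {S0}. \<Prod>S\<in>I. x / c) =
      (\<Sum>k\<in>{0..K}. \<Sum>I\<in>{I \<in> indep_touching {S0}. card I = k}. (x / c) ^ card I)"
    by (subst sum.group) (use card_le in \<open>auto simp: finite_indep_touching\<close>)
  also have "\<dots> = (\<Sum>k\<in>{0..K}. real (card {I \<in> indep_touching {S0}. card I = k}) * (x / c) ^ k)"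
    by (intro sum.cong refl) simp
  also have "\<dots> = real (card {I \<in> indep_touching {S0}. card I = 0}) +
      (\<Sum>k=1..K. real (card {I \<in> indep_touching {S0}. card I = k}) * (x / c) ^ k)"
    by (simp add: sum.atLeast_Suc_atMost)
  also have "{I \<in> indep_touching {S0}. card I = 0} = {{}}"
    using indep_touching_card_le(1)[OF S0] by (auto simp: indep_touching_def indep_def)
  also have "real (card {{} :: family set}) +
      (\<Sum>k=1..K. real (card {I \<in> indep_touching {S0}. card I = k}) * (x / c) ^ k) \<le>
      1 + (\<Sum>k=1..K. real (w choose k) * shf_Gamma w n k * c ^ k * (x / c) ^ k)"
  proof -
    have "(\<Sum>k=1..K. real (card {I \<in> indep_touching {S0}. card I = k}) * (x / c) ^ k) \<le>
      (\<Sum>k=1..K. real (w choose k) * shf_Gamma w n k * c ^ k * (x / c) ^ k)"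
      using x c unfolding c_def[symmetric]
      by (intro sum_mono mult_right_mono card_indep_touching_le[OF S0 _ _ n, folded c_def]) (auto simp: K_def)
    then show ?thesis by simp
  qed
  also have "\<dots> = shf_phi w n x"
    unfolding shf_phi_def K_def using c by (simp add: power_divide mult.assoc)
  finally show ?thesis by (simp add: c_def)
qed

lemma card_disjoint_families_le:
  assumes "w \<le> n"
  shows "real (card (disjoint_families n s ws)) \<le> real (n choose w) * shf_M w s ws"
proof -
  \<comment> \<open>With empty \<open>X\<close> and \<open>b = 0\<close> the count by blocks becomes
    the count of all families.\<close>
  have eq: "{S \<in> disjoint_families n s ws. \<Union>S \<subseteq> {} \<union> {1..n} \<and> card (\<Union>S \<inter> {}) = 0} = disjoint_families n s ws"
    by (rule set_eqI) (simp add: Union_disjoint_families del: One_nat_def cong: conj_cong)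
  show ?thesis using card_families_blocks_le[of "{}" "{1..n}" 0] unfolding eq by simp
qed

end

section \<open>The probability of a bad event\<close>

text \<open>Every \<open>f\<close> with \<open>P f\<close> is transported along \<open>h\<close> and
  extended by arbitrary values outside the image. Applied with \<open>V\<close> the vertices of the
  multipartite graph and \<open>h\<close> placing them in one row of the matrix.\<close>

lemma card_PiE_comp_ge:
  fixes B :: "'b set" and h :: "'c \<Rightarrow> 'a"
  assumes D: "finite D" and B: "finite B" and h: "inj_on h V" "h ` V \<subseteq> D"
  shows "card {f \<in> V \<rightarrow>\<^sub>E B. P f} * card B ^ (card D - card V) \<le>
    card {A \<in> D \<rightarrow>\<^sub>E B. P (restrict (\<lambda>v. A (h v)) V)}"
proof -
  have finV: "finite V" using h D by (meson finite_image_iff finite_subset)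
  define g :: "('c \<Rightarrow> 'b) \<times> ('a \<Rightarrow> 'b) \<Rightarrow> 'a \<Rightarrow> 'b"
    where "g = (\<lambda>(f, f') d. if d \<in> h ` V then f (inv_into V h d) else f' d)"
  have gh: "g (f, f') (h v) = f v" if "v \<in> V" for f f' v
    using that h(1) by (simp add: g_def inv_into_f_f)
  let ?L = "{f \<in> V \<rightarrow>\<^sub>E B. P f} \<times> ((D - h ` V) \<rightarrow>\<^sub>E B)"
  have "inj_on g ?L"
  proof (rule inj_onI, clarify)
    fix f f' k k' assume f: "f \<in> V \<rightarrow>\<^sub>E B" "k \<in> V \<rightarrow>\<^sub>E B"
      and f': "f' \<in> (D - h ` V) \<rightarrow>\<^sub>E B" "k' \<in> (D - h ` V) \<rightarrow>\<^sub>E B" and eq: "g (f, f') = g (k, k')"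
    have "f = k"
      by (rule PiE_ext[OF f]) (use gh eq in metis)
    moreover have "f' = k'"
    proof (rule PiE_ext[OF f'])
      fix d assume "d \<in> D - h ` V"
      then show "f' d = k' d" using fun_cong[OF eq, of d] by (simp add: g_def)
    qed
    ultimately show "f = k \<and> f' = k'" by simp
  qed
  moreover have "g ` ?L \<subseteq> {A \<in> D \<rightarrow>\<^sub>E B. P (restrict (\<lambda>v. A (h v)) V)}"
  proof (rule image_subsetI, clarify)
    fix f f' assume f: "f \<in> V \<rightarrow>\<^sub>E B" "P f" and f': "f' \<in> (D - h ` V) \<rightarrow>\<^sub>E B"
    have "restrict (\<lambda>v. g (f, f') (h v)) V = f"
      using f(1) gh by (intro PiE_ext[of _ V "\<lambda>_. B"]) (auto simp: PiE_iff)
    moreover have "g (f, f') \<in> D \<rightarrow>\<^sub>E B"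
    proof (rule PiE_I)
      fix d assume d: "d \<in> D"
      show "g (f, f') d \<in> B"
      proof (cases "d \<in> h ` V")
        case True
        then obtain v where "v \<in> V" "d = h v" by blast
        then show ?thesis using gh f(1) by auto
      next
        case False
        then show ?thesis using d f' by (auto simp: g_def PiE_iff)
      qed
    next
      fix d assume "d \<notin> D"
      then show "g (f, f') d = undefined" using h(2) f' by (auto simp: g_def PiE_iff extensional_def)
    qed
    ultimately show "g (f, f') \<in> D \<rightarrow>\<^sub>E B \<and> P (restrict (\<lambda>v. g (f, f') (h v)) V)"
      using f(2) by simp
  qed
  ultimately have "card ?L \<le> card {A \<in> D \<rightarrow>\<^sub>E B. P (restrict (\<lambda>v. A (h v)) V)}"
    by (rule card_inj_on_le) (simp add: D B finite_PiE)
  moreover have "card (D - h ` V) = card D - card V"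
    using h D finV by (simp add: card_Diff_subset card_image)
  ultimately show ?thesis using D by (simp add: card_cartesian_product card_PiE)
qed

lemma finite_multipartite_vertices: "finite (multipartite_vertices s ws)"
  unfolding multipartite_vertices_def by simp

lemma multipartite_edges_subset: "\<Union>(multipartite_edges s ws) \<subseteq> multipartite_vertices s ws"
  unfolding multipartite_edges_def by auto

lemma card_multipartite_vertices: "card (multipartite_vertices s ws) = (\<Sum>i=1..s. ws i)"
  unfolding multipartite_vertices_def by (subst card_SigmaI) auto

context shf
begin

abbreviation num_colourings :: nat where
  "num_colourings \<equiv> card (proper_colourings (multipartite_vertices s ws) (multipartite_edges s ws) m)"

lemma card_vertices: "card (multipartite_vertices s ws) = w"
  unfolding card_multipartite_vertices by (rule ws_sum)

lemma shf_q_eq: "shf_q w m s ws = 1 - real num_colourings / real m ^ w"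
  unfolding shf_q_def
  by (subst poly_chromatic_polynomial[OF finite_multipartite_vertices multipartite_edges_subset]) simp

text \<open>The constant colouring is improper, as there are at least two nonempty parts.\<close>

lemma shf_q_pos: "shf_q w m s ws > 0"
proof -
  let ?V = "multipartite_vertices s ws"
  let ?f = "restrict (\<lambda>_. 1) ?V :: nat \<times> nat \<Rightarrow> nat"
  have V: "(1, 1) \<in> ?V" "(2, 1) \<in> ?V"
    using s_ge ws_pos[of 1] ws_pos[of 2] by (auto simp: multipartite_vertices_def Suc_le_eq)
  then have "{(1, 1), (2, 1)} \<in> multipartite_edges s ws"
    unfolding multipartite_edges_def
    by (intro CollectI exI[of _ "(1, 1)"] exI[of _ "(2, 1)"]) simp
  then have "?f \<notin> proper_colourings ?V (multipartite_edges s ws) m"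
    using V unfolding proper_colourings_def by force
  moreover have "?f \<in> ?V \<rightarrow>\<^sub>E {1..m}" using m_pos by auto
  ultimately have "proper_colourings ?V (multipartite_edges s ws) m \<noteq> (?V \<rightarrow>\<^sub>E {1..m})"
    by (elim contrapos_nn) (simp only:)
  moreover have "proper_colourings ?V (multipartite_edges s ws) m \<subseteq> (?V \<rightarrow>\<^sub>E {1..m})"
    unfolding proper_colourings_def by (rule Collect_restrict)
  ultimately have "proper_colourings ?V (multipartite_edges s ws) m \<subset> (?V \<rightarrow>\<^sub>E {1..m})"
    by (intro psubsetI)
  then have "num_colourings < card (?V \<rightarrow>\<^sub>E {1..m})"
    by (intro psubset_card_mono) (auto simp: finite_PiE finite_multipartite_vertices)
  also have "\<dots> = m ^ w"
    by (simp add: card_PiE finite_multipartite_vertices card_vertices)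
  finally have "real num_colourings < real m ^ w" by (metis of_nat_less_iff of_nat_power)
  then show ?thesis using m_pos by (simp add: shf_q_eq)
qed

text \<open>Matching part \<open>r\<close> of the graph with block \<open>W r\<close> turns a row
  into a vertex colouring, and a proper colouring separates the blocks.\<close>

lemma avg_row_separates_ge:
  assumes S: "S \<in> disjoint_families n s ws" and i: "i \<in> {1..N}"
  shows "avg (\<lambda>A. of_bool (row_separates A i S)) \<ge> real num_colourings / real m ^ w"
proof -
  let ?V = "multipartite_vertices s ws" and ?E = "multipartite_edges s ws"
  from S obtain W where W: "S = W ` {1..s}" "\<forall>i\<in>{1..s}. W i \<subseteq> {1..n}"
    "\<forall>i\<in>{1..s}. card (W i) = ws i" "disjoint_family_on W {1..s}"
    by (rule disjoint_familiesE)
  have "\<exists>g. bij_betw g {1..ws r} (W r)" if "r \<in> {1..s}" for r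
  proof -
    have "W r \<subseteq> {1..n}" "card (W r) = ws r" using W(2,3) that by blast+
    then have "finite (W r)" "card (W r) = ws r" by (auto intro: finite_subset)
    then show ?thesis using ex_bij_betw_nat_finite_1 by metis
  qed
  then obtain g where g: "\<And>r. r \<in> {1..s} \<Longrightarrow> bij_betw (g r) {1..ws r} (W r)" by metis
  define h where "h = (\<lambda>(r, t). (i, g r t))"
  have gW: "g r t \<in> W r" if "(r, t) \<in> ?V" for r t
    using bij_betwE[OF g[of r]] that by (auto simp: multipartite_vertices_def)
  have inj: "inj_on h ?V"
  proof (rule inj_onI, clarify)
    fix r t r' t' assume rt: "(r, t) \<in> ?V" "(r', t') \<in> ?V" and eq: "h (r, t) = h (r', t')"
    have geq: "g r t = g r' t'" using eq by (simp add: h_def)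
    have r: "r \<in> {1..s}" "r' \<in> {1..s}" using rt by (auto simp: multipartite_vertices_def)
    have "r = r'"
    proof (rule ccontr)
      assume "r \<noteq> r'"
      then have "W r \<inter> W r' = {}" by (rule disjoint_family_onD[OF W(4) r])
      then show False using gW[OF rt(1)] gW[OF rt(2)] geq by auto
    qed
    moreover have "t = t'"
      using inj_onD[OF bij_betw_imp_inj_on[OF g[OF r(1)]], of t t'] geq rt \<open>r = r'\<close>
      by (auto simp: multipartite_vertices_def)
    ultimately show "r = r' \<and> t = t'" by simp
  qed
  have im: "h ` ?V \<subseteq> grid N n"
  proof (rule image_subsetI, clarify)
    fix r t assume rt: "(r, t) \<in> ?V"
    then have "r \<in> {1..s}" by (auto simp: multipartite_vertices_def)
    then have "g r t \<in> {1..n}" using W(2) gW[OF rt] by blast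
    then show "h (r, t) \<in> grid N n" using i by (simp add: h_def grid_def)
  qed
  let ?P = "\<lambda>f. \<forall>u v. {u, v} \<in> ?E \<longrightarrow> f u \<noteq> f v"
  have sep: "row_separates A i S" if P: "?P (restrict (\<lambda>v. A (h v)) ?V)" for A :: matrix
    unfolding row_separates_def
  proof (intro ballI impI)
    fix U U' c c' assume U: "U \<in> S" "U' \<in> S" "U \<noteq> U'" and c: "c \<in> U" "c' \<in> U'"
    obtain r r' where r: "r \<in> {1..s}" "U = W r" "r' \<in> {1..s}" "U' = W r'"
      using U W(1) by (metis imageE)
    obtain t t' where t: "t \<in> {1..ws r}" "c = g r t" "t' \<in> {1..ws r'}" "c' = g r' t'"
      using c r bij_betw_imp_surj_on[OF g[OF r(1)]] bij_betw_imp_surj_on[OF g[OF r(3)]]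
      by (metis imageE)
    have V: "(r, t) \<in> ?V" "(r', t') \<in> ?V" using r t by (auto simp: multipartite_vertices_def)
    moreover have "r \<noteq> r'" using r U(3) by auto
    ultimately have "{(r, t), (r', t')} \<in> ?E"
      unfolding multipartite_edges_def by (intro CollectI exI[of _ "(r, t)"] exI[of _ "(r', t')"]) simp
    then have "restrict (\<lambda>v. A (h v)) ?V (r, t) \<noteq> restrict (\<lambda>v. A (h v)) ?V (r', t')"
      using P by blast
    then show "A (i, c) \<noteq> A (i, c')" using V t by (simp add: h_def)
  qed
  \<comment> \<open>The \<open>w\<close> vertices occupy distinct cells, so the exponent
    \<open>N * n - w\<close> is not truncated.\<close>
  have w_le: "w \<le> N * n"
  proof -
    have "card (h ` ?V) \<le> card (grid N n)" using im by (intro card_mono) (simp_all add: grid_def)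
    then show ?thesis
      using card_image[OF inj] by (simp add: card_vertices grid_def)
  qed
  have "num_colourings * m ^ (N * n - w) \<le>
      card {A \<in> grid N n \<rightarrow>\<^sub>E {1..m}. ?P (restrict (\<lambda>v. A (h v)) ?V)}"
    using card_PiE_comp_ge[OF _ _ inj im, of "{1..m}" ?P]
    by (simp add: proper_colourings_def card_vertices grid_def)
  also have "\<dots> \<le> card {A \<in> states. row_separates A i S}"
  proof (rule card_mono)
    have "states = (grid N n \<rightarrow>\<^sub>E {1..m})" by (subst states_def) (simp only: colours_def)
    then show "{A \<in> grid N n \<rightarrow>\<^sub>E {1..m}. ?P (restrict (\<lambda>v. A (h v)) ?V)} \<subseteq> {A \<in> states. row_separates A i S}"
      by (intro Collect_mono impI, elim conjE, intro conjI sep) (simp only:)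
  qed (simp add: finite_states)
  finally have "real (num_colourings * m ^ (N * n - w)) \<le> real (card {A \<in> states. row_separates A i S})"
    by (rule of_nat_mono)
  moreover have "card states = m ^ (N * n)"
    unfolding states_def by (simp add: card_PiE grid_def colours_def)
  moreover have "(\<Sum>A\<in>states. of_bool (row_separates A i S)) = real (card {A \<in> states. row_separates A i S})"
    using finite_states by (simp add: of_bool_def sum.If_cases Int_def)
  ultimately have "avg (\<lambda>A. of_bool (row_separates A i S)) \<ge>
      real (num_colourings * m ^ (N * n - w)) / real (m ^ (N * n))"
    unfolding avg_def by (simp add: divide_right_mono)
  also have "real (num_colourings * m ^ (N * n - w)) / real (m ^ (N * n)) = real num_colourings / real m ^ w"
  proof -
    have "real (m ^ (N * n - w)) = real m ^ (N * n) / real m ^ w"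
      using m_pos w_le power_diff[of "real m" w "N * n"] by simp
    then show ?thesis using m_pos by simp
  qed
  finally show ?thesis .
qed

text \<open>Whether row \<open>i\<close> separates depends on the cells of row \<open>i\<close>
  only, so the rows are independent.\<close>

lemma avg_rows_not_separating:
  assumes "R \<subseteq> {1..N}"
  shows "avg (\<lambda>A. of_bool (\<forall>i\<in>R. \<not> row_separates A i S)) =
    (\<Prod>i\<in>R. avg (\<lambda>A. of_bool (\<not> row_separates A i S)))"
proof -
  have "finite R" using assms finite_subset by blast
  then show ?thesis
  proof (induction R)
    case empty
    then show ?case by (simp add: avg_const)
  next
    case (insert i R)
    have "avg (\<lambda>A. of_bool (\<forall>j\<in>insert i R. \<not> row_separates A j S)) =
        avg (\<lambda>A. of_bool (\<not> row_separates A i S) * of_bool (\<forall>j\<in>R. \<not> row_separates A j S))"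
      by (rule avg_cong) simp
    also have "\<dots> = avg (\<lambda>A. of_bool (\<not> row_separates A i S)) *
        avg (\<lambda>A. of_bool (\<forall>j\<in>R. \<not> row_separates A j S))"
    proof (rule avg_mult_indep[where C = "{i} \<times> UNIV"])
      fix A A' :: matrix assume "\<And>c. c \<in> {i} \<times> UNIV \<Longrightarrow> A c = A' c"
      then have "row_separates A i S = row_separates A' i S" by (intro row_separates_cong) simp
      then show "of_bool (\<not> row_separates A i S) = (of_bool (\<not> row_separates A' i S) :: real)" by simp
    next
      fix A A' :: matrix assume eq: "\<And>c. c \<notin> {i} \<times> UNIV \<Longrightarrow> A c = A' c"
      have "row_separates A j S = row_separates A' j S" if "j \<in> R" for j
        using insert.hyps that by (intro row_separates_cong eq) auto
      then show "of_bool (\<forall>j\<in>R. \<not> row_separates A j S) = (of_bool (\<forall>j\<in>R. \<not> row_separates A' j S) :: real)"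
        by simp
    qed
    finally show ?case using insert by simp
  qed
qed

lemma prob_le:
  assumes S: "S \<in> disjoint_families n s ws"
  shows "prob S \<le> shf_q w m s ws ^ N"
proof -
  have row: "avg (\<lambda>A. of_bool (\<not> row_separates A i S)) \<le> shf_q w m s ws" if "i \<in> {1..N}" for i
  proof -
    have "avg (\<lambda>A. of_bool (\<not> row_separates A i S)) + avg (\<lambda>A. of_bool (row_separates A i S)) = avg (\<lambda>_. 1)"
      unfolding avg_def add_divide_distrib[symmetric] sum.distrib[symmetric]
      by (intro arg_cong2[where f = "(/)"] sum.cong refl) simp
    then show ?thesis using avg_row_separates_ge[OF S that] by (simp add: avg_const shf_q_eq)
  qed
  have "prob S = avg (\<lambda>A. of_bool (\<forall>i\<in>{1..N}. \<not> row_separates A i S))"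
    unfolding prob_def bad_event_def by simp
  also have "\<dots> = (\<Prod>i\<in>{1..N}. avg (\<lambda>A. of_bool (\<not> row_separates A i S)))"
    by (rule avg_rows_not_separating) simp
  also have "\<dots> \<le> (\<Prod>i\<in>{1..N}. shf_q w m s ws)"
    by (intro prod_mono conjI row avg_nonneg) auto
  finally show ?thesis by simp
qed

section \<open>The threshold\<close>

lemma deriv_shf_phi:
  "deriv (shf_phi w n) x =
     (\<Sum>k=1..min (n div w) w. real (w choose k) * shf_Gamma w n k * (real k * x ^ (k - 1)))"
proof (rule DERIV_imp_deriv)
  show "(shf_phi w n has_field_derivative
      (\<Sum>k=1..min (n div w) w. real (w choose k) * shf_Gamma w n k * (real k * x ^ (k - 1)))) (at x)"
    unfolding shf_phi_def[abs_def] by (auto intro!: derivative_eq_intros sum.cong)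
qed

context
  fixes \<tau> :: real
  assumes w_ge: "2 \<le> w" and n_ge: "w \<le> n"
    and \<tau>: "first_positive_solution (\<lambda>x. shf_phi w n x - x * deriv (shf_phi w n) x) \<tau>"
begin

lemma \<tau>_pos: "\<tau> > 0" and phi_\<tau>: "shf_phi w n \<tau> = \<tau> * deriv (shf_phi w n) \<tau>"
  using \<tau> by (auto simp: first_positive_solution_def)

text \<open>In \<phi>(x) - x \<phi>'(x) the constant term is 1 and the term of degree
  \<open>k\<close> is multiplied by \<open>1 - k\<close>.\<close>

lemma sum_\<tau>_eq_1: "(\<Sum>k=1..min (n div w) w. real (k - 1) * (real (w choose k) * shf_Gamma w n k * \<tau> ^ k)) = 1"
proof -
  let ?a = "\<lambda>k. real (w choose k) * shf_Gamma w n k"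
  have "\<tau> * deriv (shf_phi w n) \<tau> = (\<Sum>k=1..min (n div w) w. real k * (?a k * \<tau> ^ k))"
    unfolding deriv_shf_phi sum_distrib_left
  proof (rule sum.cong)
    fix k assume "k \<in> {1..min (n div w) w}"
    then have "\<tau> ^ k = \<tau> * \<tau> ^ (k - 1)" by (cases k) auto
    then show "\<tau> * (?a k * (real k * \<tau> ^ (k - 1))) = real k * (?a k * \<tau> ^ k)" by simp
  qed simp
  then have "(\<Sum>k=1..min (n div w) w. real k * (?a k * \<tau> ^ k)) - (\<Sum>k=1..min (n div w) w. ?a k * \<tau> ^ k) = 1"
    using phi_\<tau> unfolding shf_phi_def by linarith
  then show ?thesis
    by (simp add: sum_subtractf[symmetric] algebra_simps of_nat_diff)
qed

text \<open>Below \<open>2 * w\<close> at most the term with \<open>k = 1\<close> is present, and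
  its factor \<open>k - 1\<close> vanishes, so \<tau> could not exist. In particular
  \<open>n - w\<close> is positive and no division by zero hides in Gamma.\<close>

lemma n_ge_2w: "2 * w \<le> n"
proof (rule ccontr)
  assume "\<not> 2 * w \<le> n"
  then have "n div w < 2" using w_ge by (simp add: div_less_iff_less_mult)
  then have "(\<Sum>k=1..min (n div w) w. real (k - 1) * (real (w choose k) * shf_Gamma w n k * \<tau> ^ k)) = 0"
    by (intro sum.neutral) auto
  then show False using sum_\<tau>_eq_1 by simp
qed

text \<open>In a sum of nonnegative terms equal to 1, the term with \<open>k = 2\<close> is at most
  1, whereas \<open>shf_Gamma_2_ge\<close> puts its value at \<open>block_scale w n\<close> above
  1.\<close>

lemma \<tau>_le: "\<tau> \<le> block_scale w n"
proof -
  let ?a = "\<lambda>k. real (w choose k) * shf_Gamma w n k"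
  have wn: "w < n" using n_ge_2w w_ge by simp
  have scale: "block_scale w n > 0" using wn by (simp add: block_scale_def)
  have "2 \<le> n div w" using n_ge_2w w_ge by (simp add: less_eq_div_iff_mult_less_eq)
  then have 2: "2 \<in> {1..min (n div w) w}" using w_ge by simp
  have "real (2 - 1) * (?a 2 * \<tau> ^ 2) \<le>
      (\<Sum>k=1..min (n div w) w. real (k - 1) * (?a k * \<tau> ^ k))"
    using \<tau>_pos wn
    by (intro member_le_sum[OF 2, where f = "\<lambda>k. real (k - 1) * (?a k * \<tau> ^ k)"] mult_nonneg_nonneg)
       (auto intro!: shf_Gamma_nonneg)
  then have le1: "?a 2 * \<tau> ^ 2 \<le> 1" using sum_\<tau>_eq_1 by simp
  have "\<tau> ^ 2 * 1 \<le> \<tau> ^ 2 * (real (w choose 2) * block_scale w n ^ 2 * shf_Gamma w n 2)"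
    by (intro mult_left_mono shf_Gamma_2_ge w_ge n_ge_2w) simp
  also have "\<dots> = block_scale w n ^ 2 * (?a 2 * \<tau> ^ 2)" by (simp add: mult_ac)
  also have "\<dots> \<le> block_scale w n ^ 2 * 1" by (intro mult_left_mono le1) simp
  finally have "\<tau> ^ 2 \<le> block_scale w n ^ 2" by simp
  then show ?thesis by (rule power2_le_imp_le) (use scale in simp)
qed

definition mu :: real where
  "mu = \<tau> / (shf_M w s ws * block_scale w n)"

lemma block_scale_pos: "block_scale w n > 0"
  using n_ge_2w w_ge by (simp add: block_scale_def)

lemma mu_pos: "mu > 0"
  using \<tau>_pos shf_M_pos block_scale_pos by (simp add: mu_def)

lemma sum_mu_le: "(\<Sum>S\<in>disjoint_families n s ws. mu) \<le> real (n choose w)"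
proof -
  have "(\<Sum>S\<in>disjoint_families n s ws. mu) = real (card (disjoint_families n s ws)) * mu" by simp
  also have "\<dots> \<le> (real (n choose w) * shf_M w s ws) * (1 / shf_M w s ws)"
  proof (intro mult_mono card_disjoint_families_le n_ge)
    show "mu \<le> 1 / shf_M w s ws"
      using \<tau>_le shf_M_pos[of w s ws] block_scale_pos by (simp add: mu_def field_simps)
  qed (use mu_pos shf_M_pos[of w s ws] in auto)
  also have "\<dots> = real (n choose w)" using shf_M_pos[of w s ws] by simp
  finally show ?thesis .
qed

lemma mu_condition:
  assumes q: "shf_q w m s ws < 1"
    and N: "real N \<ge> (ln (deriv (shf_phi w n) \<tau>) + (real w - 1) * ln (real n - real w)
                  - ln (fact (w - 1)) + ln (shf_M w s ws)) / ln (1 / shf_q w m s ws)"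
    and S: "S \<in> disjoint_families n s ws"
  shows "prob S * (\<Sum>I\<in>indep_touching {S}. \<Prod>S'\<in>I. mu) \<le> mu"
proof -
  define q where "q = shf_q w m s ws"
  have q01: "0 < q" "q < 1" using assms shf_q_pos by (auto simp: q_def)
  define p where "p = deriv (shf_phi w n) \<tau>"
  have wn: "w < n" using n_ge_2w w_ge by simp
  have phi_pos: "shf_phi w n \<tau> > 0"
  proof -
    have "0 \<le> (\<Sum>k=1..min (n div w) w. real (w choose k) * shf_Gamma w n k * \<tau> ^ k)"
      using \<tau>_pos wn by (intro sum_nonneg mult_nonneg_nonneg) (auto intro!: shf_Gamma_nonneg)
    then show ?thesis unfolding shf_phi_def by linarith
  qed
  then have p: "p > 0" using phi_\<tau> \<tau>_pos by (simp add: p_def zero_less_mult_iff)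
  note pos = p shf_M_pos[of w s ws] block_scale_pos
  \<comment> \<open>The bound on \<open>N\<close> in exponential form: \<open>q ^ N\<close> times
    this product is at most 1.\<close>
  have "ln (p * (shf_M w s ws * block_scale w n)) =
      ln p + (real w - 1) * ln (real n - real w) - ln (fact (w - 1)) + ln (shf_M w s ws)"
  proof -
    have "ln (block_scale w n) = (real w - 1) * ln (real n - real w) - ln (fact (w - 1))"
      unfolding block_scale_def using wn w_ge by (simp add: ln_div ln_realpow of_nat_diff)
    then show ?thesis using pos by (simp add: ln_mult)
  qed
  also have "\<dots> \<le> real N * ln (1 / q)"
    using N q01 unfolding p_def q_def by (simp add: divide_le_eq ln_gt_zero)
  also have "\<dots> = ln (1 / q ^ N)" using q01 by (simp add: ln_div ln_realpow)
  finally have "p * (shf_M w s ws * block_scale w n) \<le> 1 / q ^ N"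
    using pos q01 by (subst (asm) ln_le_cancel_iff) auto
  then have key: "q ^ N * p \<le> 1 / (shf_M w s ws * block_scale w n)"
    using pos q01 by (simp add: field_simps)
  have "prob S * (\<Sum>I\<in>indep_touching {S}. \<Prod>S'\<in>I. mu) \<le> q ^ N * shf_phi w n \<tau>"
    using sum_indep_touching_le[OF S wn less_imp_le[OF \<tau>_pos]] prob_le[OF S] q01 mu_pos
    unfolding mu_def[symmetric] q_def[symmetric]
    by (intro mult_mono sum_nonneg prod_nonneg) auto
  \<comment> \<open>The defining equation of \<tau> trades \<phi>(\<tau>) for its
    derivative.\<close>
  also have "\<dots> = \<tau> * (q ^ N * p)" by (simp add: phi_\<tau> p_def)
  also have "\<dots> \<le> \<tau> * (1 / (shf_M w s ws * block_scale w n))"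
    using key \<tau>_pos by (intro mult_left_mono) auto
  finally show ?thesis by (simp add: mu_def)
qed

end

section \<open>Polynomial running time\<close>

lemma check_time_le:
  assumes w: "2 \<le> w" and n: "w \<le> n"
  shows "real (check_time N n s ws) \<le> 2 * fact w * real w ^ 2 * (real N * real n ^ w)"
proof -
  have pairs: "(\<Sum>r=1..s. \<Sum>r'=Suc r..s. ws r * ws r') \<le> w ^ 2"
  proof -
    have "(\<Sum>r=1..s. \<Sum>r'=Suc r..s. ws r * ws r') \<le> (\<Sum>r=1..s. \<Sum>r'=1..s. ws r * ws r')"
      by (intro sum_mono sum_mono2) auto
    also have "\<dots> = w * w" using ws_sum by (simp add: sum_product[symmetric])
    finally show ?thesis by (simp add: power2_eq_square)
  qed
  \<comment> \<open>Listing the columns costs no more than the bound for the comparisons, which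
    explains the factor 2.\<close>
  have "w \<le> N * w ^ 2"
    using mult_le_mono[of 1 N "w * 1" "w * w"] N_pos w by (simp add: power2_eq_square)
  then have "(\<Sum>r=1..s. ws r) + N * (\<Sum>r=1..s. \<Sum>r'=Suc r..s. ws r * ws r') \<le> 2 * (N * w ^ 2)"
    using mult_le_mono2[OF pairs, of N] unfolding ws_sum by linarith
  then have "real ((\<Sum>r=1..s. ws r) + N * (\<Sum>r=1..s. \<Sum>r'=Suc r..s. ws r * ws r')) \<le> real (2 * (N * w ^ 2))"
    by (rule of_nat_mono)
  moreover have "real (card (disjoint_families n s ws)) \<le> real n ^ w * fact w"
  proof -
    have "real (card (disjoint_families n s ws)) \<le> real (n choose w) * shf_M w s ws"
      by (rule card_disjoint_families_le[OF n])
    also have "\<dots> \<le> real n ^ w * fact w"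
      using binomial_le_pow[OF n] shf_M_pos[of w s ws]
      by (intro mult_mono shf_M_le) (auto simp flip: of_nat_power)
    finally show ?thesis .
  qed
  ultimately have "real (check_time N n s ws) \<le> (real n ^ w * fact w) * real (2 * (N * w ^ 2))"
    unfolding check_time_def of_nat_mult[of "card _"]
    by (intro mult_mono) (auto simp del: of_nat_add of_nat_mult of_nat_sum)
  then show ?thesis by (simp add: mult_ac)
qed

end

lemma poly3_monomial:
  assumes "a \<le> d" "b \<le> d" "e \<le> d"
  shows "poly3 d (\<lambda>i j k. if i = a \<and> j = b \<and> k = e then C else 0) x y z = C * x ^ a * y ^ b * z ^ e"
proof -
  have "(\<Sum>k\<le>d. (if i = a \<and> j = b \<and> k = e then C else 0) * x ^ i * y ^ j * z ^ k) =
      (if j = b then if i = a then C * x ^ a * y ^ b * z ^ e else 0 else 0)" for i j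
    using assms by (simp add: if_distrib[where f = "\<lambda>c. c * _"] sum.delta cong: if_cong)
  then show ?thesis using assms by (simp add: poly3_def)
qed

theorem theorem1p3:
  fixes w :: nat
  assumes "2 \<le> w"
  shows "\<exists>(d::nat) (c :: nat \<Rightarrow> nat \<Rightarrow> nat \<Rightarrow> real).
    \<forall>(N::nat) (n::nat) (m::nat) (s::nat) (ws :: nat \<Rightarrow> nat) (\<tau>::real).
      0 < N \<and> 0 < n \<and> 0 < m \<and> w \<le> n \<and>
      2 \<le> s \<and> (\<forall>i\<in>{1..s}. 0 < ws i) \<and> (\<Sum>i=1..s. ws i) = w \<and>
      first_positive_solution (\<lambda>x. shf_phi w n x - x * deriv (shf_phi w n) x) \<tau> \<and>
      shf_q w m s ws < 1 \<and>
      real N \<ge> (ln (deriv (shf_phi w n) \<tau>) + (real w - 1) * ln (real n - real w)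
                  - ln (fact (w - 1)) + ln (shf_M w s ws)) / ln (1 / shf_q w m s ws)
      \<longrightarrow>
      (\<exists>A. is_SHF N n m s ws A) \<and>
      (\<forall>sel. valid_selection N n m s ws sel \<longrightarrow>
         (AE \<omega> in randomness N n m.
            mt_stops N n s ws sel \<omega> \<and> is_SHF N n m s ws (mt_output N n s ws sel \<omega>)) \<and>
         expected_mt_time N n m s ws sel \<le> ennreal (poly3 d c (real N) (real n) (real m)))"
proof -
  define c0 :: real where "c0 = 2 * fact w * real w ^ 2"
  \<comment> \<open>1 for drawing the first matrix, \<open>c0\<close> for the first check,
    \<open>c0 + w\<close> for each resampling with the check after it. One check costs order
    \<open>N * n ^ w\<close> and at most \<open>n ^ w\<close> resamplings are expected, hence the
    degree \<open>2 * w\<close> in \<open>n\<close>.\<close>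
  define C where "C = 1 + 2 * c0 + real w"
  define c where "c = (\<lambda>(i::nat) (j::nat) (k::nat). if i = 1 \<and> j = 2 * w \<and> k = 0 then C else (0::real))"
  have "(\<exists>A. is_SHF N n m s ws A) \<and>
      (\<forall>sel. valid_selection N n m s ws sel \<longrightarrow>
         (AE \<omega> in randomness N n m.
            mt_stops N n s ws sel \<omega> \<and> is_SHF N n m s ws (mt_output N n s ws sel \<omega>)) \<and>
         expected_mt_time N n m s ws sel \<le> ennreal (poly3 (2 * w) c (real N) (real n) (real m)))"
    if N: "0 < N" and n: "0 < n" and m: "0 < m" and wn: "w \<le> n" and s: "2 \<le> s"
      and ws: "\<forall>i\<in>{1..s}. 0 < ws i" "(\<Sum>i=1..s. ws i) = w"
      and \<tau>: "first_positive_solution (\<lambda>x. shf_phi w n x - x * deriv (shf_phi w n) x) \<tau>"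
      and q: "shf_q w m s ws < 1"
      and bound: "real N \<ge> (ln (deriv (shf_phi w n) \<tau>) + (real w - 1) * ln (real n - real w)
                  - ln (fact (w - 1)) + ln (shf_M w s ws)) / ln (1 / shf_q w m s ws)"
    for N n m s ws \<tau>
  proof -
    interpret shf N n m s w ws
      using N m s ws by unfold_locales auto
    note mu = mu_pos[OF assms wn \<tau>] mu_condition[OF assms wn \<tau> q bound] sum_mu_le[OF assms wn \<tau>]
    have AE: "AE \<omega> in randomness N n m.
        mt_stops N n s ws sel \<omega> \<and> is_SHF N n m s ws (mt_output N n s ws sel \<omega>)"
      if "valid_selection N n m s ws sel" for sel
      by (rule AE_mt_stops[OF that, where \<mu> = "\<lambda>_. mu \<tau>"]) (use mu in auto)
    have "\<exists>A. is_SHF N n m s ws A"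
    proof -
      \<comment> \<open>Existence follows from running the algorithm with some valid rule: an almost
        sure statement on a probability space that does not mention \<omega> is true.\<close>
      define sel where "sel h = (SOME S. S \<in> disjoint_families n s ws \<and> bad_event N S (last h))" for h
      have "valid_selection N n m s ws sel"
        unfolding valid_selection_def
      proof (intro allI impI, elim conjE)
        fix h assume "some_bad N n s ws (last h)"
        then have "\<exists>S. S \<in> disjoint_families n s ws \<and> bad_event N S (last h)"
          unfolding some_bad_def by (simp only: Bex_def)
        from someI_ex[OF this] show "sel h \<in> disjoint_families n s ws \<and> bad_event N (sel h) (last h)"
          by (simp only: sel_def)
      qed
      from AE[OF this] have "AE \<omega> in seq.S. \<exists>A. is_SHF N n m s ws A"
        unfolding randomness_eq by eventually_elim blast
      then show ?thesis by (simp add: seq.P.AE_const)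
    qed
    moreover have "expected_mt_time N n m s ws sel \<le> ennreal (poly3 (2 * w) c (real N) (real n) (real m))"
      if sel: "valid_selection N n m s ws sel" for sel
    proof -
      let ?c = "real (check_time N n s ws)" and ?r = "real (resample_time N s ws)"
      let ?E = "\<Sum>S\<in>disjoint_families n s ws. mu \<tau>"
      define P where "P = real N * real n ^ (2 * w)"
      define Q where "Q = real N * real n ^ w"
      have "expected_mt_time N n m s ws sel \<le>
          ennreal (real (N * n + check_time N n s ws) +
            real (check_time N n s ws + resample_time N s ws) * ?E)"
        by (rule expected_mt_time_le[OF sel, where \<mu> = "\<lambda>_. mu \<tau>"]) (use mu in auto)
      also have "\<dots> \<le> ennreal (C * P)"
      proof (rule ennreal_leI)
        have n1: "1 \<le> real n ^ w" "real n \<le> real n ^ (2 * w)"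
          using n assms power_increasing[of 1 "2 * w" "real n"] by auto
        have QP: "Q \<le> P" "Q * real n ^ w = P"
          using n by (auto simp: P_def Q_def power_add mult_2 intro!: mult_left_mono power_increasing)
        have c: "?c \<le> c0 * Q" unfolding c0_def Q_def by (rule check_time_le[OF assms wn])
        have E: "?E \<le> real n ^ w"
          using mu(3) binomial_le_pow[OF wn] by (simp flip: of_nat_power)
        have "real N * real w * 1 \<le> real N * real w * real n ^ w"
          by (intro mult_left_mono n1) simp
        then have r: "?r \<le> real w * Q"
          unfolding resample_time_def ws_sum by (simp add: Q_def mult_ac)
        have "real N * real n \<le> P" unfolding P_def by (intro mult_left_mono n1) simp
        moreover have "c0 * Q \<le> c0 * P" by (intro mult_left_mono QP) (simp add: c0_def)
        moreover have "(?c + ?r) * ?E \<le> (c0 * Q + real w * Q) * real n ^ w"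
          by (rule mult_mono[OF add_mono[OF c r] E]) (use mu(1) in \<open>auto simp: c0_def Q_def\<close>)
        moreover have "(c0 * Q + real w * Q) * real n ^ w = (c0 + real w) * P"
          unfolding QP(2)[symmetric] by (simp add: algebra_simps)
        ultimately show "real (N * n + check_time N n s ws) +
            real (check_time N n s ws + resample_time N s ws) * ?E \<le> C * P"
          using c by (simp add: C_def algebra_simps)
      qed
      also have "C * P = poly3 (2 * w) c (real N) (real n) (real m)"
        unfolding c_def P_def using assms by (subst poly3_monomial) auto
      finally show ?thesis .
    qed
    ultimately show ?thesis using AE by blast
  qed
  then show ?thesis by (intro exI[of _ "2 * w"] exI[of _ c]) blast
qed

end
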